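(* Let $L\ge2$, let $\ell(x)=\ln(1+e^{-x})$ be the logistic loss, and suppose Assumptions 2, 3 and 5 hold (with $\beta=1/4$, $G=1$ in the definition of $\beta(R)$). Then for Lebesgue-almost every data set (i.e. with probability one when the data points are drawn from a distribution with a density with respect to Lebesgue measure), the gradient descent iterates satisfy $\lim_{t\to\infty}|\langle v_1(t),\bar u\rangle|=1$ and $\lim_{t\to\infty}\frac{w_{\mathrm{prod}}(t)}{\prod_{k=1}^L\|W_k(t)\|_F}=\bar u$.
   Context: Setting: data $(x_i,y_i)_{i=1}^n$ with $x_i\in\mathbb{R}^d$, $\|x_i\|\le 1$, $y_i\in\{-1,+1\}$; $z_i:=y_ix_i$; the data are linearly separable. $\gamma:=\max_{\|u\|=1}\min_i\langle u,z_i\rangle>0$ and $\bar u$ is the unique unit vector attaining it. A depth-$L$ linear network is $W=(W_L,\dots,W_1)$ with $W_k\in\mathbb{R}^{d_k\times d_{k-1}}$, $d_0=d$, $d_L=1$, $w_{\mathrm{prod}}:=(W_L\cdots W_1)^\top$, and $\mathcal{R}(W)=\frac1n\sum_{i=1}^n\ell(\langle w_{\mathrm{prod}},z_i\rangle)$. $B(R):=\{W:\max_k\|W_k\|_F\le R\}$. Gradient descent: $W(t+1)=W(t)-\eta_t\nabla\mathcal{R}(W(t))$, $t=0,1,2,\dots$. Assumption 2: $\nabla\mathcal{R}(W(0))\ne0$ and $\mathcal{R}(W(0))\le\ell(0)$. Assumption 3: the $z_i$ with $\langle\bar u,z_i\rangle=\gamma$ span $\mathbb{R}^d$. With $\beta$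 a Lipschitz constant of $\ell'$ and $G$ a bound on $|\ell'|$, $\beta(R):=2L^2R^{2L-2}(\beta+G)$. Assumption 5: $\eta_t=\min\{1/\beta(R_t),1\}$, where the radii $R_t$ satisfy $W(t)\in B(R_t-1)$ for every $t$, and $R_{t+1}=R_t$ whenever $W(t+1)\in B(R_t-1)$. $v_1(t)$ is a first (top) right unit singular vector of $W_1(t)$. *)

theory Defs
  imports "HOL-Analysis.Analysis"
begin

text \<open>Conventions. Vectors in R^m are functions nat => real whose relevant entries are
the indices below m. A d_k x d_(k-1) matrix is a function nat => nat => real
(row index, column index). A depth-L network is a function
W :: nat => nat => nat => real, where W k is the k-th layer matrix (k = 1..L),
with all entries outside the index ranges equal to 0.\<close>

definition vinner :: "nat \<Rightarrow> (nat \<Rightarrow> real) \<Rightarrow> (nat \<Rightarrow> real) \<Rightarrow> real" where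
  "vinner m u v = (\<Sum>j<m. u j * v j)"

definition vnorm :: "nat \<Rightarrow> (nat \<Rightarrow> real) \<Rightarrow> real" where
  "vnorm m u = sqrt (vinner m u u)"

definition unit_vec :: "nat \<Rightarrow> (nat \<Rightarrow> real) \<Rightarrow> bool" where
  "unit_vec m u \<longleftrightarrow> vnorm m u = 1 \<and> (\<forall>j\<ge>m. u j = 0)"

definition margin :: "nat \<Rightarrow> nat \<Rightarrow> (nat \<Rightarrow> nat \<Rightarrow> real) \<Rightarrow> (nat \<Rightarrow> real) \<Rightarrow> real" where
  "margin n d z u = Min ((\<lambda>i. vinner d u (z i)) ` {..<n})"

definition ubar :: "nat \<Rightarrow> nat \<Rightarrow> (nat \<Rightarrow> nat \<Rightarrow> real) \<Rightarrow> (nat \<Rightarrow> real)" where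
  "ubar n d z = (THE u. unit_vec d u \<and> (\<forall>v. unit_vec d v \<longrightarrow> margin n d z v \<le> margin n d z u))"

definition gamma :: "nat \<Rightarrow> nat \<Rightarrow> (nat \<Rightarrow> nat \<Rightarrow> real) \<Rightarrow> real" where
  "gamma n d z = margin n d z (ubar n d z)"

definition lin_separable :: "nat \<Rightarrow> nat \<Rightarrow> (nat \<Rightarrow> nat \<Rightarrow> real) \<Rightarrow> bool" where
  "lin_separable n d z \<longleftrightarrow> (\<exists>u. \<forall>i<n. vinner d u (z i) > 0)"

definition assumption3 :: "nat \<Rightarrow> nat \<Rightarrow> (nat \<Rightarrow> nat \<Rightarrow> real) \<Rightarrow> bool" where
  "assumption3 n d z \<longleftrightarrow>
     (\<forall>v::nat \<Rightarrow> real. \<exists>c::nat \<Rightarrow> real. \<forall>j<d.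
        v j = (\<Sum>i\<in>{i. i < n \<and> vinner d (ubar n d z) (z i) = gamma n d z}. c i * z i j))"

definition logistic :: "real \<Rightarrow> real" where
  "logistic x = ln (1 + exp (- x))"

text \<open>Well-formed network: widths dk 0 = d, ..., dk L = 1; entries outside ranges are 0.\<close>
definition wf_net :: "nat \<Rightarrow> (nat \<Rightarrow> nat) \<Rightarrow> (nat \<Rightarrow> nat \<Rightarrow> nat \<Rightarrow> real) \<Rightarrow> bool" where
  "wf_net L dk W \<longleftrightarrow>
     (\<forall>k i j. \<not> (1 \<le> k \<and> k \<le> L \<and> i < dk k \<and> j < dk (k - 1)) \<longrightarrow> W k i j = 0)"

fun chain :: "(nat \<Rightarrow> nat) \<Rightarrow> (nat \<Rightarrow> nat \<Rightarrow> nat \<Rightarrow> real) \<Rightarrow> nat \<Rightarrow> nat \<Rightarrow> nat \<Rightarrow> real" where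
  "chain dk W 0 = (\<lambda>i j. if i = j \<and> j < dk 0 then 1 else 0)"
| "chain dk W (Suc k) = (\<lambda>i j. \<Sum>l<dk k. W (Suc k) i l * chain dk W k l j)"

definition wprod :: "nat \<Rightarrow> (nat \<Rightarrow> nat) \<Rightarrow> (nat \<Rightarrow> nat \<Rightarrow> nat \<Rightarrow> real) \<Rightarrow> nat \<Rightarrow> real" where
  "wprod L dk W = (\<lambda>j. chain dk W L 0 j)"

definition risk :: "(real \<Rightarrow> real) \<Rightarrow> nat \<Rightarrow> nat \<Rightarrow> (nat \<Rightarrow> nat \<Rightarrow> real) \<Rightarrow> nat \<Rightarrow> (nat \<Rightarrow> nat)
                    \<Rightarrow> (nat \<Rightarrow> nat \<Rightarrow> nat \<Rightarrow> real) \<Rightarrow> real" where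
  "risk loss n d z L dk W = (1 / real n) * (\<Sum>i<n. loss (vinner d (wprod L dk W) (z i)))"

definition grad :: "nat \<Rightarrow> (nat \<Rightarrow> nat) \<Rightarrow> ((nat \<Rightarrow> nat \<Rightarrow> nat \<Rightarrow> real) \<Rightarrow> real)
                    \<Rightarrow> (nat \<Rightarrow> nat \<Rightarrow> nat \<Rightarrow> real) \<Rightarrow> nat \<Rightarrow> nat \<Rightarrow> nat \<Rightarrow> real" where
  "grad L dk F W = (\<lambda>k i j.
     if 1 \<le> k \<and> k \<le> L \<and> i < dk k \<and> j < dk (k - 1)
     then deriv (\<lambda>s. F (W(k := (W k)(i := (W k i)(j := s))))) (W k i j)
     else 0)"

definition frob :: "(nat \<Rightarrow> nat) \<Rightarrow> (nat \<Rightarrow> nat \<Rightarrow> nat \<Rightarrow> real) \<Rightarrow> nat \<Rightarrow> real" where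
  "frob dk W k = sqrt (\<Sum>i<dk k. \<Sum>j<dk (k - 1). (W k i j)\<^sup>2)"

definition in_ball :: "nat \<Rightarrow> (nat \<Rightarrow> nat) \<Rightarrow> real \<Rightarrow> (nat \<Rightarrow> nat \<Rightarrow> nat \<Rightarrow> real) \<Rightarrow> bool" where
  "in_ball L dk R W \<longleftrightarrow> (\<forall>k\<in>{1..L}. frob dk W k \<le> R)"

definition betaR :: "nat \<Rightarrow> real \<Rightarrow> real \<Rightarrow> real \<Rightarrow> real" where
  "betaR L b G R = 2 * (real L)\<^sup>2 * R ^ (2 * L - 2) * (b + G)"

definition top_right_sing_vec :: "nat \<Rightarrow> nat \<Rightarrow> (nat \<Rightarrow> nat \<Rightarrow> real) \<Rightarrow> (nat \<Rightarrow> real) \<Rightarrow> bool" where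
  "top_right_sing_vec p m A v \<longleftrightarrow>
     (let AtA = (\<lambda>v. \<lambda>j. if j < m then \<Sum>i<p. A i j * (\<Sum>l<m. A i l * v l) else 0) in
      unit_vec m v \<and>
      (\<exists>lam. AtA v = (\<lambda>j. lam * v j) \<and>
           (\<forall>\<mu> w. unit_vec m w \<and> AtA w = (\<lambda>j. \<mu> * w j) \<longrightarrow> \<mu> \<le> lam)))"

end

theory Submission
  imports Defs
begin

text \<open>Gradient descent with these step sizes decreases the risk by at least \<open>\<eta> |\<nabla>R|\<^sup>2 / 2\<close>, so
  \<open>\<Sum> \<eta> |\<nabla>R|\<^sup>2\<close> is finite. Hence the matrices \<open>W\<^bsub>k+1\<^esub>\<^sup>T W\<^bsub>k+1\<^esub> - W\<^sub>k W\<^sub>k\<^sup>T\<close>, which gradient flow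
  would conserve, stay bounded. If the risk stayed above a positive constant, the gradient would be
  bounded below, so the iterates, and then the radii, would be bounded and the step sizes bounded below,
  contradicting summability. So the risk tends to \<open>0\<close> and all layers diverge; by the bounded imbalance
  they become rank one and aligned.

  The direction is controlled through the part of \<open>W\<^sub>1\<close> orthogonal to the maximum margin direction
  \<open>u\<close>. For almost all data, every nonzero \<open>\<xi> \<bottom> u\<close> has a negative inner product with some
  support vector, so for the logistic loss the risk decreases towards \<open>u\<close> as soon as the component of
  the product orthogonal to \<open>u\<close> exceeds a constant. By alignment this keeps the orthogonal part of
  \<open>W\<^sub>1\<close> bounded while \<open>|W\<^sub>1| \<rightarrow> \<infinity>\<close>.\<close>

section \<open>Vectors, matrices and networks\<close>

text \<open>The step sizes have no a priori lower bound, since they shrink as the radii grow. What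
  is always available is a finite sum of \<open>eta s * grad_sq (W s)\<close>. As
  \<open>eta s \<le> 1\<close>, it also bounds the sum of
  \<open>(eta s)\<^sup>2 * grad_sq (W s)\<close>, which is the discretization error of both
  controlled quantities, the imbalance and the off-axis part of the first layer. A gradient bound
  needs more than a large risk, because the zero network is a critical point. By Assumption 2 the
  first step pushes the risk strictly below that of the zero network. Monotonicity then keeps the
  product away from 0, and with it the factor \<open>bwd\<close> in the gradient of the first layer.
  Assumption 3 gives, for \<xi> orthogonal to the maximum margin direction, only some support vector
  with nonzero inner product. The negative sign comes from \<open>degenerate\<close> being excluded,
  and this is the only place where "almost every data set" enters. Smoothness is obtained from an
  exact telescoping of the difference of two matrix products, so no Hessian of the network
  appears.\<close>

lemma vinner_commute: "vinner m u v = vinner m v u"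
  by (simp add: vinner_def mult.commute)

lemma vinner_add_left: "vinner m (\<lambda>j. u j + v j) w = vinner m u w + vinner m v w"
  by (simp add: vinner_def sum.distrib algebra_simps)

lemma vinner_add_right: "vinner m w (\<lambda>j. u j + v j) = vinner m w u + vinner m w v"
  by (simp add: vinner_def sum.distrib algebra_simps)

lemma vinner_diff_left: "vinner m (\<lambda>j. u j - v j) w = vinner m u w - vinner m v w"
  by (simp add: vinner_def sum_subtractf algebra_simps)

lemma vinner_diff_right: "vinner m w (\<lambda>j. u j - v j) = vinner m w u - vinner m w v"
  by (simp add: vinner_def sum_subtractf algebra_simps)

lemma vinner_scale_left: "vinner m (\<lambda>j. c * u j) w = c * vinner m u w"
  by (simp add: vinner_def sum_distrib_left algebra_simps)

lemma vinner_scale_right: "vinner m w (\<lambda>j. c * u j) = c * vinner m w u"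
  by (simp add: vinner_def sum_distrib_left algebra_simps)

lemma vinner_sum_left: "vinner m (\<lambda>j. \<Sum>i\<in>I. f i j) w = (\<Sum>i\<in>I. vinner m (f i) w)"
  unfolding vinner_def by (simp add: sum_distrib_right) (rule sum.swap)

lemma vinner_sum_right: "vinner m w (\<lambda>j. \<Sum>i\<in>I. f i j) = (\<Sum>i\<in>I. vinner m w (f i))"
  by (subst (1 2) vinner_commute) (rule vinner_sum_left)

lemmas vinner_linear = vinner_add_left vinner_add_right vinner_diff_left vinner_diff_right
  vinner_scale_left vinner_scale_right

lemma vinner_cong: "(\<And>j. j < m \<Longrightarrow> u j = u' j) \<Longrightarrow> (\<And>j. j < m \<Longrightarrow> v j = v' j) \<Longrightarrow> vinner m u v = vinner m u' v'"
  by (simp add: vinner_def)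

lemma vinner_self_ge0 [simp]: "0 \<le> vinner m u u"
  by (simp add: vinner_def sum_nonneg)

lemma vinner_self_eq_sum: "vinner m u u = (\<Sum>j<m. (u j)\<^sup>2)"
  by (simp add: vinner_def power2_eq_square)

lemma vinner_self_eq0: "vinner m u u = 0 \<longleftrightarrow> (\<forall>j<m. u j = 0)"
  by (auto simp: vinner_self_eq_sum sum_nonneg_eq_0_iff)

lemma vinner_Cauchy_Schwarz: "(vinner m u v)\<^sup>2 \<le> vinner m u u * vinner m v v"
  unfolding vinner_self_eq_sum unfolding vinner_def by (rule Cauchy_Schwarz_ineq_sum)

lemma vnorm_eq_L2: "vnorm m u = L2_set u {..<m}"
  by (simp add: vnorm_def vinner_self_eq_sum L2_set_def)

lemma vnorm_ge0 [simp]: "0 \<le> vnorm m u"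
  by (simp add: vnorm_def)

lemma vnorm_sq: "(vnorm m u)\<^sup>2 = vinner m u u"
  by (simp add: vnorm_def)

lemma vnorm_triangle: "vnorm m (\<lambda>j. u j + v j) \<le> vnorm m u + vnorm m v"
  unfolding vnorm_eq_L2 by (rule L2_set_triangle_ineq)

lemma vinner_abs_le: "\<bar>vinner m u v\<bar> \<le> vnorm m u * vnorm m v"
proof -
  have "\<bar>vinner m u v\<bar> = sqrt ((vinner m u v)\<^sup>2)" by simp
  also have "\<dots> \<le> sqrt (vinner m u u * vinner m v v)"
    by (intro real_sqrt_le_mono vinner_Cauchy_Schwarz)
  finally show ?thesis by (simp add: vnorm_def real_sqrt_mult)
qed

lemma vnorm_scale: "vnorm m (\<lambda>j. c * u j) = \<bar>c\<bar> * vnorm m u"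
  by (simp add: vnorm_def vinner_linear real_sqrt_mult flip: mult.assoc)

lemma vnorm_sum: "vnorm m (\<lambda>j. \<Sum>i\<in>I. f i j) \<le> (\<Sum>i\<in>I. vnorm m (f i))"
proof (induction I rule: infinite_finite_induct)
  case (insert i I)
  have "vnorm m (\<lambda>j. f i j + (\<Sum>i\<in>I. f i j)) \<le> vnorm m (f i) + vnorm m (\<lambda>j. \<Sum>i\<in>I. f i j)"
    by (rule vnorm_triangle)
  with insert show ?case by simp
qed (simp_all add: vnorm_def vinner_def)

lemma vinner_indicator_right:
  "c < m \<Longrightarrow> vinner m u (\<lambda>j. if j = c then 1 else 0) = u c"
  by (simp add: vinner_def if_distrib cong: if_cong)

section \<open>Matrix-vector products and Frobenius norms\<close>

definition mat_vec :: "nat \<Rightarrow> (nat \<Rightarrow> nat \<Rightarrow> real) \<Rightarrow> (nat \<Rightarrow> real) \<Rightarrow> nat \<Rightarrow> real" where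
  "mat_vec m A x = (\<lambda>i. \<Sum>j<m. A i j * x j)"

definition vec_mat :: "nat \<Rightarrow> (nat \<Rightarrow> real) \<Rightarrow> (nat \<Rightarrow> nat \<Rightarrow> real) \<Rightarrow> nat \<Rightarrow> real" where
  "vec_mat p x A = (\<lambda>j. \<Sum>i<p. x i * A i j)"

definition frob_sq :: "nat \<Rightarrow> nat \<Rightarrow> (nat \<Rightarrow> nat \<Rightarrow> real) \<Rightarrow> real" where
  "frob_sq p m A = (\<Sum>i<p. \<Sum>j<m. (A i j)\<^sup>2)"

lemma frob_sq_ge0 [simp]: "0 \<le> frob_sq p m A"
  by (simp add: frob_sq_def sum_nonneg)

lemma frob_ge0 [simp]: "0 \<le> frob dk W k"
  by (simp add: frob_def sum_nonneg)

lemma frob_power2: "(frob dk W k)\<^sup>2 = frob_sq (dk k) (dk (k - 1)) (W k)"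
  by (simp add: frob_def frob_sq_def sum_nonneg)

lemma frob_sq_rows: "frob_sq p m A = (\<Sum>i<p. vinner m (A i) (A i))"
  by (simp add: frob_sq_def vinner_self_eq_sum)

lemma mat_vec_row: "mat_vec m A x i = vinner m (A i) x"
  by (simp add: mat_vec_def vinner_def)

lemma vinner_mat_vec: "vinner p x (mat_vec m A y) = vinner m (vec_mat p x A) y"
  unfolding vinner_def mat_vec_def vec_mat_def
  by (simp add: sum_distrib_left sum_distrib_right mult.assoc) (rule sum.swap)

lemma mat_vec_self: "vinner p (mat_vec m A y) (mat_vec m A y) = (\<Sum>i<p. (vinner m (A i) y)\<^sup>2)"
  by (simp add: vinner_self_eq_sum mat_vec_row)

lemma mat_vec_bound:
  "vinner p (mat_vec m A y) (mat_vec m A y) \<le> frob_sq p m A * vinner m y y"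
  unfolding mat_vec_self frob_sq_rows sum_distrib_right
  by (intro sum_mono vinner_Cauchy_Schwarz)

lemma vec_mat_bound:
  "vinner m (vec_mat p x A) (vec_mat p x A) \<le> frob_sq p m A * vinner p x x"
proof -
  have "vinner m (vec_mat p x A) (vec_mat p x A) = vinner m (mat_vec p (\<lambda>j i. A i j) x) (mat_vec p (\<lambda>j i. A i j) x)"
    by (simp add: vec_mat_def mat_vec_def mult.commute)
  also have "\<dots> \<le> frob_sq m p (\<lambda>j i. A i j) * vinner p x x" by (rule mat_vec_bound)
  also have "frob_sq m p (\<lambda>j i. A i j) = frob_sq p m A"
    unfolding frob_sq_def by (rule sum.swap)
  finally show ?thesis .
qed

lemma vnorm_mat_vec_le: "vnorm p (mat_vec m A y) \<le> sqrt (frob_sq p m A) * vnorm m y"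
  unfolding vnorm_def real_sqrt_mult[symmetric] by (intro real_sqrt_le_mono mat_vec_bound)

lemma vnorm_vec_mat_le: "vnorm m (vec_mat p x A) \<le> sqrt (frob_sq p m A) * vnorm p x"
  unfolding vnorm_def real_sqrt_mult[symmetric] by (intro real_sqrt_le_mono vec_mat_bound)

lemma frob_sqrt: "frob dk W (Suc k) = sqrt (frob_sq (dk (Suc k)) (dk k) (W (Suc k)))"
  by (simp add: frob_def frob_sq_def)

lemma mat_vec_add: "mat_vec m A (\<lambda>j. x j + y j) = (\<lambda>i. mat_vec m A x i + mat_vec m A y i)"
  by (simp add: mat_vec_def sum.distrib algebra_simps)

lemma mat_vec_diff: "mat_vec m A (\<lambda>j. x j - y j) = (\<lambda>i. mat_vec m A x i - mat_vec m A y i)"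
  by (simp add: mat_vec_def sum_subtractf algebra_simps)

lemma mat_vec_scale: "mat_vec m A (\<lambda>j. c * x j) = (\<lambda>i. c * mat_vec m A x i)"
  by (simp add: mat_vec_def sum_distrib_left algebra_simps)

text \<open>Forward pass \<open>W\<^sub>k \<cdots> W\<^sub>1 x\<close> and the row vector \<open>p\<^sub>k = W\<^sub>L \<cdots> W\<^bsub>k+1\<^esub>\<close>. In these terms the
  gradient of the risk in layer \<open>k\<close> is the rank-one matrix \<open>p\<^sub>k\<^sup>T (W\<^bsub>k-1\<^esub> \<cdots> W\<^sub>1 g)\<^sup>T\<close>.\<close>

fun fwd :: "(nat \<Rightarrow> nat) \<Rightarrow> (nat \<Rightarrow> nat \<Rightarrow> nat \<Rightarrow> real) \<Rightarrow> (nat \<Rightarrow> real) \<Rightarrow> nat \<Rightarrow> nat \<Rightarrow> real" where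
  "fwd dk W x 0 = x"
| "fwd dk W x (Suc k) = mat_vec (dk k) (W (Suc k)) (fwd dk W x k)"

text \<open>The recursion runs downwards from the output layer, so its argument counts the layers
  already multiplied; \<open>bwd\<close> turns this into the layer index. The start is the row
  vector 1, the output having width one.\<close>

fun bwd_aux :: "nat \<Rightarrow> (nat \<Rightarrow> nat) \<Rightarrow> (nat \<Rightarrow> nat \<Rightarrow> nat \<Rightarrow> real) \<Rightarrow> nat \<Rightarrow> nat \<Rightarrow> real" where
  "bwd_aux L dk W 0 = (\<lambda>i. if i = 0 then 1 else 0)"
| "bwd_aux L dk W (Suc m) = vec_mat (dk (L - m)) (bwd_aux L dk W m) (W (L - m))"

definition bwd :: "nat \<Rightarrow> (nat \<Rightarrow> nat) \<Rightarrow> (nat \<Rightarrow> nat \<Rightarrow> nat \<Rightarrow> real) \<Rightarrow> nat \<Rightarrow> nat \<Rightarrow> real" where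
  "bwd L dk W k = bwd_aux L dk W (L - k)"

lemma bwd_top: "bwd L dk W L = (\<lambda>i. if i = 0 then 1 else 0)"
  by (simp add: bwd_def)

lemma bwd_step: "k < L \<Longrightarrow> bwd L dk W k = vec_mat (dk (Suc k)) (bwd L dk W (Suc k)) (W (Suc k))"
  by (simp add: bwd_def Suc_diff_Suc[symmetric])

text \<open>At level 0, \<open>chain\<close> is cut off at \<open>dk 0\<close> while
  \<open>fwd\<close> returns \<open>x\<close> uncut, hence the side condition on \<open>i\<close>
  there. From level 1 on, only indices below \<open>dk 0\<close> enter the sums.\<close>

lemma fwd_chain: "fwd dk W x k i = (\<Sum>j<dk 0. chain dk W k i j * x j)"
  if "k = 0 \<Longrightarrow> i < dk 0"
  using that
proof (induction k arbitrary: i)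
  case 0
  have "(\<Sum>j<dk 0. (if i = j \<and> j < dk 0 then 1 else 0) * x j) = (\<Sum>j<dk 0. if j = i then x j else 0)"
    by (intro sum.cong) auto
  with 0 show ?case by simp
next
  case (Suc k)
  have "fwd dk W x (Suc k) i = (\<Sum>l<dk k. W (Suc k) i l * (\<Sum>j<dk 0. chain dk W k l j * x j))"
    unfolding fwd.simps mat_vec_def
  proof (intro sum.cong refl)
    fix l assume "l \<in> {..<dk k}"
    then show "W (Suc k) i l * fwd dk W x k l = W (Suc k) i l * (\<Sum>j<dk 0. chain dk W k l j * x j)"
      by (subst Suc.IH) auto
  qed
  also have "\<dots> = (\<Sum>j<dk 0. chain dk W (Suc k) i j * x j)"
    by (simp add: sum_distrib_left sum_distrib_right mult.assoc) (rule sum.swap)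
  finally show ?case .
qed

lemma fwd_linear: "fwd dk W (\<lambda>j. \<Sum>i\<in>I. c i * f i j) k l = (\<Sum>i\<in>I. c i * fwd dk W (f i) k l)"
proof (induction k arbitrary: l)
  case (Suc k)
  have "fwd dk W (\<lambda>j. \<Sum>i\<in>I. c i * f i j) (Suc k) l
      = (\<Sum>j<dk k. \<Sum>i\<in>I. c i * (W (Suc k) l j * fwd dk W (f i) k j))"
    by (simp add: mat_vec_def Suc.IH sum_distrib_left mult.left_commute)
  also have "\<dots> = (\<Sum>i\<in>I. \<Sum>j<dk k. c i * (W (Suc k) l j * fwd dk W (f i) k j))" by (rule sum.swap)
  finally show ?case by (simp add: mat_vec_def sum_distrib_left)
qed simp

lemma fwd_cong_lower:
  "(\<And>j. 1 \<le> j \<Longrightarrow> j \<le> k \<Longrightarrow> W' j = W j) \<Longrightarrow> fwd dk W' x k = fwd dk W x k"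
  by (induction k) auto

text \<open>Cutting the product of all layers applied to \<open>x\<close> at any layer gives the
  same number, by moving one matrix at a time across the inner product.\<close>

lemma vinner_bwd_fwd:
  "k \<le> L \<Longrightarrow> vinner (dk k) (bwd L dk W k) (fwd dk W x k) = vinner (dk 0) (bwd L dk W 0) x"
proof (induction k)
  case (Suc k)
  then show ?case by (simp add: vinner_mat_vec bwd_step[of k])
qed simp

lemma fwd_top: "dk L = 1 \<Longrightarrow> fwd dk W x L 0 = vinner (dk 0) (bwd L dk W 0) x"
  using vinner_bwd_fwd[of L L dk W x] by (simp add: bwd_top vinner_def[of "Suc 0"])

lemma vinner_wprod:
  assumes "L \<ge> 1"
  shows "vinner (dk 0) (wprod L dk W) x = fwd dk W x L 0"
  using assms by (subst fwd_chain) (auto simp: vinner_def wprod_def)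

text \<open>\<open>chain\<close> multiplies from the input side and \<open>bwd\<close> from the
  output side; testing both against basis vectors replaces a proof of associativity.\<close>

lemma wprod_eq_bwd:
  assumes "L \<ge> 1" "dk L = 1" "j < dk 0"
  shows "wprod L dk W j = bwd L dk W 0 j"
proof -
  let ?e = "\<lambda>i. if i = j then 1 else (0::real)"
  have "wprod L dk W j = vinner (dk 0) (wprod L dk W) ?e"
    using assms by (simp add: vinner_indicator_right)
  also have "\<dots> = vinner (dk 0) (bwd L dk W 0) ?e"
    using assms by (simp add: vinner_wprod fwd_top)
  finally show ?thesis using assms by (simp add: vinner_indicator_right)
qed

text \<open>An exact identity, obtained by exchanging the layers one at a time: \<open>T k\<close>
  uses \<open>W'\<close> in the first \<open>k\<close> layers and \<open>W\<close> above. It yields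
  the partial derivatives, the Lipschitz bound and the linearization error.\<close>

lemma fwd_top_diff:
  assumes "dk L = 1"
  shows "fwd dk W' x L 0 - fwd dk W x L 0 =
    (\<Sum>k<L. vinner (dk (Suc k)) (bwd L dk W (Suc k))
        (mat_vec (dk k) (\<lambda>i j. W' (Suc k) i j - W (Suc k) i j) (fwd dk W' x k)))"
proof -
  define T where "T = (\<lambda>k. vinner (dk k) (bwd L dk W k) (fwd dk W' x k))"
  have step: "T (Suc k) - T k = vinner (dk (Suc k)) (bwd L dk W (Suc k))
        (mat_vec (dk k) (\<lambda>i j. W' (Suc k) i j - W (Suc k) i j) (fwd dk W' x k))" if "k < L" for k
  proof -
    have "T k = vinner (dk (Suc k)) (bwd L dk W (Suc k)) (mat_vec (dk k) (W (Suc k)) (fwd dk W' x k))"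
      unfolding T_def by (simp add: bwd_step[OF that] vinner_mat_vec)
    then show ?thesis
      by (simp add: T_def vinner_diff_right[symmetric])
        (simp add: mat_vec_def sum_subtractf algebra_simps)
  qed
  have "fwd dk W' x L 0 - fwd dk W x L 0 = T L - T 0"
    using assms by (simp add: T_def fwd_top[of dk L W x]) (simp add: bwd_top vinner_def)
  also have "\<dots> = (\<Sum>k<L. T (Suc k) - T k)" by (rule sum_lessThan_telescope[symmetric])
  finally show ?thesis using step by simp
qed

section \<open>Logistic loss and the descent inequality\<close>

definition sig :: "real \<Rightarrow> real" where
  "sig x = 1 / (1 + exp x)"

lemma logistic_has_derivative: "(logistic has_real_derivative - sig x) (at x)"
proof -
  have "1 + exp (- x) > 0" by (simp add: add_pos_pos)
  then have "((\<lambda>x. ln (1 + exp (- x))) has_real_derivative inverse (1 + exp (- x)) * (exp (- x) * -1)) (at x)"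
    by (auto intro!: derivative_eq_intros simp: divide_inverse)
  moreover have "inverse (1 + exp (- x)) * (exp (- x) * -1) = - sig x"
    by (simp add: sig_def exp_minus field_simps)
  ultimately show ?thesis by (simp add: logistic_def[abs_def])
qed

lemma sig_has_derivative: "(sig has_real_derivative - exp x / (1 + exp x)\<^sup>2) (at x)"
proof -
  have "1 + exp x \<noteq> 0" using exp_gt_zero[of x] by linarith
  then show ?thesis unfolding sig_def[abs_def]
    by (auto intro!: derivative_eq_intros simp: power2_eq_square field_simps)
qed

lemma sig_pos: "0 < sig x" and sig_less1: "sig x < 1"
  by (simp_all add: sig_def add_pos_pos)

lemma sig_lipschitz: "\<bar>sig x - sig y\<bar> \<le> \<bar>x - y\<bar>"
proof -
  have "norm (sig x - sig y) \<le> 1 * norm (x - y)"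
  proof (rule field_differentiable_bound[OF convex_UNIV])
    fix x :: real
    show "(sig has_field_derivative - exp x / (1 + exp x)\<^sup>2) (at x within UNIV)"
      using sig_has_derivative by simp
    have "exp x \<le> (1 + exp x)\<^sup>2"
      unfolding power2_eq_square using exp_gt_zero[of x] by (simp add: algebra_simps)
    then show "norm (- exp x / (1 + exp x)\<^sup>2) \<le> 1"
      by (simp add: divide_le_eq_1)
  qed auto
  then show ?thesis by simp
qed

lemma logistic_mvt: "\<exists>c. \<bar>c - a\<bar> \<le> \<bar>b - a\<bar> \<and> logistic b - logistic a = - sig c * (b - a)"
proof -
  consider "a < b" | "a = b" | "b < a" by linarith
  then show ?thesis
  proof cases
    case 1
    then obtain c where "a < c" "c < b" "logistic b - logistic a = (b - a) * - sig c"
      using MVT2[of a b logistic "\<lambda>x. - sig x"] logistic_has_derivative by blast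
    then show ?thesis by (intro exI[of _ c]) (simp add: algebra_simps)
  next
    case 3
    then obtain c where "b < c" "c < a" "logistic a - logistic b = (a - b) * - sig c"
      using MVT2[of b a logistic "\<lambda>x. - sig x"] logistic_has_derivative by blast
    then show ?thesis by (intro exI[of _ c]) (simp add: algebra_simps)
  qed (auto intro: exI[of _ a])
qed

text \<open>Mean value theorem plus the Lipschitz bound for \<open>sig\<close>. The coefficient 1 is
  cruder than the sharp one; the slack in the step size pays for it.\<close>

lemma logistic_quadratic_upper: "logistic b \<le> logistic a - sig a * (b - a) + (b - a)\<^sup>2"
proof -
  obtain c where c: "\<bar>c - a\<bar> \<le> \<bar>b - a\<bar>" "logistic b - logistic a = - sig c * (b - a)"
    using logistic_mvt by blast
  have "(sig a - sig c) * (b - a) \<le> \<bar>sig a - sig c\<bar> * \<bar>b - a\<bar>"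
    by (metis abs_ge_self abs_mult)
  also have "\<dots> \<le> \<bar>b - a\<bar> * \<bar>b - a\<bar>"
    using sig_lipschitz[of a c] c(1) by (intro mult_right_mono) auto
  also have "\<dots> = (b - a)\<^sup>2" by (simp add: power2_eq_square flip: abs_mult)
  finally show ?thesis using c(2) by (simp add: algebra_simps)
qed

lemma logistic_lipschitz: "\<bar>logistic b - logistic a\<bar> \<le> \<bar>b - a\<bar>"
proof -
  obtain c where c: "logistic b - logistic a = - sig c * (b - a)"
    using logistic_mvt by blast
  have "\<bar>sig c\<bar> * \<bar>b - a\<bar> \<le> 1 * \<bar>b - a\<bar>"
    using sig_pos[of c] sig_less1[of c] by (intro mult_right_mono) auto
  then show ?thesis by (simp add: c abs_mult)
qed

lemma logistic_pos: "0 < logistic x"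
  by (simp add: logistic_def ln_gt_zero)

lemma logistic_le_iff: "logistic x \<le> logistic y \<longleftrightarrow> y \<le> x"
  by (simp add: logistic_def add_pos_pos)

text \<open>Turns a lower bound on the loss of a data point into a lower bound on its weight in the
  gradient.\<close>

lemma sig_eq_logistic: "sig x = 1 - exp (- logistic x)"
proof -
  have "1 + exp (- x) > 0" by (simp add: add_pos_pos)
  then have "exp (- logistic x) = inverse (1 + exp (- x))"
    by (simp add: logistic_def exp_minus)
  then show ?thesis
    by (simp add: sig_def exp_minus field_simps)
qed

lemma sig_le_exp: "sig x \<le> exp (- x)"
  by (simp add: sig_def exp_minus field_simps add_pos_pos)

lemma sig_ge_exp: "0 \<le> x \<Longrightarrow> exp (- x) / 2 \<le> sig x"
  by (simp add: sig_def exp_minus field_simps add_pos_pos)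

section \<open>Norm estimates for networks in a ball\<close>

lemma in_ball_frob: "in_ball L dk R W \<Longrightarrow> k < L \<Longrightarrow> sqrt (frob_sq (dk (Suc k)) (dk k) (W (Suc k))) \<le> R"
  unfolding in_ball_def frob_sqrt[symmetric] by auto

lemma frob_triangle:
  "frob dk W' (Suc k) \<le> frob dk W (Suc k)
     + sqrt (frob_sq (dk (Suc k)) (dk k) (\<lambda>i j. W' (Suc k) i j - W (Suc k) i j))"
proof -
  let ?I = "{..<dk (Suc k)} \<times> {..<dk k}"
  have L2: "sqrt (frob_sq (dk (Suc k)) (dk k) A) = L2_set (\<lambda>p. A (fst p) (snd p)) ?I" for A
    by (simp add: frob_sq_def L2_set_def sum.cartesian_product case_prod_unfold)
  have "L2_set (\<lambda>p. W (Suc k) (fst p) (snd p) + (W' (Suc k) (fst p) (snd p) - W (Suc k) (fst p) (snd p))) ?I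
     \<le> L2_set (\<lambda>p. W (Suc k) (fst p) (snd p)) ?I
       + L2_set (\<lambda>p. W' (Suc k) (fst p) (snd p) - W (Suc k) (fst p) (snd p)) ?I"
    by (rule L2_set_triangle_ineq)
  then show ?thesis unfolding frob_sqrt L2 by simp
qed

lemma vnorm_fwd_le:
  assumes "in_ball L dk R W" "k \<le> L" "0 \<le> R"
  shows "vnorm (dk k) (fwd dk W x k) \<le> R ^ k * vnorm (dk 0) x"
  using assms(2)
proof (induction k)
  case (Suc k)
  have "vnorm (dk (Suc k)) (fwd dk W x (Suc k)) \<le> R * (R ^ k * vnorm (dk 0) x)"
    unfolding fwd.simps using Suc assms in_ball_frob[of L dk R W k]
    by (intro order_trans[OF vnorm_mat_vec_le] mult_mono) auto
  then show ?case by (simp add: mult.assoc)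
qed simp

lemma vnorm_bwd_le:
  assumes "in_ball L dk R W" "k \<le> L" "0 \<le> R" "dk L = 1"
  shows "vnorm (dk k) (bwd L dk W k) \<le> R ^ (L - k)"
  using assms(2)
proof (induction k rule: inc_induct)
  case base
  then show ?case using assms(4) by (simp add: bwd_top vnorm_def vinner_def)
next
  case (step k)
  have "vnorm (dk k) (bwd L dk W k) \<le> R * R ^ (L - Suc k)"
    unfolding bwd_step[OF step(2)] using step assms in_ball_frob[of L dk R W k]
    by (intro order_trans[OF vnorm_vec_mat_le] mult_mono) auto
  with step(2) show ?case by (simp add: Suc_diff_Suc[symmetric])
qed

lemma vnorm_fwd_diff_le:
  assumes "in_ball L dk R W" "in_ball L dk R W'" "k \<le> L" "1 \<le> R"
    and a: "\<And>k. k < L \<Longrightarrow> sqrt (frob_sq (dk (Suc k)) (dk k) (\<lambda>i j. W' (Suc k) i j - W (Suc k) i j)) \<le> a k"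
  shows "vnorm (dk k) (\<lambda>i. fwd dk W' x k i - fwd dk W x k i) \<le> R ^ k * (\<Sum>j<k. a j) * vnorm (dk 0) x"
  using assms(3)
proof (induction k)
  case 0
  then show ?case by (simp add: vnorm_def vinner_def)
next
  case (Suc k)
  let ?V = "\<lambda>i j. W' (Suc k) i j - W (Suc k) i j"
  have a0: "0 \<le> a k" using a[of k] Suc.prems real_sqrt_ge_zero[OF frob_sq_ge0] by (meson Suc_le_lessD order_trans)
  have eq: "(\<lambda>i. fwd dk W' x (Suc k) i - fwd dk W x (Suc k) i) =
     (\<lambda>i. mat_vec (dk k) (W' (Suc k)) (\<lambda>i. fwd dk W' x k i - fwd dk W x k i) i
        + mat_vec (dk k) ?V (fwd dk W x k) i)"
    by (simp add: mat_vec_def fun_eq_iff flip: sum_subtractf sum.distrib) (simp add: algebra_simps)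
  have "vnorm (dk (Suc k)) (\<lambda>i. fwd dk W' x (Suc k) i - fwd dk W x (Suc k) i)
     \<le> vnorm (dk (Suc k)) (mat_vec (dk k) (W' (Suc k)) (\<lambda>i. fwd dk W' x k i - fwd dk W x k i))
       + vnorm (dk (Suc k)) (mat_vec (dk k) ?V (fwd dk W x k))"
    unfolding eq by (rule vnorm_triangle)
  also have "\<dots> \<le> R * (R ^ k * (\<Sum>j<k. a j) * vnorm (dk 0) x) + a k * (R ^ k * vnorm (dk 0) x)"
    using Suc assms in_ball_frob[of L dk R W' k] a[of k] a0 vnorm_fwd_le[of L dk R W k x]
    by (intro add_mono order_trans[OF vnorm_mat_vec_le] mult_mono) auto
  \<comment> \<open>The induction carries \<open>R ^ k\<close> rather than the sharper power with
    exponent \<open>k - 1\<close>, avoiding truncated subtraction; \<open>1 \<le> R\<close> pays for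
    the extra factor.\<close>
  also have "\<dots> \<le> R * (R ^ k * (\<Sum>j<k. a j) * vnorm (dk 0) x) + a k * (R * R ^ k * vnorm (dk 0) x)"
    using a0 assms(4) by (intro add_left_mono mult_left_mono mult_right_mono) auto
  also have "\<dots> = R ^ Suc k * (\<Sum>j<Suc k. a j) * vnorm (dk 0) x"
    by (simp add: algebra_simps)
  finally show ?case .
qed

text \<open>The \<open>L - Suc k\<close> layers above and the \<open>k\<close> layers below the
  perturbed one contribute \<open>R ^ (L - 1)\<close> together, whatever \<open>k\<close>
  is.\<close>

lemma layer_term_le:
  assumes "in_ball L dk R W" "k < L" "0 \<le> R" "dk L = 1" "sqrt (frob_sq (dk (Suc k)) (dk k) V) \<le> a"
    and "vnorm (dk k) h \<le> R ^ k * c"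
  shows "\<bar>vinner (dk (Suc k)) (bwd L dk W (Suc k)) (mat_vec (dk k) V h)\<bar> \<le> R ^ (L - 1) * a * c"
proof -
  have a0: "0 \<le> a" using assms(5) real_sqrt_ge_zero[OF frob_sq_ge0] by (meson order_trans)
  have "\<bar>vinner (dk (Suc k)) (bwd L dk W (Suc k)) (mat_vec (dk k) V h)\<bar>
    \<le> R ^ (L - Suc k) * (a * (R ^ k * c))"
    using assms a0 vnorm_bwd_le[of L dk R W "Suc k"]
    by (intro order_trans[OF vinner_abs_le] mult_mono order_trans[OF vnorm_mat_vec_le]) auto
  also have "R ^ (L - Suc k) * (a * (R ^ k * c)) = R ^ (L - 1) * a * c"
    using assms(2) by (simp flip: power_add)
  finally show ?thesis .
qed

lemma fwd_top_diff_le: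
  assumes "in_ball L dk R W" "in_ball L dk R W'" "1 \<le> R" "dk L = 1"
    and a: "\<And>k. k < L \<Longrightarrow> sqrt (frob_sq (dk (Suc k)) (dk k) (\<lambda>i j. W' (Suc k) i j - W (Suc k) i j)) \<le> a k"
  shows "\<bar>fwd dk W' x L 0 - fwd dk W x L 0\<bar> \<le> R ^ (L - 1) * (\<Sum>k<L. a k) * vnorm (dk 0) x"
proof -
  have "\<bar>fwd dk W' x L 0 - fwd dk W x L 0\<bar> \<le> (\<Sum>k<L. R ^ (L - 1) * a k * vnorm (dk 0) x)"
    unfolding fwd_top_diff[where dk=dk and L=L, OF assms(4)] using assms vnorm_fwd_le[of L dk R W' _ x]
    by (intro order_trans[OF sum_abs] sum_mono layer_term_le) auto
  also have "\<dots> = R ^ (L - 1) * (\<Sum>k<L. a k) * vnorm (dk 0) x"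
    by (simp add: sum_distrib_left sum_distrib_right mult_ac)
  finally show ?thesis .
qed

text \<open>Subtracting the linear part from the telescoped difference replaces the forward pass of
  \<open>W'\<close> by the difference of two forward passes, itself of first order; hence a
  quadratic remainder.\<close>

lemma fwd_top_linearization_le:
  assumes "in_ball L dk R W" "in_ball L dk R W'" "1 \<le> R" "dk L = 1"
    and a: "\<And>k. k < L \<Longrightarrow> sqrt (frob_sq (dk (Suc k)) (dk k) (\<lambda>i j. W' (Suc k) i j - W (Suc k) i j)) \<le> a k"
  shows "\<bar>fwd dk W' x L 0 - fwd dk W x L 0 - (\<Sum>k<L. vinner (dk (Suc k)) (bwd L dk W (Suc k))
        (mat_vec (dk k) (\<lambda>i j. W' (Suc k) i j - W (Suc k) i j) (fwd dk W x k)))\<bar>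
     \<le> R ^ (L - 1) * (\<Sum>k<L. a k)\<^sup>2 * vnorm (dk 0) x"
proof -
  let ?A = "\<Sum>k<L. a k"
  have a0: "0 \<le> a k" if "k < L" for k
    using a[OF that] real_sqrt_ge_zero[OF frob_sq_ge0] by (meson order_trans)
  have part: "(\<Sum>j<k. a j) \<le> ?A" if "k < L" for k
    using that a0 by (intro sum_mono2) auto
  have "\<bar>fwd dk W' x L 0 - fwd dk W x L 0 - (\<Sum>k<L. vinner (dk (Suc k)) (bwd L dk W (Suc k))
        (mat_vec (dk k) (\<lambda>i j. W' (Suc k) i j - W (Suc k) i j) (fwd dk W x k)))\<bar>
    = \<bar>\<Sum>k<L. vinner (dk (Suc k)) (bwd L dk W (Suc k))
        (mat_vec (dk k) (\<lambda>i j. W' (Suc k) i j - W (Suc k) i j) (\<lambda>i. fwd dk W' x k i - fwd dk W x k i))\<bar>"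
    unfolding fwd_top_diff[where dk=dk and L=L, OF assms(4)] by (simp add: mat_vec_diff vinner_diff_right sum_subtractf)
  also have "\<dots> \<le> (\<Sum>k<L. R ^ (L - 1) * a k * (?A * vnorm (dk 0) x))"
  proof (intro order_trans[OF sum_abs] sum_mono layer_term_le)
    fix k assume k: "k \<in> {..<L}"
    have "vnorm (dk k) (\<lambda>i. fwd dk W' x k i - fwd dk W x k i) \<le> R ^ k * (\<Sum>j<k. a j) * vnorm (dk 0) x"
      using assms k by (intro vnorm_fwd_diff_le) auto
    also have "\<dots> \<le> R ^ k * ?A * vnorm (dk 0) x"
      using part[of k] k assms(3) by (intro mult_right_mono mult_left_mono) auto
    finally show "vnorm (dk k) (\<lambda>i. fwd dk W' x k i - fwd dk W x k i) \<le> R ^ k * (?A * vnorm (dk 0) x)"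
      by (simp add: mult.assoc)
  qed (use assms in auto)
  also have "\<dots> = R ^ (L - 1) * ?A\<^sup>2 * vnorm (dk 0) x"
    by (simp add: sum_distrib_left sum_distrib_right mult_ac power2_eq_square)
  finally show ?thesis .
qed

section \<open>The risk, its gradient, and one descent step\<close>

locale deep_linear =
  fixes n L :: nat and dk :: "nat \<Rightarrow> nat" and z :: "nat \<Rightarrow> nat \<Rightarrow> real"
  assumes n_pos: "n \<ge> 1" and L_ge2: "L \<ge> 2" and dk_top: "dk L = 1"
    and data_bounded: "i < n \<Longrightarrow> vinner (dk 0) (z i) (z i) \<le> 1"
begin

abbreviation d :: nat where "d \<equiv> dk 0"

abbreviation loss_risk :: "(nat \<Rightarrow> nat \<Rightarrow> nat \<Rightarrow> real) \<Rightarrow> real" where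
  "loss_risk \<equiv> risk logistic n d z L dk"

abbreviation marg :: "(nat \<Rightarrow> nat \<Rightarrow> nat \<Rightarrow> real) \<Rightarrow> nat \<Rightarrow> real" where
  "marg W i \<equiv> vinner d (wprod L dk W) (z i)"

text \<open>The gradient of the risk as a function of the end-to-end vector
  \<open>wprod\<close>.\<close>

definition wgrad :: "(nat \<Rightarrow> nat \<Rightarrow> nat \<Rightarrow> real) \<Rightarrow> nat \<Rightarrow> real" where
  "wgrad W = (\<lambda>j. \<Sum>i<n. - (sig (marg W i) / real n) * z i j)"

text \<open>The squared norm of the full gradient: each layer gradient has rank one, so its
  Frobenius norm is the product of the norms of its two factors.\<close>

definition grad_sq :: "(nat \<Rightarrow> nat \<Rightarrow> nat \<Rightarrow> real) \<Rightarrow> real" where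
  "grad_sq W = (\<Sum>k<L. vinner (dk (Suc k)) (bwd L dk W (Suc k)) (bwd L dk W (Suc k))
     * vinner (dk k) (fwd dk W (wgrad W) k) (fwd dk W (wgrad W) k))"

lemma marg_eq_fwd: "marg W i = fwd dk W (z i) L 0"
  using L_ge2 by (simp add: vinner_wprod)

lemma vinner_wgrad: "vinner d u (wgrad W) = - (\<Sum>i<n. sig (marg W i) * vinner d u (z i)) / real n"
  unfolding wgrad_def vinner_sum_right vinner_scale_right by (simp add: sum_divide_distrib sum_negf)

text \<open>Every margin is affine in a single matrix entry, with the slope given by the one
  surviving term of \<open>fwd_top_diff\<close>; only the scalar loss has to be
  differentiated.\<close>

lemma grad_risk:
  assumes "k < L" "i < dk (Suc k)" "j < dk k"
  shows "grad L dk loss_risk W (Suc k) i j = bwd L dk W (Suc k) i * fwd dk W (wgrad W) k j"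
proof -
  define U where "U = (\<lambda>s. W(Suc k := (W (Suc k))(i := (W (Suc k) i)(j := s))))"
  have out: "marg (U s) r = marg W r + (s - W (Suc k) i j) * (bwd L dk W (Suc k) i * fwd dk W (z r) k j)" for s r
  proof -
    have low: "fwd dk (U s) (z r) k = fwd dk W (z r) k"
      by (rule fwd_cong_lower) (auto simp: U_def)
    have mv: "mat_vec (dk k) (\<lambda>a b. U s (Suc k) a b - W (Suc k) a b) h
         = (\<lambda>a. if a = i then (s - W (Suc k) i j) * h j else 0)" for h
    proof
      fix a
      have "mat_vec (dk k) (\<lambda>a b. U s (Suc k) a b - W (Suc k) a b) h a
         = (\<Sum>b<dk k. if b = j then (if a = i then (s - W (Suc k) i j) * h j else 0) else 0)"
        unfolding mat_vec_def U_def by (intro sum.cong) auto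
      then show "mat_vec (dk k) (\<lambda>a b. U s (Suc k) a b - W (Suc k) a b) h a
         = (if a = i then (s - W (Suc k) i j) * h j else 0)"
        using assms(3) by simp
    qed
    have "marg (U s) r - marg W r = (\<Sum>l<L. vinner (dk (Suc l)) (bwd L dk W (Suc l))
        (mat_vec (dk l) (\<lambda>a b. U s (Suc l) a b - W (Suc l) a b) (fwd dk (U s) (z r) l)))"
      unfolding marg_eq_fwd by (rule fwd_top_diff[where dk=dk and L=L, OF dk_top])
    also have "\<dots> = (\<Sum>l<L. if l = k then vinner (dk (Suc k)) (bwd L dk W (Suc k))
        (mat_vec (dk k) (\<lambda>a b. U s (Suc k) a b - W (Suc k) a b) (fwd dk (U s) (z r) k)) else 0)"
    proof (intro sum.cong refl)
      fix l
      have "l \<noteq> k \<Longrightarrow> mat_vec (dk l) (\<lambda>a b. U s (Suc l) a b - W (Suc l) a b) h = (\<lambda>_. 0)" for h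
        by (simp add: U_def mat_vec_def)
      then show "vinner (dk (Suc l)) (bwd L dk W (Suc l)) (mat_vec (dk l) (\<lambda>a b. U s (Suc l) a b - W (Suc l) a b) (fwd dk (U s) (z r) l))
         = (if l = k then vinner (dk (Suc k)) (bwd L dk W (Suc k))
        (mat_vec (dk k) (\<lambda>a b. U s (Suc k) a b - W (Suc k) a b) (fwd dk (U s) (z r) k)) else 0)"
        by (auto simp: vinner_def)
    qed
    also have "\<dots> = vinner (dk (Suc k)) (bwd L dk W (Suc k)) (\<lambda>a. if a = i then (s - W (Suc k) i j) * fwd dk W (z r) k j else 0)"
      using assms(1) by (simp add: mv low)
    also have "\<dots> = (s - W (Suc k) i j) * (bwd L dk W (Suc k) i * fwd dk W (z r) k j)"
      using assms(2) by (simp add: vinner_def if_distrib cong: if_cong)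
    finally show ?thesis by simp
  qed
  let ?c = "\<lambda>r. bwd L dk W (Suc k) i * fwd dk W (z r) k j"
  have "((\<lambda>s. (1 / real n) * (\<Sum>r<n. logistic (marg W r + (s - W (Suc k) i j) * ?c r))) has_real_derivative
      (1 / real n) * (\<Sum>r<n. - sig (marg W r + (W (Suc k) i j - W (Suc k) i j) * ?c r) * ?c r)) (at (W (Suc k) i j))"
    by (intro DERIV_cmult DERIV_sum DERIV_chain2[OF logistic_has_derivative])
      (auto intro!: derivative_eq_intros)
  then have "((\<lambda>s. loss_risk (U s)) has_real_derivative (1 / real n) * (\<Sum>r<n. - sig (marg W r) * ?c r)) (at (W (Suc k) i j))"
    by (simp add: risk_def out)
  then have "deriv (\<lambda>s. loss_risk (U s)) (W (Suc k) i j) = (1 / real n) * (\<Sum>r<n. - sig (marg W r) * ?c r)"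
    by (rule DERIV_imp_deriv)
  also have "\<dots> = bwd L dk W (Suc k) i * fwd dk W (wgrad W) k j"
    unfolding wgrad_def fwd_linear sum_distrib_left by (intro sum.cong) auto
  finally show ?thesis
    using assms by (simp add: grad_def U_def)
qed

text \<open>Only entries inside the index ranges are constrained, as no norm or product sees the
  others.\<close>

definition gd_step :: "real \<Rightarrow> (nat \<Rightarrow> nat \<Rightarrow> nat \<Rightarrow> real) \<Rightarrow> (nat \<Rightarrow> nat \<Rightarrow> nat \<Rightarrow> real) \<Rightarrow> bool" where
  "gd_step \<eta> W W' \<longleftrightarrow> (\<forall>k<L. \<forall>i<dk (Suc k). \<forall>j<dk k.
      W' (Suc k) i j = W (Suc k) i j - \<eta> * (bwd L dk W (Suc k) i * fwd dk W (wgrad W) k j))"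

lemma vnorm_data: "i < n \<Longrightarrow> vnorm d (z i) \<le> 1"
  using data_bounded by (simp add: vnorm_def)

lemma vnorm_wgrad_le: "vnorm d (wgrad W) \<le> 1"
proof -
  have "vnorm d (wgrad W) \<le> (\<Sum>i<n. vnorm d (\<lambda>j. - (sig (marg W i) / real n) * z i j))"
    unfolding wgrad_def by (rule vnorm_sum)
  also have "\<dots> \<le> (\<Sum>i<n. 1 / real n)"
  proof (intro sum_mono)
    fix i assume "i \<in> {..<n}"
    then have "\<bar>sig (marg W i)\<bar> * vnorm d (z i) \<le> 1 * 1"
      using sig_pos[of "marg W i"] sig_less1[of "marg W i"] vnorm_data[of i]
      by (intro mult_mono) auto
    then have "\<bar>sig (marg W i)\<bar> * vnorm d (z i) / real n \<le> 1 / real n"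
      by (intro divide_right_mono) auto
    then show "vnorm d (\<lambda>j. - (sig (marg W i) / real n) * z i j) \<le> 1 / real n"
      unfolding vnorm_scale by (simp add: abs_divide)
  qed
  also have "\<dots> = 1" using n_pos by simp
  finally show ?thesis .
qed

lemma grad_sq_ge0 [simp]: "0 \<le> grad_sq W"
  by (simp add: grad_sq_def sum_nonneg)

lemma layer_grad_sq_le: "k < L \<Longrightarrow> vinner (dk (Suc k)) (bwd L dk W (Suc k)) (bwd L dk W (Suc k))
     * vinner (dk k) (fwd dk W (wgrad W) k) (fwd dk W (wgrad W) k) \<le> grad_sq W"
  unfolding grad_sq_def by (rule member_le_sum) auto

lemma gd_step_frob:
  assumes "gd_step \<eta> W W'" "k < L"
  shows "frob_sq (dk (Suc k)) (dk k) (\<lambda>i j. W' (Suc k) i j - W (Suc k) i j) =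
    \<eta>\<^sup>2 * (vinner (dk (Suc k)) (bwd L dk W (Suc k)) (bwd L dk W (Suc k))
     * vinner (dk k) (fwd dk W (wgrad W) k) (fwd dk W (wgrad W) k))"
proof -
  have "frob_sq (dk (Suc k)) (dk k) (\<lambda>i j. W' (Suc k) i j - W (Suc k) i j) =
    (\<Sum>i<dk (Suc k). \<Sum>j<dk k. \<eta>\<^sup>2 * ((bwd L dk W (Suc k) i)\<^sup>2 * (fwd dk W (wgrad W) k j)\<^sup>2))"
    unfolding frob_sq_def using assms by (intro sum.cong) (auto simp: gd_step_def power_mult_distrib)
  then show ?thesis
    unfolding vinner_self_eq_sum sum_product by (simp add: sum_distrib_left)
qed

lemma gd_step_first_order:
  assumes "gd_step \<eta> W W'"
  shows "(\<Sum>k<L. vinner (dk (Suc k)) (bwd L dk W (Suc k))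
        (mat_vec (dk k) (\<lambda>i j. W' (Suc k) i j - W (Suc k) i j) (fwd dk W (wgrad W) k))) = - \<eta> * grad_sq W"
  unfolding grad_sq_def sum_distrib_left
proof (intro sum.cong refl)
  fix k assume "k \<in> {..<L}"
  then have "vinner (dk (Suc k)) (bwd L dk W (Suc k))
        (mat_vec (dk k) (\<lambda>i j. W' (Suc k) i j - W (Suc k) i j) (fwd dk W (wgrad W) k)) =
    (\<Sum>i<dk (Suc k). bwd L dk W (Suc k) i * (\<Sum>j<dk k. - \<eta> * (bwd L dk W (Suc k) i * fwd dk W (wgrad W) k j) * fwd dk W (wgrad W) k j))"
    using assms by (simp add: vinner_def mat_vec_def gd_step_def)
  also have "\<dots> = - \<eta> * (vinner (dk (Suc k)) (bwd L dk W (Suc k)) (bwd L dk W (Suc k)) *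
          vinner (dk k) (fwd dk W (wgrad W) k) (fwd dk W (wgrad W) k))"
    unfolding vinner_def sum_product by (simp add: sum_distrib_left mult_ac)
  finally show "vinner (dk (Suc k)) (bwd L dk W (Suc k))
        (mat_vec (dk k) (\<lambda>i j. W' (Suc k) i j - W (Suc k) i j) (fwd dk W (wgrad W) k)) =
     - \<eta> * (vinner (dk (Suc k)) (bwd L dk W (Suc k)) (bwd L dk W (Suc k)) *
          vinner (dk k) (fwd dk W (wgrad W) k) (fwd dk W (wgrad W) k))" .
qed

lemma fwd_wgrad: "fwd dk W' (wgrad W) L 0 = (\<Sum>i<n. - (sig (marg W i) / real n) * marg W' i)"
  unfolding wgrad_def fwd_linear marg_eq_fwd ..

text \<open>Here \<open>betaR\<close> equals \<open>5/2 * L\<^sup>2 * R ^ (2 * L - 2)\<close>, so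
  the left side is at most \<open>2 / (5 * L)\<close>, and \<open>L \<ge> 2\<close> gives
  1/5.\<close>

lemma step_size_bound:
  assumes "1 \<le> R" "\<eta> \<le> 1 / betaR L (1/4) 1 R"
  shows "\<eta> * (R ^ (2 * L - 2) * real L) \<le> 1 / 5"
proof -
  let ?P = "R ^ (2 * L - 2)"
  have P: "1 \<le> ?P" using assms(1) by simp
  have L: "2 \<le> real L" using L_ge2 by simp
  have "\<eta> * (?P * real L) \<le> 1 / betaR L (1/4) 1 R * (?P * real L)"
    using assms P by (intro mult_right_mono) auto
  also have "\<dots> = 2 / (5 * real L)"
    using P L assms(1) by (simp add: betaR_def power2_eq_square field_simps)
  also have "\<dots> \<le> 1 / 5" using L by (simp add: field_simps)
  finally show ?thesis .
qed

text \<open>Each layer gradient has norm at most \<open>R ^ (L - 1)\<close>, so a step moves a layer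
  by at most 1. This is the margin left by the radius \<open>R - 1\<close>, and it allows the
  smoothness estimates in the ball of radius \<open>R\<close> to cover both ends of the
  step.\<close>

lemma gd_step_ball:
  assumes st: "gd_step \<eta> W W'" and R: "in_ball L dk (R - 1) W" "1 \<le> R"
    and \<eta>: "0 \<le> \<eta>" "\<eta> \<le> 1 / betaR L (1/4) 1 R"
  shows "in_ball L dk R W'"
  unfolding in_ball_def
proof
  fix k' assume "k' \<in> {1..L}"
  then obtain k where k: "k' = Suc k" "k < L" by (cases k') auto
  have WR: "in_ball L dk R W" using R(1) by (force simp: in_ball_def)
  let ?V = "\<lambda>i j. W' (Suc k) i j - W (Suc k) i j"
  have "sqrt (frob_sq (dk (Suc k)) (dk k) ?V) =
     \<eta> * (vnorm (dk (Suc k)) (bwd L dk W (Suc k)) * vnorm (dk k) (fwd dk W (wgrad W) k))"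
    using \<eta>(1) by (simp add: gd_step_frob[OF st k(2)] real_sqrt_mult vnorm_def)
  also have "\<dots> \<le> \<eta> * (R ^ (L - Suc k) * (R ^ k * 1))"
    using \<eta>(1) R(2) k vnorm_bwd_le[OF WR, of "Suc k"] vnorm_fwd_le[OF WR, of k "wgrad W"] vnorm_wgrad_le[of W] dk_top
    by (intro mult_left_mono mult_mono) (auto intro!: order_trans[OF vnorm_fwd_le[OF WR, of k "wgrad W"]] mult_mono)
  also have "\<dots> = \<eta> * R ^ (L - 1)"
    using k by (simp flip: power_add)
  also have "\<dots> \<le> \<eta> * (R ^ (2 * L - 2) * real L)"
  proof -
    have "R ^ (L - 1) * 1 \<le> R ^ (2 * L - 2) * real L"
      using R(2) L_ge2 by (intro mult_mono power_increasing) auto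
    then show ?thesis using \<eta>(1) by (intro mult_left_mono) auto
  qed
  also have "\<dots> \<le> 1" using step_size_bound[OF R(2) \<eta>(2)] by simp
  finally have V: "sqrt (frob_sq (dk (Suc k)) (dk k) ?V) \<le> 1" .
  have "frob dk W' (Suc k) \<le> frob dk W (Suc k) + 1"
    using frob_triangle[of dk W' k W] V by linarith
  moreover have "frob dk W (Suc k) \<le> R - 1" using R(1) k by (auto simp: in_ball_def)
  ultimately show "frob dk W' k' \<le> R" unfolding k(1) by linarith
qed

text \<open>The curvature of the loss and the nonlinearity of the product each cost at most
  \<open>?P * A\<^sup>2\<close>, where \<open>A\<close> sums the layer displacements. Cauchy-Schwarz
  over the layers and \<open>step_size_bound\<close> make each at most a fifth of
  \<open>\<eta> * grad_sq W\<close>, leaving 3/5 of the linear decrease.\<close>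

lemma risk_descent:
  assumes st: "gd_step \<eta> W W'" and R: "in_ball L dk (R - 1) W" "1 \<le> R"
    and \<eta>: "0 \<le> \<eta>" "\<eta> \<le> 1 / betaR L (1/4) 1 R"
  shows "loss_risk W' \<le> loss_risk W - \<eta> / 2 * grad_sq W"
proof -
  have W: "in_ball L dk R W" using R(1) by (force simp: in_ball_def)
  have W': "in_ball L dk R W'" using gd_step_ball[OF assms] .
  define a where "a = (\<lambda>k. sqrt (frob_sq (dk (Suc k)) (dk k) (\<lambda>i j. W' (Suc k) i j - W (Suc k) i j)))"
  define A where "A = (\<Sum>k<L. a k)"
  let ?P = "R ^ (2 * L - 2)"
  have P: "R ^ (L - 1) \<le> ?P" using R(2) L_ge2 by (intro power_increasing) auto
  have A2: "A\<^sup>2 \<le> real L * (\<eta>\<^sup>2 * grad_sq W)"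
  proof -
    have "A\<^sup>2 \<le> (\<Sum>k<L. (1::real)\<^sup>2) * (\<Sum>k<L. (a k)\<^sup>2)"
      unfolding A_def using Cauchy_Schwarz_ineq_sum[of "\<lambda>_. 1" a "{..<L}"] by simp
    also have "(\<Sum>k<L. (a k)\<^sup>2) = \<eta>\<^sup>2 * grad_sq W"
      by (simp add: a_def gd_step_frob[OF st] grad_sq_def sum_distrib_left)
    finally show ?thesis by simp
  qed
  have lin: "\<bar>fwd dk W' (wgrad W) L 0 - fwd dk W (wgrad W) L 0 - (- \<eta> * grad_sq W)\<bar> \<le> ?P * A\<^sup>2"
  proof -
    have "\<bar>fwd dk W' (wgrad W) L 0 - fwd dk W (wgrad W) L 0 - (- \<eta> * grad_sq W)\<bar>
       \<le> R ^ (L - 1) * A\<^sup>2 * vnorm d (wgrad W)"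
      unfolding gd_step_first_order[OF st, symmetric] A_def
      by (rule fwd_top_linearization_le[OF W W' R(2) dk_top]) (simp add: a_def)
    also have "\<dots> \<le> ?P * A\<^sup>2 * 1"
      using P vnorm_wgrad_le[of W] R(2) by (intro mult_mono) auto
    finally show ?thesis by simp
  qed
  have out: "(marg W' i - marg W i)\<^sup>2 \<le> ?P * A\<^sup>2" if "i < n" for i
  proof -
    have "\<bar>marg W' i - marg W i\<bar> \<le> R ^ (L - 1) * A * vnorm d (z i)"
      unfolding marg_eq_fwd A_def by (rule fwd_top_diff_le[OF W W' R(2) dk_top]) (simp add: a_def)
    also have "\<dots> \<le> R ^ (L - 1) * A * 1"
      using R(2) vnorm_data[OF that]
      by (intro mult_left_mono mult_nonneg_nonneg) (auto simp: A_def a_def intro!: sum_nonneg)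
    finally have "\<bar>marg W' i - marg W i\<bar>\<^sup>2 \<le> (R ^ (L - 1) * A)\<^sup>2"
      by (intro power_mono) auto
    also have "\<dots> = ?P * A\<^sup>2"
      by (simp add: power_mult_distrib power_mult[symmetric] diff_mult_distrib2 mult.commute[of _ 2])
    finally show ?thesis by simp
  qed
  have "loss_risk W' \<le> (1 / real n) * (\<Sum>i<n. logistic (marg W i) - sig (marg W i) * (marg W' i - marg W i) + ?P * A\<^sup>2)"
    unfolding risk_def
  proof (intro mult_left_mono sum_mono)
    fix i assume "i \<in> {..<n}"
    then show "logistic (marg W' i) \<le> logistic (marg W i) - sig (marg W i) * (marg W' i - marg W i) + ?P * A\<^sup>2"
      using out[of i] logistic_quadratic_upper[of "marg W' i" "marg W i"] by simp
  qed simp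
  also have "\<dots> = loss_risk W + (fwd dk W' (wgrad W) L 0 - fwd dk W (wgrad W) L 0) + ?P * A\<^sup>2"
    using n_pos unfolding risk_def fwd_wgrad
    by (simp add: sum.distrib sum_subtractf sum_distrib_left field_simps sum_negf sum_divide_distrib[symmetric])
  also have "\<dots> \<le> loss_risk W - \<eta> * grad_sq W + 2 * (?P * A\<^sup>2)"
    using lin by linarith
  also have "?P * A\<^sup>2 \<le> ?P * (real L * (\<eta>\<^sup>2 * grad_sq W))"
    using R(2) by (intro mult_left_mono A2) auto
  also have "?P * (real L * (\<eta>\<^sup>2 * grad_sq W)) = \<eta> * (?P * real L) * (\<eta> * grad_sq W)"
    by (simp add: power2_eq_square)
  also have "\<dots> \<le> 1 / 5 * (\<eta> * grad_sq W)"
    using \<eta> R(2) by (intro mult_right_mono step_size_bound) auto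
  finally have "loss_risk W' \<le> loss_risk W - \<eta> * grad_sq W + 2 * (1 / 5 * (\<eta> * grad_sq W))" by simp
  moreover have "0 \<le> \<eta> * grad_sq W" using \<eta> by simp
  ultimately show ?thesis by simp
qed

end

section \<open>Balancedness and alignment\<close>

abbreviation nsq :: "nat \<Rightarrow> (nat \<Rightarrow> real) \<Rightarrow> real" where
  "nsq m u \<equiv> vinner m u u"

lemma nsq_diff_scale: "nsq m (\<lambda>j. u j - c * v j) = nsq m u - 2 * c * vinner m u v + c\<^sup>2 * nsq m v"
  by (simp add: vinner_linear vinner_commute[of m v u] power2_eq_square algebra_simps)

context
  fixes p m :: nat and A A' :: "nat \<Rightarrow> nat \<Rightarrow> real" and \<eta> :: real and a b :: "nat \<Rightarrow> real"
  assumes upd: "\<And>i j. i < p \<Longrightarrow> j < m \<Longrightarrow> A' i j = A i j - \<eta> * (a i * b j)"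
begin

lemma mat_vec_rank_one:
  "nsq p (mat_vec m A' u) = nsq p (mat_vec m A u) - 2 * \<eta> * vinner m b u * vinner p a (mat_vec m A u)
     + \<eta>\<^sup>2 * (vinner m b u)\<^sup>2 * nsq p a"
proof -
  have "mat_vec m A' u i = mat_vec m A u i - (\<eta> * vinner m b u) * a i" if "i < p" for i
  proof -
    have "mat_vec m A' u i = (\<Sum>j<m. A i j * u j - \<eta> * a i * (b j * u j))"
      unfolding mat_vec_def using that by (intro sum.cong) (auto simp: upd algebra_simps)
    then show ?thesis by (simp add: mat_vec_def vinner_def sum_subtractf sum_distrib_left mult_ac)
  qed
  then have "nsq p (mat_vec m A' u) = nsq p (\<lambda>i. mat_vec m A u i - (\<eta> * vinner m b u) * a i)"
    by (intro vinner_cong)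
  then show ?thesis
    by (simp add: nsq_diff_scale vinner_commute[of p "mat_vec m A u" a] power_mult_distrib)
qed

lemma vec_mat_rank_one:
  "nsq m (vec_mat p u A') = nsq m (vec_mat p u A) - 2 * \<eta> * vinner p u a * vinner p u (mat_vec m A b)
     + \<eta>\<^sup>2 * (vinner p u a)\<^sup>2 * nsq m b"
proof -
  have "vec_mat p u A' j = vec_mat p u A j - (\<eta> * vinner p u a) * b j" if "j < m" for j
  proof -
    have "vec_mat p u A' j = (\<Sum>i<p. u i * A i j - \<eta> * b j * (u i * a i))"
      unfolding vec_mat_def using that by (intro sum.cong) (auto simp: upd algebra_simps)
    then show ?thesis by (simp add: vec_mat_def vinner_def sum_subtractf sum_distrib_left mult_ac)
  qed
  then have "nsq m (vec_mat p u A') = nsq m (\<lambda>j. vec_mat p u A j - (\<eta> * vinner p u a) * b j)"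
    by (intro vinner_cong)
  then show ?thesis
    by (simp add: nsq_diff_scale vinner_mat_vec power_mult_distrib)
qed

lemma frob_sq_rank_one:
  "frob_sq p m A' = frob_sq p m A - 2 * \<eta> * vinner p a (mat_vec m A b) + \<eta>\<^sup>2 * (nsq p a * nsq m b)"
proof -
  have "frob_sq p m A' = (\<Sum>i<p. nsq m (\<lambda>j. A i j - (\<eta> * a i) * b j))"
    unfolding frob_sq_rows by (intro sum.cong vinner_cong) (auto simp: upd)
  also have "\<dots> = (\<Sum>i<p. nsq m (A i) - 2 * \<eta> * (a i * mat_vec m A b i) + \<eta>\<^sup>2 * ((a i * a i) * nsq m b))"
    by (simp only: nsq_diff_scale mat_vec_row) (simp add: power_mult_distrib power2_eq_square[of "a _"] mult_ac)
  also have "\<dots> = frob_sq p m A - 2 * \<eta> * vinner p a (mat_vec m A b) + \<eta>\<^sup>2 * (nsq p a * nsq m b)"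
    unfolding frob_sq_rows
    by (simp add: sum.distrib sum_subtractf vinner_def[of p] sum_distrib_left sum_distrib_right mult_ac)
  finally show ?thesis .
qed

end

text \<open>\<open>frob_sq p m A - nsq p (mat_vec m A u)\<close> is the squared Frobenius norm of \<open>A\<close> restricted to
  the orthogonal complement of the unit vector \<open>u\<close>.\<close>

lemma mat_vec_perp_bound:
  assumes "vinner m u \<xi> = 0" "nsq m u = 1"
  shows "nsq p (mat_vec m A \<xi>) \<le> nsq m \<xi> * (frob_sq p m A - nsq p (mat_vec m A u))"
proof -
  have row: "(vinner m r \<xi>)\<^sup>2 \<le> nsq m \<xi> * (nsq m r - (vinner m r u)\<^sup>2)" for r
  proof -
    let ?r = "\<lambda>j. r j - vinner m r u * u j"
    have "(vinner m ?r \<xi>)\<^sup>2 \<le> nsq m ?r * nsq m \<xi>" by (rule vinner_Cauchy_Schwarz)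
    then show ?thesis using assms
      by (simp add: nsq_diff_scale vinner_linear) (simp add: power2_eq_square algebra_simps)
  qed
  show ?thesis
    unfolding mat_vec_self frob_sq_rows sum_subtractf[symmetric] sum_distrib_left
    by (intro sum_mono row)
qed

declare fwd.simps(2) [simp del]

context deep_linear
begin

text \<open>The value at \<open>u\<close> of the quadratic form of
  \<open>W\<^sub>j\<^sub>+\<^sub>1\<^sup>T W\<^sub>j\<^sub>+\<^sub>1 - W\<^sub>j
  W\<^sub>j\<^sup>T\<close> for \<open>j = Suc k\<close>. A bound by a multiple of
  \<open>nsq\<close> is an operator norm bound on this symmetric matrix.\<close>

definition imbal :: "(nat \<Rightarrow> nat \<Rightarrow> nat \<Rightarrow> real) \<Rightarrow> nat \<Rightarrow> (nat \<Rightarrow> real) \<Rightarrow> real" where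
  "imbal W k u = nsq (dk (Suc (Suc k))) (mat_vec (dk (Suc k)) (W (Suc (Suc k))) u)
     - nsq (dk k) (vec_mat (dk (Suc k)) u (W (Suc k)))"

text \<open>\<open>W\<^bsub>k+1\<^esub>\<^sup>T G\<^bsub>k+1\<^esub> = G\<^sub>k W\<^sub>k\<^sup>T\<close>, so the terms linear in the step size cancel.\<close>

lemma imbal_gd_step:
  assumes st: "gd_step \<eta> W W'" and k: "Suc k < L"
  shows "\<bar>imbal W' k u - imbal W k u\<bar> \<le> \<eta>\<^sup>2 * grad_sq W * nsq (dk (Suc k)) u"
proof -
  let ?p = "bwd L dk W" and ?h = "fwd dk W (wgrad W)"
  let ?a = "(vinner (dk (Suc k)) (?h (Suc k)) u)\<^sup>2 * nsq (dk (Suc (Suc k))) (?p (Suc (Suc k)))"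
  let ?b = "(vinner (dk (Suc k)) u (?p (Suc k)))\<^sup>2 * nsq (dk k) (?h k)"
  have up: "W' (Suc j) i l = W (Suc j) i l - \<eta> * (?p (Suc j) i * ?h j l)" if "j < L" "i < dk (Suc j)" "l < dk j" for i j l
    using st that by (auto simp: gd_step_def)
  have 1: "nsq (dk (Suc (Suc k))) (mat_vec (dk (Suc k)) (W' (Suc (Suc k))) u)
     = nsq (dk (Suc (Suc k))) (mat_vec (dk (Suc k)) (W (Suc (Suc k))) u)
       - 2 * \<eta> * vinner (dk (Suc k)) (?h (Suc k)) u * vinner (dk (Suc k)) (?p (Suc k)) u + \<eta>\<^sup>2 * ?a"
    using k by (subst mat_vec_rank_one[OF up[OF k]])
      (simp_all add: vinner_mat_vec bwd_step[of "Suc k" L] mult.assoc)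
  have 2: "nsq (dk k) (vec_mat (dk (Suc k)) u (W' (Suc k))) = nsq (dk k) (vec_mat (dk (Suc k)) u (W (Suc k)))
      - 2 * \<eta> * vinner (dk (Suc k)) u (?p (Suc k)) * vinner (dk (Suc k)) u (?h (Suc k)) + \<eta>\<^sup>2 * ?b"
    using k by (subst vec_mat_rank_one[OF up]) (simp_all add: mult.assoc flip: fwd.simps(2))
  have eq: "imbal W' k u - imbal W k u = \<eta>\<^sup>2 * (?a - ?b)"
    unfolding imbal_def 1 2 by (simp add: vinner_commute[of _ u "?p (Suc k)"] vinner_commute[of _ u "?h (Suc k)"] algebra_simps)
  have "?a \<le> (nsq (dk (Suc k)) (?h (Suc k)) * nsq (dk (Suc k)) u) * nsq (dk (Suc (Suc k))) (?p (Suc (Suc k)))"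
    by (intro mult_right_mono vinner_Cauchy_Schwarz) auto
  also have "\<dots> = (nsq (dk (Suc (Suc k))) (?p (Suc (Suc k))) * nsq (dk (Suc k)) (?h (Suc k))) * nsq (dk (Suc k)) u"
    by (simp add: mult_ac)
  also have "\<dots> \<le> grad_sq W * nsq (dk (Suc k)) u"
    using layer_grad_sq_le[OF k, of W] by (intro mult_right_mono) auto
  finally have a: "?a \<le> grad_sq W * nsq (dk (Suc k)) u" .
  have "?b \<le> (nsq (dk (Suc k)) u * nsq (dk (Suc k)) (?p (Suc k))) * nsq (dk k) (?h k)"
    by (intro mult_right_mono vinner_Cauchy_Schwarz) auto
  also have "\<dots> = (nsq (dk (Suc k)) (?p (Suc k)) * nsq (dk k) (?h k)) * nsq (dk (Suc k)) u"
    by (simp add: mult_ac)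
  also have "\<dots> \<le> grad_sq W * nsq (dk (Suc k)) u"
    using layer_grad_sq_le[of k W] k by (intro mult_right_mono) auto
  finally have b: "?b \<le> grad_sq W * nsq (dk (Suc k)) u" .
  have "0 \<le> ?a" "0 \<le> ?b" by simp_all
  with a b have "\<bar>?a - ?b\<bar> \<le> grad_sq W * nsq (dk (Suc k)) u" by linarith
  then show ?thesis
    unfolding eq abs_mult by (simp add: mult.assoc mult_left_mono)
qed

definition off_axis :: "(nat \<Rightarrow> nat \<Rightarrow> nat \<Rightarrow> real) \<Rightarrow> (nat \<Rightarrow> real) \<Rightarrow> real" where
  "off_axis W u = frob_sq (dk 1) d (W 1) - nsq (dk 1) (mat_vec d (W 1) u)"

definition perp :: "(nat \<Rightarrow> nat \<Rightarrow> nat \<Rightarrow> real) \<Rightarrow> (nat \<Rightarrow> real) \<Rightarrow> nat \<Rightarrow> real" where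
  "perp W u = (\<lambda>j. bwd L dk W 0 j - vinner d (bwd L dk W 0) u * u j)"

lemma off_axis_ge0: "nsq d u = 1 \<Longrightarrow> 0 \<le> off_axis W u"
  using mat_vec_bound[of "dk 1" d "W 1" u] by (simp add: off_axis_def)

lemma nsq_perp: "nsq d u = 1 \<Longrightarrow> nsq d (perp W u) = nsq d (bwd L dk W 0) - (vinner d (bwd L dk W 0) u)\<^sup>2"
  by (simp add: perp_def nsq_diff_scale power2_eq_square)

lemma perp_orthogonal: "nsq d u = 1 \<Longrightarrow> vinner d u (perp W u) = 0"
  by (simp add: perp_def vinner_linear vinner_commute[of d u "bwd L dk W 0"])

lemma bwd0_vinner: "vinner d (bwd L dk W 0) x = vinner (dk 1) (bwd L dk W 1) (mat_vec d (W 1) x)"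
  using L_ge2 by (simp add: vinner_mat_vec bwd_step[of 0 L])

text \<open>When the updates of the whole norm and of the part along \<open>u\<close> are
  subtracted, the linear terms combine to the pairing of \<open>wgrad\<close> with the component of
  the product orthogonal to \<open>u\<close>, whose sign the support vectors control.\<close>

lemma off_axis_gd_step:
  assumes st: "gd_step \<eta> W W'" and u: "nsq d u = 1"
  shows "off_axis W' u \<le> off_axis W u - 2 * \<eta> * vinner d (perp W u) (wgrad W) + \<eta>\<^sup>2 * grad_sq W"
proof -
  let ?p = "bwd L dk W" and ?g = "wgrad W"
  have L0: "0 < L" using L_ge2 by simp
  have up: "W' 1 i l = W 1 i l - \<eta> * (?p 1 i * ?g l)" if "i < dk 1" "l < d" for i l
    using st L0 that by (auto simp: gd_step_def dest!: spec[of _ 0])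
  have 1: "frob_sq (dk 1) d (W' 1) = frob_sq (dk 1) d (W 1) - 2 * \<eta> * vinner d (?p 0) ?g
      + \<eta>\<^sup>2 * (nsq (dk 1) (?p 1) * nsq d ?g)"
    by (subst frob_sq_rank_one[OF up]) (simp_all add: bwd0_vinner)
  have 2: "nsq (dk 1) (mat_vec d (W' 1) u) = nsq (dk 1) (mat_vec d (W 1) u)
     - 2 * \<eta> * vinner d ?g u * vinner d (?p 0) u + \<eta>\<^sup>2 * (vinner d ?g u)\<^sup>2 * nsq (dk 1) (?p 1)"
    by (subst mat_vec_rank_one[OF up]) (simp_all add: bwd0_vinner)
  have 3: "\<eta>\<^sup>2 * (nsq (dk 1) (?p 1) * nsq d ?g) \<le> \<eta>\<^sup>2 * grad_sq W"
    using layer_grad_sq_le[OF L0, of W] by (intro mult_left_mono) auto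
  have 4: "0 \<le> \<eta>\<^sup>2 * (vinner d ?g u)\<^sup>2 * nsq (dk 1) (?p 1)" by simp
  have "vinner d (perp W u) ?g = vinner d (?p 0) ?g - vinner d (?p 0) u * vinner d ?g u"
    by (simp add: perp_def vinner_linear vinner_commute[of d ?g u])
  then have "2 * \<eta> * vinner d (perp W u) ?g = 2 * \<eta> * vinner d (?p 0) ?g - 2 * \<eta> * vinner d ?g u * vinner d (?p 0) u"
    by (simp only:) (simp add: right_diff_distrib)
  with 1 2 3 4 show ?thesis unfolding off_axis_def by linarith
qed

text \<open>For \<open>x = perp W u\<close>, \<open>nsq d x\<close> is the pairing of
  \<open>bwd L dk W 1\<close> with \<open>W 1\<close> applied to \<open>x\<close>. Cauchy-Schwarz
  and \<open>mat_vec_perp_bound\<close> apply, and one factor \<open>nsq d x\<close>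
  cancels.\<close>

lemma nsq_perp_upper:
  assumes u: "nsq d u = 1"
  shows "nsq d (perp W u) \<le> nsq (dk 1) (bwd L dk W 1) * off_axis W u"
proof -
  let ?x = "perp W u"
  have "nsq d ?x = vinner (dk 1) (bwd L dk W 1) (mat_vec d (W 1) ?x)"
    unfolding bwd0_vinner[symmetric] nsq_perp[OF u]
    by (simp add: perp_def vinner_diff_right vinner_scale_right power2_eq_square)
  then have "(nsq d ?x)\<^sup>2 \<le> nsq (dk 1) (bwd L dk W 1) * nsq (dk 1) (mat_vec d (W 1) ?x)"
    by (simp only: vinner_Cauchy_Schwarz)
  also have "\<dots> \<le> nsq (dk 1) (bwd L dk W 1) * (nsq d ?x * off_axis W u)"
    unfolding off_axis_def using perp_orthogonal[OF u] u by (intro mult_left_mono mat_vec_perp_bound) auto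
  finally have "nsq d ?x * nsq d ?x \<le> nsq d ?x * (nsq (dk 1) (bwd L dk W 1) * off_axis W u)"
    by (simp add: power2_eq_square mult_ac)
  then show ?thesis
    using off_axis_ge0[OF u, of W] by (cases "nsq d ?x = 0") (auto simp: mult_le_cancel_left less_le)
qed

section \<open>Quantitative alignment of a network with bounded imbalance\<close>

context
  fixes W :: "nat \<Rightarrow> nat \<Rightarrow> nat \<Rightarrow> real" and C :: real
  assumes C0: "0 \<le> C"
    and balanced: "\<And>k u. Suc k < L \<Longrightarrow> \<bar>imbal W k u\<bar> \<le> C * nsq (dk (Suc k)) u"
begin

definition top_sq :: real where "top_sq = frob_sq (dk L) (dk (L - 1)) (W L)"

lemma nsq_bwd_top: "nsq (dk L) (bwd L dk W L) = 1"
  by (simp add: bwd_top dk_top vinner_def)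

lemma nsq_bwd_below_top: "nsq (dk (L - 1)) (bwd L dk W (L - 1)) = top_sq"
proof -
  have "bwd L dk W (L - 1) = W L 0"
    using bwd_step[of "L - 1" L dk W] L_ge2 by (simp add: bwd_top dk_top vec_mat_def)
  then show ?thesis by (simp add: top_sq_def frob_sq_rows dk_top)
qed

text \<open>With \<open>q\<^sub>k = |p\<^sub>k|\<^sup>2\<close>: balance gives \<open>q\<^bsub>k-1\<^esub> = |W\<^sub>k\<^sup>T p\<^sub>k|\<^sup>2 \<ge> |W\<^bsub>k+1\<^esub> p\<^sub>k|\<^sup>2 - C q\<^sub>k\<close>, and
  Cauchy--Schwarz gives \<open>|W\<^bsub>k+1\<^esub> p\<^sub>k|\<^sup>2 q\<^bsub>k+1\<^esub> \<ge> q\<^sub>k\<^sup>2\<close>. Hence the ratios \<open>q\<^bsub>k-1\<^esub>/q\<^sub>k\<close> drop by at most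
  \<open>C\<close> per layer.\<close>

lemma bwd_ratio_aux:
  assumes "k \<le> L - 1" "real L * C < top_sq"
  shows "0 < nsq (dk (Suc k)) (bwd L dk W (Suc k)) \<and>
    (top_sq - real (L - 1 - k) * C) * nsq (dk (Suc k)) (bwd L dk W (Suc k)) \<le> nsq (dk k) (bwd L dk W k)"
  using assms(1)
proof (induction k rule: inc_induct)
  case base
  show ?case using nsq_bwd_top nsq_bwd_below_top L_ge2 by simp
next
  case (step k)
  let ?q = "\<lambda>k. nsq (dk k) (bwd L dk W k)"
  let ?m = "real (L - 1 - Suc k)"
  have k: "Suc k < L" using step(2) by simp
  have m: "real (L - 1 - k) = ?m + 1" using step(2) by linarith
  have "?m * C \<le> real L * C" using C0 by (intro mult_right_mono) auto
  then have pos: "0 < top_sq - ?m * C" using assms(2) by linarith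
  have q2: "0 < ?q (Suc (Suc k))" using step.IH by simp
  have ih: "(top_sq - ?m * C) * ?q (Suc (Suc k)) \<le> ?q (Suc k)" using step.IH by simp
  with pos q2 have q1: "0 < ?q (Suc k)" by (meson less_le_trans mult_pos_pos)
  let ?N = "nsq (dk (Suc (Suc k))) (mat_vec (dk (Suc k)) (W (Suc (Suc k))) (bwd L dk W (Suc k)))"
  have "(?q (Suc k))\<^sup>2 \<le> ?q (Suc (Suc k)) * ?N"
    using vinner_Cauchy_Schwarz[of "dk (Suc (Suc k))" "bwd L dk W (Suc (Suc k))" "mat_vec (dk (Suc k)) (W (Suc (Suc k))) (bwd L dk W (Suc k))"]
    by (simp add: vinner_mat_vec bwd_step[OF k])
  moreover have "?N \<le> ?q k + C * ?q (Suc k)"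
    using balanced[OF k, of "bwd L dk W (Suc k)"] k unfolding imbal_def by (simp add: bwd_step[of k L])
  ultimately have "(?q (Suc k))\<^sup>2 \<le> ?q (Suc (Suc k)) * (?q k + C * ?q (Suc k))"
    using q2 by (meson mult_left_mono order_trans less_imp_le)
  then have "?q (Suc (Suc k)) * ((top_sq - (?m + 1) * C) * ?q (Suc k)) \<le> ?q (Suc (Suc k)) * ?q k"
    using mult_right_mono[OF ih, of "?q (Suc k)"] q1 by (simp add: power2_eq_square algebra_simps)
  then have "(top_sq - (?m + 1) * C) * ?q (Suc k) \<le> ?q k"
    using q2 by (simp add: mult_le_cancel_left_pos)
  then show ?case unfolding m using q1 by simp
qed

lemma bwd_ratio:
  assumes "k < L" "real L * C < top_sq"
  shows "(top_sq - real L * C) * nsq (dk (Suc k)) (bwd L dk W (Suc k)) \<le> nsq (dk k) (bwd L dk W k)"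
proof -
  have "(top_sq - real L * C) * nsq (dk (Suc k)) (bwd L dk W (Suc k))
      \<le> (top_sq - real (L - 1 - k) * C) * nsq (dk (Suc k)) (bwd L dk W (Suc k))"
    using C0 by (intro mult_right_mono diff_left_mono) auto
  also have "\<dots> \<le> nsq (dk k) (bwd L dk W k)"
    using bwd_ratio_aux[of k] assms by linarith
  finally show ?thesis .
qed

lemma bwd_lower:
  assumes "k \<le> L" "real L * C < top_sq"
  shows "(top_sq - real L * C) ^ (L - k) \<le> nsq (dk k) (bwd L dk W k)"
  using assms(1)
proof (induction k rule: inc_induct)
  case base
  show ?case by (simp add: nsq_bwd_top)
next
  case (step k)
  have "(top_sq - real L * C) ^ (L - k) = (top_sq - real L * C) * (top_sq - real L * C) ^ (L - Suc k)"
    using step(2) by (simp add: Suc_diff_Suc[symmetric])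
  also have "\<dots> \<le> (top_sq - real L * C) * nsq (dk (Suc k)) (bwd L dk W (Suc k))"
    using assms(2) step by (intro mult_left_mono) auto
  also have "\<dots> \<le> nsq (dk k) (bwd L dk W k)" using step assms(2) by (intro bwd_ratio) auto
  finally show ?case .
qed

text \<open>The difference is the trace of the imbalance matrix, that is, the sum of
  \<open>imbal\<close> over the basis vectors of the shared layer.\<close>

lemma frob_sq_consecutive:
  assumes "Suc k < L"
  shows "\<bar>frob_sq (dk (Suc (Suc k))) (dk (Suc k)) (W (Suc (Suc k))) - frob_sq (dk (Suc k)) (dk k) (W (Suc k))\<bar>
    \<le> real (dk (Suc k)) * C"
proof -
  define e where "e = (\<lambda>c j::nat. if j = c then 1 else (0::real))"
  have imb: "imbal W k (e c) = (\<Sum>i<dk (Suc (Suc k)). (W (Suc (Suc k)) i c)\<^sup>2) - (\<Sum>j<dk k. (W (Suc k) c j)\<^sup>2)"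
    if "c < dk (Suc k)" for c
    unfolding imbal_def vinner_self_eq_sum mat_vec_def vec_mat_def e_def using that
    by (simp add: mult_delta_left mult_delta_right)
  have "frob_sq (dk (Suc (Suc k))) (dk (Suc k)) (W (Suc (Suc k))) - frob_sq (dk (Suc k)) (dk k) (W (Suc k))
    = (\<Sum>c<dk (Suc k). imbal W k (e c))"
    unfolding frob_sq_def by (subst sum.swap) (simp add: imb sum_subtractf)
  also have "\<bar>\<dots>\<bar> \<le> (\<Sum>c<dk (Suc k). C)"
  proof (intro order_trans[OF sum_abs] sum_mono)
    fix c assume "c \<in> {..<dk (Suc k)}"
    then have "nsq (dk (Suc k)) (e c) = 1" by (simp add: vinner_def e_def if_distrib cong: if_cong)
    then show "\<bar>imbal W k (e c)\<bar> \<le> C" using balanced[OF assms, of "e c"] by simp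
  qed
  finally show ?thesis by simp
qed

lemma frob_sq_near_top:
  assumes "k \<le> L - 1"
  shows "\<bar>frob_sq (dk (Suc k)) (dk k) (W (Suc k)) - top_sq\<bar> \<le> (\<Sum>j<L. real (dk (Suc j))) * C"
proof -
  have "\<bar>frob_sq (dk (Suc k)) (dk k) (W (Suc k)) - top_sq\<bar> \<le> (\<Sum>j\<in>{k..<L-1}. real (dk (Suc j))) * C"
    using assms
  proof (induction k rule: inc_induct)
    case base
    show ?case using L_ge2 by (simp add: top_sq_def)
  next
    case (step k)
    have "{k..<L-1} = insert k {Suc k..<L-1}" using step(2) by auto
    then have "(\<Sum>j\<in>{k..<L-1}. real (dk (Suc j))) * C = real (dk (Suc k)) * C + (\<Sum>j\<in>{Suc k..<L-1}. real (dk (Suc j))) * C"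
      by (simp add: distrib_right)
    moreover have "Suc k < L" using step(2) by simp
    note frob_sq_consecutive[OF this]
    ultimately show ?case using step.IH by linarith
  qed
  also have "\<dots> \<le> (\<Sum>j<L. real (dk (Suc j))) * C"
    using C0 by (intro mult_right_mono sum_mono2) auto
  finally show ?thesis .
qed

text \<open>The vector \<open>bwd L dk W 1\<close> captures the whole squared Frobenius norm of
  \<open>W 1\<close> up to a bounded error, so a large \<open>W 1\<close> is nearly of rank
  one.\<close>

lemma nsq_bwd0_lower:
  assumes "real L * C < top_sq"
  shows "(frob_sq (dk 1) d (W 1) - ((\<Sum>j<L. real (dk (Suc j))) * C + real L * C)) * nsq (dk 1) (bwd L dk W 1)
    \<le> nsq d (bwd L dk W 0)"
proof -
  have "frob_sq (dk 1) d (W 1) - ((\<Sum>j<L. real (dk (Suc j))) * C + real L * C) \<le> top_sq - real L * C"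
    using frob_sq_near_top[of 0] by simp
  then have "(frob_sq (dk 1) d (W 1) - ((\<Sum>j<L. real (dk (Suc j))) * C + real L * C)) * nsq (dk 1) (bwd L dk W 1)
    \<le> (top_sq - real L * C) * nsq (dk 1) (bwd L dk W 1)"
    by (rule mult_right_mono) simp
  also have "\<dots> \<le> nsq d (bwd L dk W 0)" using bwd_ratio[of 0] assms L_ge2 by simp
  finally show ?thesis .
qed

text \<open>Alignment of the layers: a large off-axis part of \<open>W\<^sub>1\<close> is visible in the product.\<close>

lemma nsq_perp_lower:
  assumes "real L * C < top_sq" "nsq d u = 1"
  shows "nsq (dk 1) (bwd L dk W 1) * (off_axis W u - ((\<Sum>j<L. real (dk (Suc j))) * C + real L * C))
    \<le> nsq d (perp W u)"
proof -
  have "(vinner d (bwd L dk W 0) u)\<^sup>2 \<le> nsq (dk 1) (bwd L dk W 1) * nsq (dk 1) (mat_vec d (W 1) u)"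
    unfolding bwd0_vinner by (rule vinner_Cauchy_Schwarz)
  with nsq_bwd0_lower[OF assms(1)] show ?thesis
    unfolding nsq_perp[OF assms(2)] off_axis_def by (simp add: algebra_simps)
qed

end

lemma bwd_upper:
  "k \<le> L \<Longrightarrow> nsq (dk k) (bwd L dk W k) \<le> (\<Prod>j\<in>{k..<L}. frob_sq (dk (Suc j)) (dk j) (W (Suc j)))"
proof (induction k rule: inc_induct)
  case base
  show ?case by (simp add: bwd_top dk_top vinner_def)
next
  case (step k)
  have "{k..<L} = insert k {Suc k..<L}" using step(2) by auto
  then have "(\<Prod>j\<in>{k..<L}. frob_sq (dk (Suc j)) (dk j) (W (Suc j)))
     = frob_sq (dk (Suc k)) (dk k) (W (Suc k)) * (\<Prod>j\<in>{Suc k..<L}. frob_sq (dk (Suc j)) (dk j) (W (Suc j)))" by simp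
  moreover have "nsq (dk k) (bwd L dk W k) \<le> frob_sq (dk (Suc k)) (dk k) (W (Suc k)) * nsq (dk (Suc k)) (bwd L dk W (Suc k))"
    unfolding bwd_step[OF step(2)] by (rule vec_mat_bound)
  ultimately show ?case using step by (smt (verit) frob_sq_ge0 mult_left_mono)
qed

end

section \<open>Maximum margin direction and support vectors\<close>

lemma continuous_on_vinner_left: "continuous_on S (\<lambda>u. vinner m u v)"
  unfolding vinner_def
  by (intro continuous_on_sum continuous_on_mult continuous_on_const
      continuous_on_product_then_coordinatewise[OF continuous_on_id])

lemma continuous_on_nsq: "continuous_on S (\<lambda>u. nsq m u)"
  unfolding vinner_def
  by (intro continuous_on_sum continuous_on_mult
      continuous_on_product_then_coordinatewise[OF continuous_on_id])

lemma continuous_on_Min_image: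
  fixes f :: "'i \<Rightarrow> 'a::topological_space \<Rightarrow> real"
  assumes "finite I" "I \<noteq> {}" "\<And>i. i \<in> I \<Longrightarrow> continuous_on S (f i)"
  shows "continuous_on S (\<lambda>x. Min ((\<lambda>i. f i x) ` I))"
  using assms
proof (induction I rule: finite_ne_induct)
  case (insert i I)
  then have "(\<lambda>x. Min ((\<lambda>i. f i x) ` insert i I)) = (\<lambda>x. min (f i x) (Min ((\<lambda>i. f i x) ` I)))"
    by simp
  with insert show ?case by (auto intro!: continuous_on_min)
qed simp

lemma unit_vec_iff: "unit_vec m u \<longleftrightarrow> nsq m u = 1 \<and> (\<forall>j\<ge>m. u j = 0)"
  by (simp add: unit_vec_def vnorm_def)

text \<open>Vectors are functions on all naturals with the product topology; being zero from index
  \<open>m\<close> on places unit vectors in a compact product of intervals.\<close>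

lemma compact_unit_vec: "compact {u. unit_vec m u}"
proof -
  let ?B = "PiE UNIV (\<lambda>j. if j < m then {-1..1} else {0::real})"
  have "compactin (product_topology (\<lambda>_. euclidean) UNIV) ?B"
    by (subst compactin_PiE) auto
  then have B: "compact ?B"
    by (simp add: euclidean_product_topology)
  have "closed ({u. nsq m u = 1} \<inter> (\<Inter>j\<in>{m..}. {u. u j = (0::real)}))"
    by (intro closed_Int closed_INT ballI closed_Collect_eq continuous_on_nsq continuous_on_const
        continuous_on_product_then_coordinatewise[OF continuous_on_id])
  also have "{u. nsq m u = 1} \<inter> (\<Inter>j\<in>{m..}. {u. u j = (0::real)}) = {u. unit_vec m u}"
    by (auto simp: unit_vec_iff)
  finally have "compact (?B \<inter> {u. unit_vec m u})" using B by blast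
  also have "?B \<inter> {u. unit_vec m u} = {u. unit_vec m u}"
  proof -
    have "u j \<in> (if j < m then {-1..1} else {0})" if "unit_vec m u" for u j
    proof (cases "j < m")
      case True
      then have "(u j)\<^sup>2 \<le> nsq m u"
        unfolding vinner_self_eq_sum by (intro member_le_sum) auto
      then have "\<bar>u j\<bar> \<le> 1" using that by (simp add: unit_vec_iff abs_square_le_1)
      with True show ?thesis by auto
    qed (use that in \<open>auto simp: unit_vec_iff\<close>)
    then show ?thesis by auto
  qed
  finally show ?thesis .
qed

definition normalized :: "nat \<Rightarrow> (nat \<Rightarrow> real) \<Rightarrow> nat \<Rightarrow> real" where
  "normalized m u = (\<lambda>j. if j < m then u j / vnorm m u else 0)"

lemma vinner_normalized: "vinner m (normalized m u) v = vinner m u v / vnorm m u"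
  by (simp add: vinner_def normalized_def sum_divide_distrib)

lemma unit_vec_normalized:
  assumes "nsq m u \<noteq> 0"
  shows "unit_vec m (normalized m u)"
proof -
  have "nsq m (normalized m u) = nsq m u / (vnorm m u)\<^sup>2"
    by (simp add: vinner_normalized vinner_commute[of m u "normalized m u"] power2_eq_square)
  then show ?thesis using assms by (simp add: unit_vec_iff vnorm_sq) (simp add: normalized_def)
qed

lemma unit_vec_exists: "1 \<le> m \<Longrightarrow> \<exists>u. unit_vec m u"
  by (rule exI[of _ "\<lambda>j. if j = 0 then 1 else 0"])
    (auto simp: unit_vec_iff vinner_indicator_right)

text \<open>Orthogonal projection onto a span, by Gram-Schmidt along the index set; the vectors may
  be dependent.\<close>

lemma span_decomposition:
  fixes z :: "nat \<Rightarrow> nat \<Rightarrow> real"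
  assumes "finite T"
  shows "\<exists>c b. (\<forall>j. u j = (\<Sum>i\<in>T. c i * z i j) + b j) \<and> (\<forall>i\<in>T. vinner m b (z i) = 0)"
  using assms
proof (induction T arbitrary: u)
  case empty
  show ?case by (intro exI[of _ "\<lambda>_. 0"] exI[of _ u]) simp
next
  case (insert k T)
  obtain c b where u: "\<And>j. u j = (\<Sum>i\<in>T. c i * z i j) + b j" and b: "\<And>i. i \<in> T \<Longrightarrow> vinner m b (z i) = 0"
    using insert.IH[of u] by blast
  obtain c' b' where zk: "\<And>j. z k j = (\<Sum>i\<in>T. c' i * z i j) + b' j" and b': "\<And>i. i \<in> T \<Longrightarrow> vinner m b' (z i) = 0"
    using insert.IH[of "z k"] by blast
  have perp_zk: "vinner m x (z k) = vinner m x b'" if "\<And>i. i \<in> T \<Longrightarrow> vinner m x (z i) = 0" for x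
  proof -
    have "z k = (\<lambda>j. (\<Sum>i\<in>T. c' i * z i j) + b' j)" using zk by auto
    then show ?thesis using that by (simp add: vinner_add_right vinner_sum_right vinner_scale_right)
  qed
  \<comment> \<open>\<open>b'\<close> is the part of \<open>z k\<close> orthogonal to the earlier
    vectors, and \<mu> the Gram-Schmidt coefficient along it. If \<open>b'\<close> vanishes,
    \<open>z k\<close> adds nothing to the span, and 0 is right.\<close>
  define \<mu> where "\<mu> = (if nsq m b' = 0 then 0 else vinner m b b' / nsq m b')"
  define b2 where "b2 = (\<lambda>j. b j - \<mu> * b' j)"
  have T0: "vinner m b2 (z i) = 0" if "i \<in> T" for i
    unfolding b2_def using b[OF that] b'[OF that] by (simp add: vinner_linear)
  have "vinner m b b' = 0" if "nsq m b' = 0"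
    using vinner_Cauchy_Schwarz[of m b b'] that by simp
  then have "vinner m b2 b' = 0"
    by (auto simp: b2_def \<mu>_def vinner_linear)
  then have "vinner m b2 (z k) = 0" using perp_zk[of b2] T0 by simp
  moreover have "u j = (\<Sum>i\<in>insert k T. (if i = k then \<mu> else c i - \<mu> * c' i) * z i j) + b2 j" for j
  proof -
    have "(\<Sum>i\<in>insert k T. (if i = k then \<mu> else c i - \<mu> * c' i) * z i j) = \<mu> * z k j + (\<Sum>i\<in>T. (c i - \<mu> * c' i) * z i j)"
      using insert.hyps by (auto intro!: sum.cong)
    also have "(\<Sum>i\<in>T. (c i - \<mu> * c' i) * z i j) = (\<Sum>i\<in>T. c i * z i j) - \<mu> * (\<Sum>i\<in>T. c' i * z i j)"
      by (simp add: sum_subtractf sum_distrib_left left_diff_distrib mult.assoc)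
    finally show ?thesis using u[of j] zk[of j] by (simp add: b2_def algebra_simps)
  qed
  ultimately show ?case using T0
    by (intro exI[of _ "\<lambda>i. if i = k then \<mu> else c i - \<mu> * c' i"] exI[of _ b2]) blast
qed

text \<open>A vector in the span of the points of \<open>T\<close> having inner product 1 with each
  of them is determined by these points. That a further point \<open>i0\<close> lies on the same
  hyperplane is a coincidence of codimension one.\<close>

definition degenerate :: "nat \<Rightarrow> nat \<Rightarrow> (nat \<Rightarrow> nat \<Rightarrow> real) \<Rightarrow> bool" where
  "degenerate n d z \<longleftrightarrow> (\<exists>T c i0. T \<subseteq> {..<n} \<and> i0 < n \<and> i0 \<notin> T \<and>
     (\<forall>i\<in>insert i0 T. vinner d (\<lambda>j. \<Sum>k\<in>T. c k * z k j) (z i) = 1))"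

locale separable_data =
  fixes n d :: nat and z :: "nat \<Rightarrow> nat \<Rightarrow> real"
  assumes n_ge1: "1 \<le> n" and d_ge1: "1 \<le> d" and sep: "lin_separable n d z"
begin

abbreviation ub :: "nat \<Rightarrow> real" where "ub \<equiv> ubar n d z"
abbreviation \<gamma> :: real where "\<gamma> \<equiv> gamma n d z"

lemma indices_nonempty: "{..<n} \<noteq> {}"
  using n_ge1 by (auto simp: lessThan_empty_iff)

lemma le_margin_iff: "c \<le> margin n d z u \<longleftrightarrow> (\<forall>i<n. c \<le> vinner d u (z i))"
  unfolding margin_def using indices_nonempty by (subst Min_ge_iff) auto

lemma margin_le: "i < n \<Longrightarrow> margin n d z u \<le> vinner d u (z i)"
  using le_margin_iff[of "margin n d z u" u] by simp

lemma margin_attained: "\<exists>i<n. vinner d u (z i) = margin n d z u"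
proof -
  have "margin n d z u \<in> (\<lambda>i. vinner d u (z i)) ` {..<n}"
    unfolding margin_def using indices_nonempty by (intro Min_in) auto
  then show ?thesis by auto
qed

text \<open>A scale-free form of maximality. Since \<open>g\<close> is any upper bound on
  unit-vector margins, it serves before \<open>ub\<close> is identified as well as
  afterwards.\<close>

lemma max_margin_scaled:
  assumes max: "\<And>v. unit_vec d v \<Longrightarrow> margin n d z v \<le> g"
    and c: "0 < c" "\<And>i. i < n \<Longrightarrow> c \<le> vinner d u (z i)"
  shows "c \<le> g * vnorm d u"
proof -
  have "nsq d u \<noteq> 0"
  proof
    assume "nsq d u = 0"
    then have "vinner d u (z 0) = 0" using vinner_Cauchy_Schwarz[of d u "z 0"] by simp
    then show False using c(1) c(2)[of 0] n_ge1 by simp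
  qed
  then have pos: "0 < vnorm d u" and unit: "unit_vec d (normalized d u)"
    using vnorm_ge0[of d u] unit_vec_normalized[of d u] by (auto simp: less_le vnorm_def)
  have "c / vnorm d u \<le> margin n d z (normalized d u)"
    unfolding le_margin_iff vinner_normalized using c(2) pos by (auto intro!: divide_right_mono)
  also have "\<dots> \<le> g" using max unit by blast
  finally show ?thesis using pos by (simp add: field_simps)
qed

lemma ubar_max: "unit_vec d ub \<and> (\<forall>v. unit_vec d v \<longrightarrow> margin n d z v \<le> \<gamma>)" and gamma_pos: "0 < \<gamma>"
proof -
  have "\<exists>u\<in>{u. unit_vec d u}. \<forall>v\<in>{u. unit_vec d u}. margin n d z v \<le> margin n d z u"
    unfolding margin_def using indices_nonempty d_ge1 unit_vec_exists[of d]
    by (intro continuous_attains_sup compact_unit_vec continuous_on_Min_image continuous_on_vinner_left) auto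
  then obtain u where u: "unit_vec d u" "\<And>v. unit_vec d v \<Longrightarrow> margin n d z v \<le> margin n d z u" by auto
  obtain s where s: "\<And>i. i < n \<Longrightarrow> 0 < vinner d s (z i)" using sep by (auto simp: lin_separable_def)
  obtain i where "i < n" "vinner d s (z i) = margin n d z s" using margin_attained by blast
  with s[of i] have "0 < margin n d z s" by simp
  then have "margin n d z s \<le> margin n d z u * vnorm d s"
    by (intro max_margin_scaled u margin_le)
  with \<open>0 < margin n d z s\<close> have "0 < margin n d z u * vnorm d s" by linarith
  then have pos: "0 < margin n d z u"
    using vnorm_ge0[of d s] by (simp add: zero_less_mult_iff)
  have uniq: "v = u" if v: "unit_vec d v" "\<And>w. unit_vec d w \<Longrightarrow> margin n d z w \<le> margin n d z v" for v
  proof -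
    let ?g = "margin n d z u"
    have eq: "margin n d z v = ?g" using u v by (meson order_antisym)
    \<comment> \<open>The sum of two maximizers has margin at least \<open>2 * ?g\<close>, hence
      norm at least 2; the parallelogram identity for unit vectors then forces them to
      coincide.\<close>
    have "?g * 2 \<le> ?g * vnorm d (\<lambda>j. u j + v j)"
    proof (rule max_margin_scaled)
      fix i assume "i < n"
      then show "?g * 2 \<le> vinner d (\<lambda>j. u j + v j) (z i)"
        using margin_le[of i u] margin_le[of i v] eq by (simp add: vinner_linear)
    qed (use u pos in auto)
    then have "2 \<le> vnorm d (\<lambda>j. u j + v j)" using pos by simp
    then have "2\<^sup>2 \<le> (vnorm d (\<lambda>j. u j + v j))\<^sup>2" by (intro power_mono) auto
    then have "4 \<le> nsq d (\<lambda>j. u j + v j)" by (simp add: vnorm_sq)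
    then have "nsq d (\<lambda>j. u j - v j) \<le> 0"
      using u(1) v(1) by (simp add: vinner_linear unit_vec_iff vinner_commute[of d v u])
    then have "nsq d (\<lambda>j. u j - v j) = 0" by (simp add: order_antisym)
    then have "\<forall>j<d. u j = v j" by (simp add: vinner_self_eq0)
    then show "v = u" using u(1) v(1) unfolding unit_vec_iff fun_eq_iff by (metis not_le)
  qed
  have "ub = u" unfolding ubar_def
  proof (rule the_equality)
    show "unit_vec d u \<and> (\<forall>v. unit_vec d v \<longrightarrow> margin n d z v \<le> margin n d z u)" using u by blast
  qed (use uniq in blast)
  with u pos show "unit_vec d ub \<and> (\<forall>v. unit_vec d v \<longrightarrow> margin n d z v \<le> \<gamma>)" "0 < \<gamma>"
    by (auto simp: gamma_def)
qed

lemma nsq_ub: "nsq d ub = 1"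
  using ubar_max by (simp add: unit_vec_iff)

lemma gamma_le: "i < n \<Longrightarrow> \<gamma> \<le> vinner d ub (z i)"
  unfolding gamma_def by (rule margin_le)

abbreviation supp :: "nat set" where "supp \<equiv> {i. i < n \<and> vinner d ub (z i) = \<gamma>}"

text \<open>If \<open>\<xi>\<close> violated the claim, \<open>ub\<close> would lie in the span of the support vectors orthogonal to
  \<open>\<xi>\<close>, for otherwise tilting \<open>ub\<close> away from its component \<open>b\<close> orthogonal to them, and slightly
  towards \<open>\<xi>\<close>, would increase the margin. But then \<open>ub / \<gamma>\<close> witnesses degeneracy.\<close>

lemma support_vector_negative:
  assumes a3: "assumption3 n d z" and gp: "\<not> degenerate n d z"
    and \<xi>: "vinner d ub \<xi> = 0" "nsq d \<xi> \<noteq> 0"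
  shows "\<exists>i\<in>supp. vinner d \<xi> (z i) < 0"
proof (rule ccontr)
  assume "\<not> (\<exists>i\<in>supp. vinner d \<xi> (z i) < 0)"
  then have nonneg: "\<And>i. i \<in> supp \<Longrightarrow> 0 \<le> vinner d \<xi> (z i)" by force
  define T where "T = {i \<in> supp. vinner d \<xi> (z i) = 0}"
  have fT: "finite T" by (simp add: T_def)
  obtain c b where ub: "\<And>j. ub j = (\<Sum>i\<in>T. c i * z i j) + b j" and b: "\<And>i. i \<in> T \<Longrightarrow> vinner d b (z i) = 0"
    using span_decomposition[OF fT] by blast
  \<comment> \<open>By \<open>assumption3\<close>, \<xi> is a combination of support vectors, so
    being nonzero it is not orthogonal to all of them.\<close>
  obtain i0 where i0: "i0 \<in> supp" "i0 \<notin> T"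
  proof -
    obtain e where e: "\<And>j. j < d \<Longrightarrow> \<xi> j = (\<Sum>i\<in>supp. e i * z i j)"
      using a3 unfolding assumption3_def by blast
    have "nsq d \<xi> = vinner d \<xi> (\<lambda>j. \<Sum>i\<in>supp. e i * z i j)"
      by (rule vinner_cong) (use e in auto)
    also have "\<dots> = (\<Sum>i\<in>supp. e i * vinner d \<xi> (z i))"
      by (simp add: vinner_sum_right vinner_scale_right)
    finally have "\<exists>i\<in>supp. vinner d \<xi> (z i) \<noteq> 0" using \<xi>(2) by (metis (no_types, lifting) mult_zero_right sum.neutral)
    then show ?thesis using that by (auto simp: T_def)
  qed
  have ubfun: "ub = (\<lambda>j. (\<Sum>i\<in>T. c i * z i j) + b j)" using ub by auto
  have bpos: "0 < nsq d b"
  proof (rule ccontr)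
    assume "\<not> 0 < nsq d b"
    then have "nsq d b = 0" by (simp add: order_antisym)
    then have "\<forall>j<d. b j = 0" by (simp add: vinner_self_eq0)
    then have "\<And>j. j < d \<Longrightarrow> (\<Sum>k\<in>T. c k / \<gamma> * z k j) = 1 / \<gamma> * ub j"
      using ub by (simp add: sum_divide_distrib)
    then have "vinner d (\<lambda>j. \<Sum>k\<in>T. c k / \<gamma> * z k j) (z i) = vinner d (\<lambda>j. 1 / \<gamma> * ub j) (z i)" for i
      by (intro vinner_cong) auto
    then have "vinner d (\<lambda>j. \<Sum>k\<in>T. c k / \<gamma> * z k j) (z i) = 1" if "i \<in> supp" for i
      using that gamma_pos by (simp only: vinner_scale_left) simp
    moreover have "insert i0 T \<subseteq> supp" using i0 by (auto simp: T_def)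
    ultimately have "degenerate n d z" unfolding degenerate_def using i0
      by (intro exI[of _ T] exI[of _ "\<lambda>k. c k / \<gamma>"] exI[of _ i0]) (auto simp: T_def)
    with gp show False ..
  qed
  have ubb: "vinner d ub b = nsq d b"
  proof -
    have "vinner d b ub = nsq d b" by (subst ubfun) (simp add: vinner_add_right vinner_sum_right vinner_scale_right b)
    then show ?thesis by (simp add: vinner_commute)
  qed
  obtain M where M: "\<And>i. i \<in> supp \<Longrightarrow> i \<notin> T \<Longrightarrow> vinner d b (z i) \<le> M * vinner d \<xi> (z i)"
  proof -
    let ?f = "\<lambda>i. vinner d b (z i) / vinner d \<xi> (z i)"
    have "vinner d b (z i) \<le> Max (insert 0 (?f ` supp)) * vinner d \<xi> (z i)" if "i \<in> supp" "i \<notin> T" for i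
    proof -
      have p: "0 < vinner d \<xi> (z i)" using nonneg[of i] that by (auto simp: T_def)
      have "?f i \<le> Max (insert 0 (?f ` supp))" using that by (intro Max_ge) auto
      then show ?thesis using p by (simp add: pos_divide_le_eq)
    qed
    then show ?thesis using that by blast
  qed
  \<comment> \<open>\<open>M\<close> is large enough that \<open>h\<close> has nonnegative inner
    product with every support vector, while its inner product with \<open>ub\<close> is
    \<open>- nsq d b\<close>. A small step along \<open>h\<close> thus keeps the margin at least
    \<gamma> but makes the norm smaller than 1.\<close>
  define h where "h = (\<lambda>j. M * \<xi> j - b j)"
  have ubh: "vinner d ub h = - nsq d b"
    using \<xi>(1) ubb by (simp add: h_def vinner_linear)
  let ?u = "\<lambda>\<epsilon> j. ub j + \<epsilon> * h j"
  have ev1: "\<forall>\<^sub>F \<epsilon> in at_right 0. \<forall>i\<in>{..<n}. \<gamma> \<le> vinner d (?u \<epsilon>) (z i)"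
  proof (rule eventually_ball_finite)
    show "\<forall>i\<in>{..<n}. \<forall>\<^sub>F \<epsilon> in at_right 0. \<gamma> \<le> vinner d (?u \<epsilon>) (z i)"
    proof
      fix i assume i: "i \<in> {..<n}"
      have eq: "vinner d (?u \<epsilon>) (z i) = vinner d ub (z i) + \<epsilon> * vinner d h (z i)" for \<epsilon>
        by (simp add: vinner_linear)
      show "\<forall>\<^sub>F \<epsilon> in at_right 0. \<gamma> \<le> vinner d (?u \<epsilon>) (z i)"
      proof (cases "i \<in> supp")
        case True
        then have "0 \<le> vinner d h (z i)"
          using M[of i] b[of i] by (cases "i \<in> T") (auto simp: h_def vinner_linear T_def)
        then have "\<gamma> \<le> vinner d (?u \<epsilon>) (z i)" if "0 < \<epsilon>" for \<epsilon>
          using True that unfolding eq by simp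
        then show ?thesis by (auto simp: eventually_at_filter)
      next
        case False
        then have "\<gamma> < vinner d ub (z i)" using gamma_le[of i] i by auto
        moreover have "((\<lambda>\<epsilon>. vinner d ub (z i) + \<epsilon> * vinner d h (z i)) \<longlongrightarrow> vinner d ub (z i) + 0 * vinner d h (z i)) (at_right 0)"
          by (intro tendsto_intros)
        ultimately have "\<forall>\<^sub>F \<epsilon> in at_right 0. \<gamma> < vinner d ub (z i) + \<epsilon> * vinner d h (z i)"
          by (intro order_tendstoD(1)) auto
        then show ?thesis unfolding eq by (rule eventually_mono) simp
      qed
    qed
  qed simp
  have "((\<lambda>\<epsilon>. \<epsilon> * nsq d h) \<longlongrightarrow> 0 * nsq d h) (at_right 0)" by (intro tendsto_intros)
  then have "\<forall>\<^sub>F \<epsilon> in at_right 0. \<epsilon> * nsq d h < 2 * nsq d b"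
    using bpos by (intro order_tendstoD(2)) auto
  moreover have "\<forall>\<^sub>F \<epsilon> in at_right (0::real). 0 < \<epsilon>" by (auto simp: eventually_at_filter)
  ultimately have "\<forall>\<^sub>F \<epsilon> in at_right (0::real). (\<forall>i\<in>{..<n}. \<gamma> \<le> vinner d (?u \<epsilon>) (z i)) \<and> \<epsilon> * nsq d h < 2 * nsq d b \<and> 0 < \<epsilon>"
    using ev1 by eventually_elim auto
  then obtain \<epsilon> :: real where \<epsilon>: "\<And>i. i < n \<Longrightarrow> \<gamma> \<le> vinner d (?u \<epsilon>) (z i)" "\<epsilon> * nsq d h < 2 * nsq d b" "0 < \<epsilon>"
    using eventually_happens'[OF trivial_limit_at_right_real] by (metis (no_types, lifting) lessThan_iff)
  have "\<gamma> \<le> \<gamma> * vnorm d (?u \<epsilon>)"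
    using ubar_max gamma_pos \<epsilon>(1) by (intro max_margin_scaled) auto
  then have "1 \<le> vnorm d (?u \<epsilon>)" using gamma_pos by simp
  then have "1 \<le> nsq d (?u \<epsilon>)" by (simp add: vnorm_def)
  also have "nsq d (?u \<epsilon>) = 1 - 2 * \<epsilon> * nsq d b + \<epsilon> * (\<epsilon> * nsq d h)"
    using nsq_ub ubh by (simp add: vinner_linear vinner_commute[of d h ub] algebra_simps)
  also have "\<dots> < 1 - 2 * \<epsilon> * nsq d b + \<epsilon> * (2 * nsq d b)"
    using \<epsilon> by simp
  finally show False by simp
qed

text \<open>Compactness of the unit sphere orthogonal to \<open>ub\<close> makes the sign condition
  quantitative; homogeneity extends it to all \<xi>.\<close>

lemma support_vector_uniform:
  assumes a3: "assumption3 n d z" and gp: "\<not> degenerate n d z"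
  shows "\<exists>\<alpha>>0. \<forall>\<xi>. vinner d ub \<xi> = 0 \<longrightarrow> (\<exists>i\<in>supp. vinner d \<xi> (z i) \<le> - \<alpha> * vnorm d \<xi>)"
proof -
  let ?P = "{u. unit_vec d u} \<inter> {u. vinner d u ub = 0}"
  let ?f = "\<lambda>u. Min ((\<lambda>i. vinner d u (z i)) ` supp)"
  obtain s0 where s0: "s0 \<in> supp" using margin_attained[of ub] by (auto simp: gamma_def)
  have cP: "compact ?P"
    by (intro compact_Int_closed compact_unit_vec closed_Collect_eq continuous_on_vinner_left continuous_on_const)
  have "\<exists>\<alpha>>0. \<forall>u\<in>?P. ?f u \<le> - \<alpha>"
  \<comment> \<open>In dimension one no unit vector is orthogonal to \<open>ub\<close>.\<close>
  proof (cases "?P = {}")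
    case True
    then show ?thesis by (intro exI[of _ 1]) auto
  next
    case False
    have "continuous_on ?P ?f"
      using s0 by (intro continuous_on_Min_image continuous_on_vinner_left) auto
    then obtain u0 where u0: "u0 \<in> ?P" "\<And>u. u \<in> ?P \<Longrightarrow> ?f u \<le> ?f u0"
      using continuous_attains_sup[OF cP False] by blast
    have "\<exists>i\<in>supp. vinner d u0 (z i) < 0"
      using u0(1) by (intro support_vector_negative[OF a3 gp]) (auto simp: unit_vec_iff vinner_commute)
    then have "?f u0 < 0" using s0 by (subst Min_less_iff) auto
    with u0 show ?thesis by (intro exI[of _ "- ?f u0"]) auto
  qed
  then obtain \<alpha> where \<alpha>: "0 < \<alpha>" "\<And>u. u \<in> ?P \<Longrightarrow> ?f u \<le> - \<alpha>" by blast
  have "\<exists>i\<in>supp. vinner d \<xi> (z i) \<le> - \<alpha> * vnorm d \<xi>" if \<xi>: "vinner d ub \<xi> = 0" for \<xi>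
  proof (cases "nsq d \<xi> = 0")
    case True
    then have "vinner d \<xi> (z s0) = 0" using vinner_Cauchy_Schwarz[of d \<xi> "z s0"] by simp
    with True s0 show ?thesis by (intro bexI[of _ s0]) (auto simp: vnorm_def)
  next
    case False
    then have "normalized d \<xi> \<in> ?P" using \<xi> by (simp add: unit_vec_normalized vinner_normalized vinner_commute)
    then have "?f (normalized d \<xi>) \<le> - \<alpha>" by (rule \<alpha>)
    then obtain i where i: "i \<in> supp" "vinner d (normalized d \<xi>) (z i) \<le> - \<alpha>"
      using s0 by (subst (asm) Min_le_iff) auto
    have "0 < vnorm d \<xi>" using False vnorm_ge0[of d \<xi>] by (auto simp: less_le vnorm_def)
    with i show ?thesis by (intro bexI[of _ i]) (auto simp: vinner_normalized pos_divide_le_eq)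
  qed
  with \<alpha>(1) show ?thesis by blast
qed

text \<open>Writing \<open>w = a ub + \<xi>\<close>, every data point contributes at most \<open>exp (- a \<gamma>)\<close> to the sum, while
  the support vector with \<open>\<langle>\<xi>, z\<^sub>i\<rangle> \<le> - \<alpha> |\<xi>|\<close> contributes at most \<open>- exp (- a \<gamma>) \<alpha> |\<xi>| / 2\<close>.\<close>

lemma gradient_points_to_ubar:
  assumes \<alpha>: "0 < \<alpha>" "\<And>\<xi>. vinner d ub \<xi> = 0 \<Longrightarrow> \<exists>i\<in>supp. vinner d \<xi> (z i) \<le> - \<alpha> * vnorm d \<xi>"
    and w: "\<And>i. i < n \<Longrightarrow> 0 \<le> vinner d w (z i)"
    and \<xi>: "\<xi> = (\<lambda>j. w j - vinner d w ub * ub j)"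
  shows "0 \<le> vinner d w ub"
    and "2 * real n / \<alpha> \<le> vnorm d \<xi> \<Longrightarrow> (\<Sum>i<n. sig (vinner d w (z i)) * vinner d \<xi> (z i)) \<le> 0"
proof -
  let ?a = "vinner d w ub"
  have orth: "vinner d ub \<xi> = 0"
    using nsq_ub by (simp add: \<xi> vinner_linear vinner_commute[of d ub w])
  obtain s where s: "s < n" "vinner d ub (z s) = \<gamma>" "vinner d \<xi> (z s) \<le> - \<alpha> * vnorm d \<xi>"
    using \<alpha>(2)[OF orth] by auto
  have wz: "vinner d w (z i) = ?a * vinner d ub (z i) + vinner d \<xi> (z i)" for i
    by (simp add: \<xi> vinner_linear)
  have "0 \<le> \<alpha> * vnorm d \<xi>" using \<alpha>(1) by simp
  \<comment> \<open>The support vector \<open>s\<close> has nonnegative margin although its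
    \<xi>-part is nonpositive, so the \<open>ub\<close>-part must be nonnegative.\<close>
  then have "0 \<le> ?a * \<gamma>" using w[OF s(1)] s unfolding wz by simp
  then show a0: "0 \<le> ?a" using gamma_pos by (simp add: zero_le_mult_iff)
  let ?E = "exp (- (?a * \<gamma>))"
  have contrib: "sig (vinner d w (z i)) * vinner d \<xi> (z i) \<le> ?E" if "i < n" for i
  proof (cases "vinner d \<xi> (z i) \<le> 0")
    case True
    then show ?thesis using sig_pos[of "vinner d w (z i)"]
      by (smt (verit) exp_gt_zero mult_nonneg_nonpos)
  next
    case False
    let ?r = "vinner d \<xi> (z i)"
    have "?a * \<gamma> \<le> ?a * vinner d ub (z i)" using gamma_le[OF that] a0 by (rule mult_left_mono)
    then have "- vinner d w (z i) \<le> - (?a * \<gamma>) - ?r" unfolding wz by simp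
    then have "sig (vinner d w (z i)) \<le> exp (- (?a * \<gamma>) - ?r)"
      using sig_le_exp[of "vinner d w (z i)"] by (smt (verit) exp_le_cancel_iff)
    then have "sig (vinner d w (z i)) * ?r \<le> exp (- (?a * \<gamma>) - ?r) * ?r"
      using False by (intro mult_right_mono) auto
    also have "\<dots> \<le> exp (- (?a * \<gamma>) - ?r) * exp ?r"
    proof (rule mult_left_mono)
      show "?r \<le> exp ?r" using exp_ge_add_one_self[of ?r] by linarith
    qed simp
    also have "\<dots> = ?E" by (simp flip: exp_add)
    finally show ?thesis .
  qed
  assume "2 * real n / \<alpha> \<le> vnorm d \<xi>"
  then have big: "2 * real n \<le> \<alpha> * vnorm d \<xi>" using \<alpha>(1) by (simp add: field_simps)
  have "?E / 2 \<le> sig (vinner d w (z s))"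
  proof -
    have "vinner d w (z s) \<le> ?a * \<gamma>" using s \<open>0 \<le> \<alpha> * vnorm d \<xi>\<close> unfolding wz by simp
    then have "?E \<le> exp (- vinner d w (z s))" by simp
    then show ?thesis using sig_ge_exp[OF w[OF s(1)]] by linarith
  qed
  \<comment> \<open>The threshold \<open>2 * real n / \<alpha>\<close> is chosen so that this single
    term is at most \<open>- (real n * ?E)\<close>, which outweighs at most \<open>?E\<close> from
    each of the other points.\<close>
  then have "?E / 2 * (2 * real n) \<le> sig (vinner d w (z s)) * (\<alpha> * vnorm d \<xi>)"
    using big sig_pos[of "vinner d w (z s)"] by (intro mult_mono[of "?E / 2" _ "2 * real n"]) auto
  also have "\<dots> \<le> sig (vinner d w (z s)) * (- vinner d \<xi> (z s))"
    using s(3) sig_pos[of "vinner d w (z s)"] by (intro mult_left_mono) auto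
  finally have neg: "sig (vinner d w (z s)) * vinner d \<xi> (z s) \<le> - (real n * ?E)" by (simp add: mult.commute[of ?E])
  have "(\<Sum>i<n. sig (vinner d w (z i)) * vinner d \<xi> (z i)) =
     sig (vinner d w (z s)) * vinner d \<xi> (z s) + (\<Sum>i\<in>{..<n} - {s}. sig (vinner d w (z i)) * vinner d \<xi> (z i))"
    using s(1) by (subst sum.remove[of _ s]) auto
  also have "\<dots> \<le> - (real n * ?E) + (\<Sum>i\<in>{..<n} - {s}. ?E)"
    using neg contrib by (intro add_mono sum_mono) auto
  also have "(\<Sum>i\<in>{..<n} - {s}. ?E) \<le> (\<Sum>i<n. ?E)" by (intro sum_mono2) auto
  finally show "(\<Sum>i<n. sig (vinner d w (z i)) * vinner d \<xi> (z i)) \<le> 0" by simp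
qed

end

text \<open>The definition compares \<open>v\<close> only with other eigenvectors, so the maximum of
  the quadratic form over the unit sphere must be shown to be attained at an eigenvector.\<close>

lemma top_right_sing_vec_maximal:
  assumes top: "top_right_sing_vec p m A v" and u: "nsq m u = 1"
  shows "nsq p (mat_vec m A u) \<le> nsq p (mat_vec m A v)"
proof -
  define M where "M = (\<lambda>v j. if j < m then \<Sum>i<p. A i j * (\<Sum>l<m. A i l * v l) else 0)"
  obtain lam where v: "unit_vec m v" "M v = (\<lambda>j. lam * v j)"
    and lam: "\<And>\<mu> w. unit_vec m w \<Longrightarrow> M w = (\<lambda>j. \<mu> * w j) \<Longrightarrow> \<mu> \<le> lam"
    using top unfolding top_right_sing_vec_def Let_def M_def by blast
  have M: "vinner m x (M y) = vinner p (mat_vec m A x) (mat_vec m A y)" for x y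
  proof -
    have "vinner m x (M y) = vinner m x (vec_mat p (mat_vec m A y) A)"
      by (rule vinner_cong) (auto simp: M_def vec_mat_def mat_vec_def mult.commute)
    then show ?thesis by (simp add: vinner_mat_vec[of p "mat_vec m A y"] vinner_commute[of _ x] vinner_commute[of p _ "mat_vec m A y"])
  qed
  have m1: "1 \<le> m" using u by (cases m) (auto simp: vinner_def)
  have cont: "continuous_on {u. unit_vec m u} (\<lambda>u. nsq p (mat_vec m A u))"
    unfolding vinner_def mat_vec_def
    by (intro continuous_on_sum continuous_on_mult continuous_on_const
      continuous_on_product_then_coordinatewise[OF continuous_on_id])
  obtain w where w: "unit_vec m w" "\<And>u. unit_vec m u \<Longrightarrow> nsq p (mat_vec m A u) \<le> nsq p (mat_vec m A w)"
    using continuous_attains_sup[OF compact_unit_vec _ cont] unit_vec_exists[OF m1] by auto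
  let ?\<mu> = "nsq p (mat_vec m A w)"
  have bound: "nsq p (mat_vec m A x) \<le> ?\<mu> * nsq m x" for x
  proof (cases "nsq m x = 0")
    case True
    then show ?thesis using mat_vec_bound[of p m A x] by simp
  next
    case False
    let ?c = "1 / vnorm m x"
    have pos: "0 < nsq m x" using False by (simp add: less_le)
    have "mat_vec m A (normalized m x) = (\<lambda>i. ?c * mat_vec m A x i)"
      by (simp add: mat_vec_def normalized_def sum_divide_distrib)
    then have "nsq p (mat_vec m A (normalized m x)) = ?c\<^sup>2 * nsq p (mat_vec m A x)"
      by (simp only: vinner_scale_left vinner_scale_right) (simp add: power2_eq_square)
    also have "?c\<^sup>2 = 1 / nsq m x" by (simp add: power_divide vnorm_sq)
    finally have "nsq p (mat_vec m A x) = nsq p (mat_vec m A (normalized m x)) * nsq m x"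
      using pos by simp
    also have "\<dots> \<le> ?\<mu> * nsq m x"
      using w(2)[OF unit_vec_normalized[OF False]] by (intro mult_right_mono) auto
    finally show ?thesis .
  qed
  \<comment> \<open>A maximizer of the quadratic form is an eigenvector: the form \<open>\<mu> |x|\<^sup>2 - |A x|\<^sup>2\<close> is positive
    semidefinite and vanishes at \<open>w\<close>, hence so does its polar form.\<close>
  define r where "r = (\<lambda>j. M w j - ?\<mu> * w j)"
  have wr: "vinner m w r = 0"
    using w(1) by (simp add: r_def vinner_linear M unit_vec_iff)
  have Awr: "vinner p (mat_vec m A w) (mat_vec m A r) = nsq m r"
  proof -
    have "nsq m r = vinner m r (M w) - ?\<mu> * vinner m r w"
      by (subst (2) r_def) (simp add: vinner_diff_right vinner_scale_right)
    then show ?thesis using wr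
      by (simp add: M vinner_commute[of m r w] vinner_commute[of p "mat_vec m A r" "mat_vec m A w"])
  qed
  have "2 * \<epsilon> * nsq m r \<le> \<epsilon>\<^sup>2 * (?\<mu> * nsq m r)" for \<epsilon> :: real
  proof -
    let ?x = "\<lambda>j. w j + \<epsilon> * r j"
    have "mat_vec m A ?x = (\<lambda>i. mat_vec m A w i + \<epsilon> * mat_vec m A r i)"
      by (simp add: mat_vec_add mat_vec_scale)
    then have "nsq p (mat_vec m A ?x) = ?\<mu> + 2 * \<epsilon> * nsq m r + \<epsilon>\<^sup>2 * nsq p (mat_vec m A r)"
      by (simp add: vinner_linear Awr vinner_commute[of p "mat_vec m A r" "mat_vec m A w"] power2_eq_square)
    moreover have "nsq m ?x = 1 + \<epsilon>\<^sup>2 * nsq m r"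
      using w(1) wr by (simp add: vinner_linear unit_vec_iff vinner_commute[of m r w] power2_eq_square)
    ultimately have "?\<mu> + 2 * \<epsilon> * nsq m r + \<epsilon>\<^sup>2 * nsq p (mat_vec m A r) \<le> ?\<mu> * (1 + \<epsilon>\<^sup>2 * nsq m r)"
      using bound[of ?x] by simp
    moreover have "?\<mu> * (1 + \<epsilon>\<^sup>2 * nsq m r) = ?\<mu> + \<epsilon>\<^sup>2 * (?\<mu> * nsq m r)"
      by (simp add: algebra_simps)
    moreover have "0 \<le> \<epsilon>\<^sup>2 * nsq p (mat_vec m A r)" by simp
    ultimately show ?thesis by linarith
  qed
  \<comment> \<open>The inequality is linear in \<epsilon> on the left and quadratic on the right.
    This \<epsilon> satisfies \<open>\<epsilon> * ?\<mu> \<le> 1\<close>, so the factor 2 on the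
    left forces the residual \<open>r\<close> to vanish.\<close>
  from this[of "1 / (1 + ?\<mu>)"] have "nsq m r = 0"
  proof -
    let ?e = "1 / (1 + ?\<mu>)"
    have e: "0 < ?e" "?e * ?\<mu> \<le> 1" by (simp_all add: add_pos_nonneg field_simps)
    assume "2 * ?e * nsq m r \<le> ?e\<^sup>2 * (?\<mu> * nsq m r)"
    also have "\<dots> = ?e * ((?e * ?\<mu>) * nsq m r)" by (simp add: power2_eq_square)
    also have "\<dots> \<le> ?e * (1 * nsq m r)" using e by (intro mult_left_mono mult_right_mono) auto
    finally have "?e * nsq m r \<le> ?e * 0" by simp
    then have "nsq m r \<le> 0" using e(1) by (rule mult_left_le_imp_le)
    then show ?thesis by (simp add: order_antisym)
  qed
  then have "M w j = ?\<mu> * w j" if "j < m" for j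
    using that by (simp add: vinner_self_eq0 r_def)
  moreover have "M w j = ?\<mu> * w j" if "\<not> j < m" for j
    using that w(1) by (simp add: M_def unit_vec_iff)
  ultimately have "M w = (\<lambda>j. ?\<mu> * w j)" by blast
  then have "?\<mu> \<le> lam" using lam w(1) by blast
  moreover have "lam = nsq p (mat_vec m A v)"
    using v by (simp add: M[symmetric] vinner_scale_right unit_vec_iff)
  ultimately show ?thesis using bound[of u] u by simp
qed

section \<open>Degenerate data sets form a null set\<close>

lemma closed_projection_of_compact:
  fixes S :: "'a::metric_space set" and C :: "('b::metric_space \<times> 'a) set"
  assumes "compact S" "closed C"
  shows "closed {x. \<exists>c\<in>S. (x, c) \<in> C}"
  unfolding closed_sequential_limits
proof (intro allI impI, elim conjE)
  fix X l assume X: "\<forall>m. X m \<in> {x. \<exists>c\<in>S. (x, c) \<in> C}" and l: "X \<longlonglongrightarrow> l"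
  then obtain c where c: "\<And>m. c m \<in> S" "\<And>m. (X m, c m) \<in> C" by simp metis
  obtain a r where r: "a \<in> S" "strict_mono r" "(c \<circ> r) \<longlonglongrightarrow> a"
    using assms(1) c(1) unfolding compact_def by metis
  have "(\<lambda>m. ((X \<circ> r) m, (c \<circ> r) m)) \<longlonglongrightarrow> (l, a)"
    by (intro tendsto_Pair LIMSEQ_subseq_LIMSEQ[OF l r(2)] r(3))
  then have "(l, a) \<in> C"
    by (rule closed_sequentially[OF assms(2), rotated]) (simp add: c(2))
  with r(1) show "l \<in> {x. \<exists>c\<in>S. (x, c) \<in> C}" by blast
qed

text \<open>Fubini in the coordinate \<open>e\<close>: every section in that direction has at most
  one point.\<close>

lemma null_set_PiM_lborel_lines:
  assumes I: "finite I" "e \<in> I" and A: "A \<in> sets (PiM I (\<lambda>_. lborel))"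
    and line: "\<And>x s s'. x(e := s) \<in> A \<Longrightarrow> x(e := s') \<in> A \<Longrightarrow> s = (s'::real)"
  shows "A \<in> null_sets (PiM I (\<lambda>_. lborel))"
proof -
  interpret product_sigma_finite "\<lambda>_. lborel :: real measure"
    by (simp add: product_sigma_finite_def sigma_finite_lborel)
  have I': "insert e (I - {e}) = I" using I(2) by auto
  have "emeasure (PiM I (\<lambda>_. lborel)) A = (\<integral>\<^sup>+ x. indicator A x \<partial>PiM I (\<lambda>_. lborel))"
    using A by simp
  also have "\<dots> = (\<integral>\<^sup>+ x. \<integral>\<^sup>+ s. indicator A (x(e := s)) \<partial>lborel \<partial>PiM (I - {e}) (\<lambda>_. lborel :: real measure))"
    using product_nn_integral_insert[of "I - {e}" e "indicator A"] I A unfolding I' by simp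
  also have "\<dots> = (\<integral>\<^sup>+ x. 0 \<partial>PiM (I - {e}) (\<lambda>_. lborel :: real measure))"
  proof (rule nn_integral_cong)
    fix x :: "'a \<Rightarrow> real"
    let ?l = "{s. x(e := s) \<in> A}"
    have "\<exists>s. ?l \<subseteq> {s}" using line by blast
    then have "finite ?l" by (meson finite.simps finite_subset)
    then have null: "?l \<in> null_sets lborel"
      by (intro countable_imp_null_set_lborel countable_finite)
    have "(\<integral>\<^sup>+ s. indicator A (x(e := s)) \<partial>lborel) = (\<integral>\<^sup>+ s. indicator ?l s \<partial>lborel)"
      by (intro nn_integral_cong) (auto simp: indicator_def)
    also have "\<dots> = emeasure lborel ?l" using null by (intro nn_integral_indicator) auto
    also have "\<dots> = 0" using null by auto
    finally show "(\<integral>\<^sup>+ s. indicator A (x(e := s)) \<partial>lborel) = 0" .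
  qed
  finally show ?thesis using A by (simp add: null_sets_def)
qed

text \<open>Transfers closed sets of the full function space to the product measure, whose points
  are constantly undefined outside \<open>I\<close>; countably many coordinates make the
  coordinatewise test sufficient.\<close>

lemma measurable_id_PiM_lborel:
  "(\<lambda>X. X) \<in> borel_measurable (PiM (I :: 'i::countable set) (\<lambda>_. lborel :: real measure))"
proof (rule measurable_coordinatewise_then_product)
  fix i
  show "(\<lambda>X. X i) \<in> borel_measurable (PiM I (\<lambda>_. lborel :: real measure))"
  proof (cases "i \<in> I")
    case True
    then show ?thesis using measurable_component_singleton[of i I "\<lambda>_. lborel :: real measure"] by simp
  next
    case False
    then have "(\<lambda>X. X i) \<in> borel_measurable (PiM I (\<lambda>_. lborel :: real measure)) \<longleftrightarrow>
      (\<lambda>X. undefined :: real) \<in> borel_measurable (PiM I (\<lambda>_. lborel :: real measure))"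
      by (intro measurable_cong) (auto simp: space_PiM PiE_def extensional_def)
    then show ?thesis by simp
  qed
qed

lemma compact_cube: "compact (PiE UNIV (\<lambda>_::nat. {- K..K::real}))"
proof -
  have "compactin (product_topology (\<lambda>_. euclidean) UNIV) (PiE UNIV (\<lambda>_::nat. {- K..K}))"
    by (subst compactin_PiE) auto
  then show ?thesis by (simp add: euclidean_product_topology)
qed

text \<open>The difference of two such vectors lies in the span of the points of \<open>T\<close>
  and is orthogonal to each of them.\<close>

lemma dual_vector_unique:
  assumes v: "v = (\<lambda>j. \<Sum>k\<in>T. c k * z k j)" "\<And>i. i \<in> T \<Longrightarrow> vinner m v (z i) = 1"
    and v': "v' = (\<lambda>j. \<Sum>k\<in>T. c' k * z k j)" "\<And>i. i \<in> T \<Longrightarrow> vinner m v' (z i) = 1"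
    and j: "j < m"
  shows "v j = v' j"
proof -
  let ?u = "\<lambda>j. v j - v' j"
  have "?u = (\<lambda>j. \<Sum>k\<in>T. (c k - c' k) * z k j)"
    by (simp add: v(1) v'(1) sum_subtractf left_diff_distrib)
  then have "nsq m ?u = vinner m ?u (\<lambda>j. \<Sum>k\<in>T. (c k - c' k) * z k j)" by simp
  also have "\<dots> = (\<Sum>k\<in>T. (c k - c' k) * vinner m ?u (z k))"
    by (simp add: vinner_sum_right vinner_scale_right)
  also have "\<dots> = 0"
    using v(2) v'(2) by (simp add: vinner_diff_left)
  finally show ?thesis using j by (simp add: vinner_self_eq0)
qed

text \<open>The set of degenerate data is a countable union of projections of closed sets along compact
  ones, hence measurable. A line in direction of a coordinate \<open>(i0, j)\<close> with \<open>v j \<noteq> 0\<close> meets it at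
  most once, because the data points indexed by \<open>T\<close> already determine \<open>v\<close>.\<close>

lemma AE_not_degenerate:
  assumes y: "\<And>i. i < n \<Longrightarrow> y i \<noteq> 0"
  shows "AE X in PiM ({..<n} \<times> {..<d}) (\<lambda>_. lborel). \<not> degenerate n d (\<lambda>i j. y i * X (i, j))"
proof -
  let ?M = "PiM ({..<n} \<times> {..<d}) (\<lambda>_. lborel :: real measure)"
  define z where "z = (\<lambda>X i (j :: nat). y i * X (i, j) :: real)"
  define v where "v = (\<lambda>(T :: nat set) X c (j :: nat). \<Sum>k\<in>T. c k * z X k j)"
  \<comment> \<open>A coordinate being nonzero is not a closed condition, whereas being at least
    \<open>1 / real (Suc K)\<close> in absolute value is. Together with coefficients confined to the
    cube of size \<open>K\<close>, letting \<open>K\<close> grow exhausts all cases.\<close>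
  define C where "C = (\<lambda>T i0 j K. {(X, c). (\<forall>i\<in>insert i0 T. vinner d (v T X c) (z X i) = 1)
     \<and> 1 / real (Suc K) \<le> \<bar>v T X c j\<bar>})"
  define B where "B = (\<lambda>T i0 j K. {X. \<exists>c\<in>PiE UNIV (\<lambda>_::nat. {- real K..real K}). (X, c) \<in> C T i0 j K})"
  have cz: "continuous_on UNIV (\<lambda>p::(nat \<times> nat \<Rightarrow> real) \<times> (nat \<Rightarrow> real). z (fst p) i j)" for i j
    unfolding z_def
    by (intro continuous_on_mult continuous_on_const continuous_on_product_then_coordinatewise[OF continuous_on_fst[OF continuous_on_id]])
  have cv: "continuous_on UNIV (\<lambda>p::(nat \<times> nat \<Rightarrow> real) \<times> (nat \<Rightarrow> real). v T (fst p) (snd p) j)" for T j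
    unfolding v_def
    by (intro continuous_on_sum continuous_on_mult cz continuous_on_product_then_coordinatewise[OF continuous_on_snd[OF continuous_on_id]])
  have closedC: "closed (C T i0 j K)" for T i0 j K
  proof -
    have "C T i0 j K = (\<Inter>i\<in>insert i0 T. {p. vinner d (v T (fst p) (snd p)) (z (fst p) i) = 1}) \<inter>
       {p. 1 / real (Suc K) \<le> \<bar>v T (fst p) (snd p) j\<bar>}"
      by (auto simp: C_def)
    also have "closed \<dots>"
      unfolding vinner_def
      by (intro closed_Int closed_INT ballI closed_Collect_eq closed_Collect_le continuous_on_sum continuous_on_mult
        cz cv continuous_on_const continuous_on_rabs)
    finally show ?thesis .
  qed
  have Bsets: "B T i0 j K \<inter> space ?M \<in> sets ?M" for T i0 j K
  proof -
    have "closed (B T i0 j K)"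
      unfolding B_def by (rule closed_projection_of_compact[OF compact_cube closedC])
    then have "(\<lambda>X. X) -` B T i0 j K \<inter> space ?M \<in> sets ?M"
      by (intro measurable_sets[OF measurable_id_PiM_lborel]) auto
    then show ?thesis by simp
  qed
  have null: "B T i0 j K \<inter> space ?M \<in> null_sets ?M" if T: "T \<subseteq> {..<n}" "i0 < n" "i0 \<notin> T" "j < d" for T i0 j K
  proof (rule null_set_PiM_lborel_lines[where e = "(i0, j)", OF _ _ Bsets])
    fix x s s'
    assume "x((i0, j) := s) \<in> B T i0 j K \<inter> space ?M" "x((i0, j) := s') \<in> B T i0 j K \<inter> space ?M"
    then obtain c c' where c: "(x((i0, j) := s), c) \<in> C T i0 j K" and c': "(x((i0, j) := s'), c') \<in> C T i0 j K"
      by (auto simp: B_def)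
    have zT: "z (x((i0, j) := r)) k = z x k" if "k \<noteq> i0" for k r using that by (auto simp: z_def)
    have vT: "v T (x((i0, j) := r)) b = v T x b" for r b
      unfolding v_def using zT T(3) by (intro ext sum.cong) (auto, metis)
    let ?v = "v T x c"
    have c1: "\<And>i. i \<in> T \<Longrightarrow> vinner d ?v (z x i) = 1" "vinner d ?v (z (x((i0, j) := s)) i0) = 1" "?v j \<noteq> 0"
      using c T(3) by (auto simp: C_def vT) (metis zT)
    have c2: "\<And>i. i \<in> T \<Longrightarrow> vinner d (v T x c') (z x i) = 1" "vinner d (v T x c') (z (x((i0, j) := s')) i0) = 1"
      using c' T(3) by (auto simp: C_def vT) (metis zT)
    have veq: "v T x c' l = ?v l" if "l < d" for l
      by (rule dual_vector_unique[OF _ c2(1) _ c1(1) that]) (simp_all add: v_def)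
    have "vinner d ?v (z (x((i0, j) := s')) i0) = 1"
      using c2(2) veq by (simp cong: vinner_cong)
    then have "0 = vinner d ?v (\<lambda>l. z (x((i0, j) := s)) i0 l - z (x((i0, j) := s')) i0 l)"
      using c1(2) by (simp add: vinner_diff_right)
    also have "\<dots> = vinner d ?v (\<lambda>l. (y i0 * (s - s')) * (if l = j then 1 else 0))"
      by (intro vinner_cong) (auto simp: z_def algebra_simps)
    also have "\<dots> = y i0 * (s - s') * ?v j"
      unfolding vinner_scale_right using T(4) by (simp add: vinner_indicator_right)
    finally show "s = s'" using y[OF T(2)] c1(3) by simp
  qed (use T in auto)
  let ?N = "\<Union>T\<in>Pow {..<n}. \<Union>i0\<in>{..<n} - T. \<Union>j\<in>{..<d}. \<Union>K. B T i0 j K \<inter> space ?M"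
  have "?N \<in> null_sets ?M"
    by (intro null_sets_UN' countable_finite finite_Diff countableI_type) (auto intro!: null)
  moreover have "{X \<in> space ?M. \<not> \<not> degenerate n d (\<lambda>i j. y i * X (i, j))} \<subseteq> ?N"
  proof
    fix X assume "X \<in> {X \<in> space ?M. \<not> \<not> degenerate n d (\<lambda>i j. y i * X (i, j))}"
    then have X: "X \<in> space ?M" "degenerate n d (z X)" by (auto simp: z_def)
    then obtain T c i0 where T: "T \<subseteq> {..<n}" "i0 < n" "i0 \<notin> T"
      and eq: "\<And>i. i \<in> insert i0 T \<Longrightarrow> vinner d (v T X c) (z X i) = 1"
      unfolding degenerate_def v_def by blast
    have "\<exists>j<d. v T X c j \<noteq> 0"
    proof (rule ccontr)
      assume "\<not> (\<exists>j<d. v T X c j \<noteq> 0)"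
      then have "vinner d (v T X c) (z X i0) = 0" by (simp add: vinner_def)
      then show False using eq[of i0] by simp
    qed
    then obtain j where j: "j < d" "v T X c j \<noteq> 0" by blast
    obtain K1 :: nat where K1: "inverse (real (Suc K1)) < \<bar>v T X c j\<bar>" using reals_Archimedean j(2) by (metis zero_less_abs_iff)
    have fT: "finite T" using T(1) finite_subset by blast
    obtain K2 :: nat where K2: "(\<Sum>k\<in>T. \<bar>c k\<bar>) \<le> real K2" using real_arch_simple by blast
    let ?K = "max K1 K2"
    \<comment> \<open>Membership in the cube concerns every index, so the coefficients outside
      \<open>T\<close>, which do not affect the sum, are reset to 0.\<close>
    define b where "b = (\<lambda>k. if k \<in> T then c k else 0)"
    have "\<bar>b k\<bar> \<le> real ?K" for k
    proof (cases "k \<in> T")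
      case True
      then have "\<bar>c k\<bar> \<le> (\<Sum>k\<in>T. \<bar>c k\<bar>)" using fT by (intro member_le_sum) auto
      then show ?thesis using K2 True by (simp add: b_def)
    qed (simp add: b_def)
    then have "b \<in> PiE UNIV (\<lambda>_. {- real ?K..real ?K})" by (auto simp: abs_le_iff minus_le_iff)
    moreover have "v T X b = v T X c" unfolding v_def b_def by (intro ext sum.cong) auto
    moreover have "1 / real (Suc ?K) \<le> \<bar>v T X c j\<bar>"
    proof -
      have "1 / real (Suc ?K) \<le> 1 / real (Suc K1)" by (intro divide_left_mono) auto
      with K1 show ?thesis by (simp add: inverse_eq_divide)
    qed
    ultimately have "b \<in> PiE UNIV (\<lambda>_. {- real ?K..real ?K})" "(X, b) \<in> C T i0 j ?K"
      using eq unfolding C_def by auto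
    then have "X \<in> B T i0 j ?K" unfolding B_def by blast
    then show "X \<in> ?N" using X(1) T j(1) by blast
  qed
  ultimately show ?thesis by (rule AE_I')
qed

section \<open>Convergence of gradient descent\<close>

locale gd_run = deep_linear n L dk z + separable_data n "dk 0" z
  for n L :: nat and dk :: "nat \<Rightarrow> nat" and z :: "nat \<Rightarrow> nat \<Rightarrow> real" +
  fixes W :: "nat \<Rightarrow> nat \<Rightarrow> nat \<Rightarrow> nat \<Rightarrow> real" and Rad eta :: "nat \<Rightarrow> real"
  assumes a3: "assumption3 n d z" and gp: "\<not> degenerate n d z"
    and grad0: "\<exists>k i j. grad L dk loss_risk (W 0) k i j \<noteq> 0"
    and risk0: "loss_risk (W 0) \<le> logistic 0"
    and eta: "\<And>t. eta t = min (1 / betaR L (1/4) 1 (Rad t)) 1"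
    and ball: "\<And>t. in_ball L dk (Rad t - 1) (W t)"
    and Rad_same: "\<And>t. in_ball L dk (Rad t - 1) (W (Suc t)) \<Longrightarrow> Rad (Suc t) = Rad t"
    and descent: "\<And>t. W (Suc t) = (\<lambda>k i j. W t k i j - eta t * grad L dk loss_risk (W t) k i j)"
begin

section \<open>Summable decrease and uniform balance along the run\<close>

lemma step: "gd_step (eta t) (W t) (W (Suc t))"
  unfolding gd_step_def by (simp add: descent grad_risk)

lemma Rad_ge1: "1 \<le> Rad t"
proof -
  have "frob dk (W t) 1 \<le> Rad t - 1" using ball[of t] L_ge2 by (auto simp: in_ball_def)
  then show ?thesis using frob_ge0[of dk "W t" 1] by linarith
qed

lemma betaR_pos: "1 \<le> R \<Longrightarrow> 0 < betaR L (1/4) 1 R"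
  using L_ge2 by (simp add: betaR_def)

lemma betaR_mono: "1 \<le> R \<Longrightarrow> R \<le> R' \<Longrightarrow> betaR L (1/4) 1 R \<le> betaR L (1/4) 1 R'"
  unfolding betaR_def by (intro mult_right_mono mult_left_mono power_mono) auto

lemma eta_pos: "0 < eta t" and eta_le1: "eta t \<le> 1" and eta_le: "eta t \<le> 1 / betaR L (1/4) 1 (Rad t)"
  using betaR_pos[OF Rad_ge1, of t] by (simp_all add: eta)

lemma risk_step: "loss_risk (W (Suc t)) \<le> loss_risk (W t) - eta t / 2 * grad_sq (W t)"
  using risk_descent[OF step ball Rad_ge1] eta_pos[of t] eta_le[of t] by simp

lemma risk_antimono: "s \<le> t \<Longrightarrow> loss_risk (W t) \<le> loss_risk (W s)"
proof (induction t rule: dec_induct)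
  case (step t)
  have "0 \<le> eta t / 2 * grad_sq (W t)" using eta_pos[of t] by simp
  with risk_step[of t] step show ?case by linarith
qed simp

lemma risk_nonneg: "0 \<le> loss_risk V"
  unfolding risk_def by (intro mult_nonneg_nonneg sum_nonneg) (auto intro: less_imp_le[OF logistic_pos])

definition energy :: real where "energy = 2 * loss_risk (W 0)"

lemma energy_sum_lessThan: "(\<Sum>s<t. eta s * grad_sq (W s)) \<le> energy"
proof -
  have "(\<Sum>s<t. eta s * grad_sq (W s)) \<le> 2 * (loss_risk (W 0) - loss_risk (W t))"
  proof (induction t)
    case (Suc t)
    then show ?case using risk_step[of t] by simp
  qed simp
  then show ?thesis using risk_nonneg[of "W t"] by (simp add: energy_def)
qed

lemma energy_sum: "(\<Sum>s=a..<b. eta s * grad_sq (W s)) \<le> energy"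
proof -
  have "(\<Sum>s=a..<b. eta s * grad_sq (W s)) \<le> (\<Sum>s<b. eta s * grad_sq (W s))"
    using less_imp_le[OF eta_pos] by (intro sum_mono2) auto
  then show ?thesis using energy_sum_lessThan[of b] by linarith
qed

text \<open>The cap of the step sizes at 1 serves here: the quadratic errors become
  summable.\<close>

lemma eta_sq_le: "(eta s)\<^sup>2 * grad_sq (W s) \<le> eta s * grad_sq (W s)"
proof -
  have "eta s * eta s \<le> eta s * 1" using eta_pos[of s] eta_le1[of s] by (intro mult_left_mono) auto
  then show ?thesis by (intro mult_right_mono) (auto simp: power2_eq_square)
qed

lemma energy_sum_sq: "(\<Sum>s=a..<b. (eta s)\<^sup>2 * grad_sq (W s)) \<le> energy"
  by (rule order_trans[OF sum_mono energy_sum]) (rule eta_sq_le)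

text \<open>The initial imbalance plus all quadratic errors, whose total is at most
  \<open>energy\<close>. Summing the initial norms over the layers makes the constant independent of
  \<open>k\<close>.\<close>

lemma balanced_uniformly:
  "\<exists>C\<ge>0. \<forall>t k u. Suc k < L \<longrightarrow> \<bar>imbal (W t) k u\<bar> \<le> C * nsq (dk (Suc k)) u"
proof -
  let ?F = "\<lambda>k. frob_sq (dk (Suc k)) (dk k) (W 0 (Suc k))"
  let ?C0 = "\<Sum>k<L. ?F k + ?F (Suc k)"
  have E: "0 \<le> energy" using risk_nonneg by (simp add: energy_def)
  have "\<bar>imbal (W t) k u\<bar> \<le> (?C0 + energy) * nsq (dk (Suc k)) u" if k: "Suc k < L" for t k u
  proof -
    let ?N = "nsq (dk (Suc k)) u"
    have "\<bar>imbal (W 0) k u\<bar> \<le> (?F k + ?F (Suc k)) * ?N"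
    proof -
      have "nsq (dk (Suc (Suc k))) (mat_vec (dk (Suc k)) (W 0 (Suc (Suc k))) u) \<le> ?F (Suc k) * ?N"
        by (rule mat_vec_bound)
      moreover have "nsq (dk k) (vec_mat (dk (Suc k)) u (W 0 (Suc k))) \<le> ?F k * ?N"
        by (rule vec_mat_bound)
      moreover have "0 \<le> nsq (dk (Suc (Suc k))) (mat_vec (dk (Suc k)) (W 0 (Suc (Suc k))) u)"
        "0 \<le> nsq (dk k) (vec_mat (dk (Suc k)) u (W 0 (Suc k)))" by simp_all
      ultimately show ?thesis unfolding imbal_def distrib_right by linarith
    qed
    also have "\<dots> \<le> ?C0 * ?N"
    proof (rule mult_right_mono)
      show "?F k + ?F (Suc k) \<le> ?C0"
        using k by (intro member_le_sum[of k "{..<L}" "\<lambda>k. ?F k + ?F (Suc k)"]) auto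
    qed simp
    finally have "\<bar>imbal (W 0) k u\<bar> \<le> ?C0 * ?N" .
    then have "\<bar>imbal (W t) k u\<bar> \<le> ?C0 * ?N + (\<Sum>s=0..<t. (eta s)\<^sup>2 * grad_sq (W s)) * ?N"
    proof (induction t)
      case (Suc t)
      then show ?case using imbal_gd_step[OF step k, of t u] by (simp add: distrib_right)
    qed simp
    also have "\<dots> \<le> ?C0 * ?N + energy * ?N"
      by (intro add_left_mono mult_right_mono energy_sum_sq) auto
    finally show ?thesis by (simp add: distrib_right)
  qed
  moreover have "0 \<le> ?C0" by (intro sum_nonneg) auto
  ultimately show ?thesis using E by (intro exI[of _ "?C0 + energy"]) auto
qed

definition C :: real where
  "C = (SOME C. 0 \<le> C \<and> (\<forall>t k u. Suc k < L \<longrightarrow> \<bar>imbal (W t) k u\<bar> \<le> C * nsq (dk (Suc k)) u))"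

lemma C_nonneg: "0 \<le> C" and balanced: "Suc k < L \<Longrightarrow> \<bar>imbal (W t) k u\<bar> \<le> C * nsq (dk (Suc k)) u"
proof -
  have "\<exists>C. 0 \<le> C \<and> (\<forall>t k u. Suc k < L \<longrightarrow> \<bar>imbal (W t) k u\<bar> \<le> C * nsq (dk (Suc k)) u)"
    using balanced_uniformly by blast
  from someI_ex[OF this] show "0 \<le> C" "Suc k < L \<Longrightarrow> \<bar>imbal (W t) k u\<bar> \<le> C * nsq (dk (Suc k)) u"
    unfolding C_def by blast+
qed

definition D :: real where "D = (\<Sum>j<L. real (dk (Suc j))) * C"

lemma D_nonneg: "0 \<le> D"
  using C_nonneg by (simp add: D_def sum_nonneg)

abbreviation ts :: "nat \<Rightarrow> real" where "ts t \<equiv> top_sq (W t)"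
abbreviation pr :: "nat \<Rightarrow> nat \<Rightarrow> real" where "pr t \<equiv> bwd L dk (W t) 0"
abbreviation p1 :: "nat \<Rightarrow> real" where "p1 t \<equiv> nsq (dk 1) (bwd L dk (W t) 1)"
abbreviation F :: "nat \<Rightarrow> nat \<Rightarrow> real" where "F t k \<equiv> frob_sq (dk (Suc k)) (dk k) (W t (Suc k))"

lemma F_near_top: "k < L \<Longrightarrow> \<bar>F t k - ts t\<bar> \<le> D"
  using frob_sq_near_top[where W = "W t" and k = k, OF C_nonneg balanced] by (simp add: D_def)

section \<open>The risk tends to zero\<close>

lemma marg_pr: "marg V i = vinner d (bwd L dk V 0) (z i)"
  using L_ge2 dk_top by (intro vinner_cong) (auto simp: wprod_eq_bwd)

lemma nsq_pr_le_p1: "nsq d (pr t) \<le> F t 0 * p1 t"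
proof -
  have "bwd L dk (W t) 0 = vec_mat (dk 1) (bwd L dk (W t) 1) (W t 1)"
    using L_ge2 by (simp add: bwd_step[of 0 L])
  then show ?thesis using vec_mat_bound[of d "dk 1" "bwd L dk (W t) 1" "W t 1"] by simp
qed

lemma p1_lower: "real L * C + K \<le> ts t \<Longrightarrow> 1 \<le> K \<Longrightarrow> K \<le> p1 t"
proof -
  assume K: "real L * C + K \<le> ts t" "1 \<le> K"
  then have "K \<le> (ts t - real L * C) ^ 1" by simp
  also have "\<dots> \<le> (ts t - real L * C) ^ (L - 1)"
    using K L_ge2 by (intro power_increasing) auto
  also have "\<dots> \<le> p1 t"
    using bwd_lower[where W = "W t" and k = 1, OF C_nonneg balanced] K L_ge2 by simp
  finally show ?thesis .
qed

text \<open>The nonzero initial gradient makes the first step decrease the risk strictly below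
  \<open>logistic 0\<close>, the risk of a zero product. The risk is 1-Lipschitz in the product, so
  this gap bounds the norm of the product from time 1 on.\<close>

lemma product_bounded_below: "\<exists>\<delta>>0. \<forall>t\<ge>1. \<delta> \<le> nsq d (pr t)"
proof -
  obtain k i j where nz: "grad L dk loss_risk (W 0) k i j \<noteq> 0" using grad0 by blast
  then have "1 \<le> k \<and> k \<le> L \<and> i < dk k \<and> j < dk (k - 1)" by (auto simp: grad_def split: if_splits)
  then obtain k' where k: "k = Suc k'" "k' < L" "i < dk (Suc k')" "j < dk k'" by (cases k) auto
  then have "bwd L dk (W 0) (Suc k') i \<noteq> 0" "fwd dk (W 0) (wgrad (W 0)) k' j \<noteq> 0"
    using nz by (auto simp: grad_risk)
  then have "nsq (dk (Suc k')) (bwd L dk (W 0) (Suc k')) \<noteq> 0" "nsq (dk k') (fwd dk (W 0) (wgrad (W 0)) k') \<noteq> 0"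
    using k by (auto simp: vinner_self_eq0)
  then have "0 < nsq (dk (Suc k')) (bwd L dk (W 0) (Suc k')) * nsq (dk k') (fwd dk (W 0) (wgrad (W 0)) k')"
    by (simp add: less_le)
  then have "0 < grad_sq (W 0)" using layer_grad_sq_le[OF k(2), of "W 0"] by linarith
  then have "0 < eta 0 / 2 * grad_sq (W 0)" using eta_pos[of 0] by simp
  then have "loss_risk (W (Suc 0)) < logistic 0" using risk_step[of 0] risk0 by linarith
  then have pos: "0 < logistic 0 - loss_risk (W 1)" by simp
  have "logistic 0 - loss_risk (W 1) \<le> vnorm d (pr t)" if "1 \<le> t" for t
  proof -
    have "logistic 0 - vnorm d (pr t) \<le> logistic (marg (W t) i)" if "i < n" for i
    proof -
      have "\<bar>marg (W t) i\<bar> \<le> vnorm d (pr t) * vnorm d (z i)" unfolding marg_pr by (rule vinner_abs_le)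
      also have "\<dots> \<le> vnorm d (pr t) * 1" using vnorm_data[OF that] by (intro mult_left_mono) auto
      finally show ?thesis using logistic_lipschitz[of "marg (W t) i" 0] by simp
    qed
    then have "(\<Sum>i<n. logistic 0 - vnorm d (pr t)) \<le> (\<Sum>i<n. logistic (marg (W t) i))"
      by (intro sum_mono) auto
    then have "logistic 0 - vnorm d (pr t) \<le> loss_risk (W t)"
      using n_pos by (simp add: risk_def field_simps)
    then show ?thesis using risk_antimono[OF that] by linarith
  qed
  then have "(logistic 0 - loss_risk (W 1))\<^sup>2 \<le> nsq d (pr t)" if "1 \<le> t" for t
    using that pos unfolding vnorm_sq[symmetric] by (intro power_mono) auto
  then show ?thesis using pos by (intro exI[of _ "(logistic 0 - loss_risk (W 1))\<^sup>2"]) auto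
qed

text \<open>Some data point has loss at least \<epsilon>. Paired with \<open>ub\<close>, the
  contributions of all data points have the same sign, so nothing cancels the weight of this
  one.\<close>

lemma wgrad_lower:
  assumes \<epsilon>: "0 < \<epsilon>" "\<epsilon> \<le> loss_risk V"
  shows "(\<gamma> * (1 - exp (- \<epsilon>)) / real n)\<^sup>2 \<le> nsq d (wgrad V)"
proof -
  have "\<exists>i<n. \<epsilon> \<le> logistic (marg V i)"
  proof (rule ccontr)
    assume "\<not> ?thesis"
    then have "(\<Sum>i<n. logistic (marg V i)) < (\<Sum>i<n. \<epsilon>)"
      using indices_nonempty by (intro sum_strict_mono) (auto simp: not_le)
    then show False using \<epsilon> n_pos by (simp add: risk_def field_simps)
  qed
  then obtain i where i: "i < n" "\<epsilon> \<le> logistic (marg V i)" by blast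
  have s: "1 - exp (- \<epsilon>) \<le> sig (marg V i)" using i(2) by (simp add: sig_eq_logistic)
  have e: "0 \<le> 1 - exp (- \<epsilon>)" using \<epsilon> by simp
  have terms: "0 \<le> sig (marg V k) * vinner d ub (z k)" if "k < n" for k
    using sig_pos[of "marg V k"] gamma_le[OF that] gamma_pos by simp
  have "\<gamma> * (1 - exp (- \<epsilon>)) \<le> sig (marg V i) * vinner d ub (z i)"
    using s e gamma_le[OF i(1)] gamma_pos by (subst mult.commute) (intro mult_mono, auto)
  also have "\<dots> \<le> (\<Sum>k<n. sig (marg V k) * vinner d ub (z k))"
    using i(1) terms by (intro member_le_sum[of i "{..<n}" "\<lambda>k. sig (marg V k) * vinner d ub (z k)"]) auto
  finally have "\<gamma> * (1 - exp (- \<epsilon>)) / real n \<le> - vinner d ub (wgrad V)"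
    unfolding vinner_wgrad by (simp add: divide_right_mono)
  then have "(\<gamma> * (1 - exp (- \<epsilon>)) / real n)\<^sup>2 \<le> (- vinner d ub (wgrad V))\<^sup>2"
    using e gamma_pos by (intro power_mono) auto
  also have "\<dots> \<le> nsq d (wgrad V)"
    using vinner_Cauchy_Schwarz[of d ub "wgrad V"] nsq_ub by simp
  finally show ?thesis .
qed

lemma gd_step_frob_le:
  assumes "k < L"
  shows "frob dk (W (Suc t)) (Suc k) \<le> frob dk (W t) (Suc k) + eta t * sqrt (grad_sq (W t))"
proof -
  have "sqrt (frob_sq (dk (Suc k)) (dk k) (\<lambda>i j. W (Suc t) (Suc k) i j - W t (Suc k) i j))
    \<le> sqrt ((eta t)\<^sup>2 * grad_sq (W t))"
    unfolding gd_step_frob[OF step assms]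
    by (intro real_sqrt_le_mono mult_left_mono layer_grad_sq_le assms) auto
  also have "\<dots> = eta t * sqrt (grad_sq (W t))"
    using eta_pos[of t] by (simp add: real_sqrt_mult)
  finally show ?thesis using frob_triangle[of dk "W (Suc t)" k "W t"] by linarith
qed

text \<open>With gradient norm at least \<open>sqrt c\<close>, the length of a step is at most
  \<open>eta t * grad_sq (W t) / sqrt c\<close>, so the path has finite length.\<close>

lemma iterates_bounded:
  assumes c: "0 < c" "\<And>t. 1 \<le> t \<Longrightarrow> c \<le> grad_sq (W t)"
  shows "\<exists>M. \<forall>t\<ge>1. in_ball L dk M (W t)"
proof -
  let ?M = "(\<Sum>k<L. frob dk (W 1) (Suc k)) + energy / sqrt c"
  have bd: "frob dk (W t) (Suc k) \<le> ?M" if k: "k < L" and "1 \<le> t" for t k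
  proof -
    have "frob dk (W t) (Suc k) \<le> frob dk (W 1) (Suc k) + (\<Sum>s=1..<t. eta s * grad_sq (W s)) / sqrt c"
      using \<open>1 \<le> t\<close>
    proof (induction t rule: dec_induct)
      case (step t)
      have "sqrt c * sqrt (grad_sq (W t)) \<le> sqrt (grad_sq (W t)) * sqrt (grad_sq (W t))"
        using c(2)[OF step(1)] by (intro mult_right_mono) auto
      then have "sqrt (grad_sq (W t)) \<le> grad_sq (W t) / sqrt c"
        using c(1) by (simp add: field_simps)
      then have "eta t * sqrt (grad_sq (W t)) \<le> eta t * (grad_sq (W t) / sqrt c)"
        using eta_pos[of t] by (intro mult_left_mono) auto
      then show ?case using step gd_step_frob_le[OF k, of t] by (simp add: add_divide_distrib)
    qed simp
    also have "\<dots> \<le> (\<Sum>k<L. frob dk (W 1) (Suc k)) + energy / sqrt c"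
      using k c(1) energy_sum[of 1 t]
      by (intro add_mono divide_right_mono member_le_sum[of k "{..<L}" "\<lambda>k. frob dk (W 1) (Suc k)"]) auto
    finally show ?thesis .
  qed
  then have "in_ball L dk ?M (W t)" if "1 \<le> t" for t
    unfolding in_ball_def
  proof (intro ballI)
    fix k assume "k \<in> {1..L}"
    then obtain k' where "k = Suc k'" "k' < L" by (cases k) auto
    then show "frob dk (W t) k \<le> ?M" using bd that by simp
  qed
  then show ?thesis by blast
qed

lemma in_ball_mono: "in_ball L dk R V \<Longrightarrow> R \<le> R' \<Longrightarrow> in_ball L dk R' V"
  by (force simp: in_ball_def)

text \<open>If the iterates stay bounded, the radii are eventually bounded: once a radius exceeds the
  bound it never changes again.\<close>

lemma Rad_eventually_bounded:
  assumes M: "\<And>t. 1 \<le> t \<Longrightarrow> in_ball L dk M (W t)"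
  shows "\<exists>R t0. \<forall>t\<ge>t0. Rad t \<le> R"
proof (cases "\<forall>t\<ge>1. Rad t \<le> M + 1")
  case False
  then obtain t0 where t0: "1 \<le> t0" "M + 1 < Rad t0" by (auto simp: not_le)
  have "Rad t = Rad t0" if "t0 \<le> t" for t
    using that
  proof (induction t rule: dec_induct)
    case (step t)
    have "in_ball L dk (Rad t - 1) (W (Suc t))"
      using step t0 by (intro in_ball_mono[OF M]) auto
    then show ?case using Rad_same step by simp
  qed simp
  then show ?thesis by (metis order_refl)
qed blast

lemma risk_below: assumes \<epsilon>: "0 < \<epsilon>" shows "\<exists>t. loss_risk (W t) < \<epsilon>"
proof (rule ccontr)
  assume "\<not> ?thesis"
  then have r: "\<And>t. \<epsilon> \<le> loss_risk (W t)" by (auto simp: not_less)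
  obtain \<delta> where \<delta>: "0 < \<delta>" "\<And>t. 1 \<le> t \<Longrightarrow> \<delta> \<le> nsq d (pr t)" using product_bounded_below by blast
  define B where "B = real L * C + 1 + D"
  have B: "0 < B" using mult_nonneg_nonneg[OF of_nat_0_le_iff C_nonneg, of L] D_nonneg unfolding B_def by linarith
  \<comment> \<open>If the top layer is large, balance gives \<open>p1 t \<ge> 1\<close>. Otherwise
    the first layer has squared norm at most \<open>B\<close>, and the lower bound on the product
    leaves \<open>\<delta> / B\<close> for \<open>p1 t\<close>.\<close>
  define c1 where "c1 = min 1 (\<delta> / B)"
  have c1: "0 < c1" using \<delta>(1) B by (simp add: c1_def)
  have p1: "c1 \<le> p1 t" if "1 \<le> t" for t
  proof (cases "real L * C + 1 \<le> ts t")
    case True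
    then show ?thesis using p1_lower[of 1 t] by (simp add: c1_def)
  next
    case False
    then have "F t 0 \<le> B" using F_near_top[of 0 t] L_ge2 by (simp add: B_def)
    then have "F t 0 * p1 t \<le> B * p1 t" by (intro mult_right_mono) auto
    then have "\<delta> \<le> B * p1 t" using \<delta>(2)[OF that] nsq_pr_le_p1[of t] by linarith
    then have "\<delta> / B \<le> p1 t" using B by (simp add: field_simps)
    then show ?thesis by (simp add: c1_def)
  qed
  define c where "c = c1 * (\<gamma> * (1 - exp (- \<epsilon>)) / real n)\<^sup>2"
  have c: "0 < c" using c1 gamma_pos \<epsilon> n_pos by (simp add: c_def)
  have cg: "c \<le> grad_sq (W t)" if "1 \<le> t" for t
  proof -
    have "c \<le> p1 t * nsq d (wgrad (W t))"
      unfolding c_def using c1 by (intro mult_mono p1[OF that] wgrad_lower[OF \<epsilon> r]) auto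
    also have "\<dots> \<le> grad_sq (W t)" using layer_grad_sq_le[of 0 "W t"] L_ge2 by simp
    finally show ?thesis .
  qed
  obtain M where "\<And>t. 1 \<le> t \<Longrightarrow> in_ball L dk M (W t)"
    using iterates_bounded[OF c cg] by blast
  then obtain R t0 where R: "\<And>t. t0 \<le> t \<Longrightarrow> Rad t \<le> R" using Rad_eventually_bounded by blast
  have R1: "1 \<le> R" using R[of t0] Rad_ge1[of t0] by simp
  define e where "e = min (1 / betaR L (1/4) 1 R) 1"
  have e0: "0 < e" using betaR_pos[OF R1] by (simp add: e_def)
  have e: "e \<le> eta t" if "t0 \<le> t" for t
    unfolding e_def eta using betaR_mono[OF Rad_ge1 R[OF that]] betaR_pos[OF Rad_ge1, of t]
    by (intro min.mono divide_left_mono) (auto intro!: mult_pos_pos betaR_pos R1)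
  obtain N :: nat where N: "energy < real N * (e * c)"
    using reals_Archimedean3[of "e * c"] e0 c by auto
  have "real N * (e * c) = (\<Sum>s=t0+1..<t0+1+N. e * c)" by simp
  also have "\<dots> \<le> (\<Sum>s=t0+1..<t0+1+N. eta s * grad_sq (W s))"
  proof (rule sum_mono)
    fix s assume "s \<in> {t0+1..<t0+1+N}"
    then show "e * c \<le> eta s * grad_sq (W s)"
      using e[of s] cg[of s] eta_pos[of s] c by (intro mult_mono) auto
  qed
  also have "\<dots> \<le> energy" by (rule energy_sum)
  finally show False using N by simp
qed

lemma eventually_risk_less: "0 < \<epsilon> \<Longrightarrow> \<forall>\<^sub>F t in sequentially. loss_risk (W t) < \<epsilon>"
  using risk_below risk_antimono unfolding eventually_sequentially by (meson le_less_trans)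

lemma eventually_marg_ge: "\<forall>\<^sub>F t in sequentially. \<forall>i<n. K \<le> marg (W t) i"
proof -
  have "\<forall>\<^sub>F t in sequentially. loss_risk (W t) < logistic K / real n"
    using logistic_pos n_pos by (intro eventually_risk_less) simp
  then show ?thesis
  proof eventually_elim
    case (elim t)
    show ?case
    proof (intro allI impI)
      fix i assume "i < n"
      then have "logistic (marg (W t) i) \<le> (\<Sum>i<n. logistic (marg (W t) i))"
        by (intro member_le_sum[of i "{..<n}" "\<lambda>i. logistic (marg (W t) i)"]) (auto intro: less_imp_le[OF logistic_pos])
      also have "\<dots> = real n * loss_risk (W t)" using n_pos by (simp add: risk_def)
      also have "\<dots> < logistic K" using elim n_pos by (simp add: field_simps)
      finally show "K \<le> marg (W t) i" by (meson logistic_le_iff less_imp_le)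
    qed
  qed
qed

section \<open>Divergence of the layers and control of the off-axis part\<close>

lemma nsq_pr_le_prod: "nsq d (pr t) \<le> (\<Prod>j<L. F t j)"
  using bwd_upper[of 0 "W t"] by (simp add: lessThan_atLeast0)

text \<open>Diverging margins force the product to diverge. It is bounded by the product of the
  layer norms, and their squares all lie within \<open>D\<close> of \<open>ts t\<close>.\<close>

lemma ts_at_top: "filterlim ts at_top sequentially"
  unfolding filterlim_at_top
proof
  fix K :: real
  \<comment> \<open>The summand 1 makes \<open>?B\<close> at least 1, so a norm above
    \<open>?B\<close> also has its square above \<open>?B\<close>, and it gives strict excess over
    the product of layer bounds.\<close>
  let ?B = "(\<bar>K\<bar> + D) ^ L + 1"
  have B: "0 \<le> (\<bar>K\<bar> + D) ^ L" using D_nonneg by simp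
  show "\<forall>\<^sub>F t in sequentially. K \<le> ts t"
    using eventually_marg_ge[of ?B]
  proof eventually_elim
    case (elim t)
    have "?B \<le> \<bar>marg (W t) 0\<bar>" using elim n_pos by force
    also have "\<dots> \<le> vnorm d (pr t) * vnorm d (z 0)" unfolding marg_pr by (rule vinner_abs_le)
    also have "\<dots> \<le> vnorm d (pr t) * 1" using vnorm_data[of 0] n_pos by (intro mult_left_mono) auto
    finally have v: "?B \<le> vnorm d (pr t)" by simp
    then have "?B * 1 \<le> vnorm d (pr t) * vnorm d (pr t)" using B by (intro mult_mono) auto
    then have "?B \<le> nsq d (pr t)" by (simp add: vnorm_sq[symmetric] power2_eq_square)
    also have "\<dots> \<le> (\<Prod>j<L. F t j)" by (rule nsq_pr_le_prod)
    finally have big: "?B \<le> (\<Prod>j<L. F t j)" .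
    show "K \<le> ts t"
    proof (rule ccontr)
      assume "\<not> K \<le> ts t"
      then have "F t j \<le> \<bar>K\<bar> + D" if "j < L" for j using F_near_top[OF that, of t] by linarith
      then have "(\<Prod>j<L. F t j) \<le> (\<Prod>j<L. \<bar>K\<bar> + D)" by (intro prod_mono) auto
      then show False using big by simp
    qed
  qed
qed

text \<open>When the orthogonal part of the product has norm at least \<open>K\<close>, the linear
  drift does not increase \<open>off_axis\<close>. When it is shorter, alignment bounds
  \<open>off_axis\<close> itself, and one step adds at most \<open>2 * K\<close> linearly. The
  remaining quadratic errors have total at most \<open>energy\<close>.\<close>

lemma off_axis_bounded: "\<exists>Y. \<forall>\<^sub>F t in sequentially. off_axis (W t) ub \<le> Y"
proof -
  obtain \<alpha> where \<alpha>: "0 < \<alpha>" "\<And>\<xi>. vinner d ub \<xi> = 0 \<Longrightarrow> \<exists>i\<in>supp. vinner d \<xi> (z i) \<le> - \<alpha> * vnorm d \<xi>"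
    using support_vector_uniform[OF a3 gp] by blast
  define K where "K = 2 * real n / \<alpha>"
  have K0: "0 \<le> K" using \<alpha>(1) by (simp add: K_def)
  \<comment> \<open>\<open>D + real L * C\<close> is the alignment error; exceeding it by 1 would
    give the orthogonal part squared norm at least \<open>p1 t \<ge> K\<^sup>2\<close>. The summand
    \<open>2 * K\<close> covers the linear change in one step.\<close>
  define Y0 where "Y0 = D + real L * C + 1 + 2 * K"
  let ?Y = "\<lambda>t. off_axis (W t) ub"
  let ?\<xi> = "\<lambda>t. perp (W t) ub"
  have "\<forall>\<^sub>F t in sequentially. real L * C + max 1 (K\<^sup>2) \<le> ts t"
    using ts_at_top unfolding filterlim_at_top by blast
  then have "\<forall>\<^sub>F t in sequentially. real L * C + max 1 (K\<^sup>2) \<le> ts t \<and> (\<forall>i<n. 0 \<le> marg (W t) i)"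
    using eventually_marg_ge[of 0] by eventually_elim auto
  then obtain t0 where t0: "\<And>t. t0 \<le> t \<Longrightarrow> real L * C + max 1 (K\<^sup>2) \<le> ts t"
    "\<And>t i. t0 \<le> t \<Longrightarrow> i < n \<Longrightarrow> 0 \<le> marg (W t) i"
    unfolding eventually_sequentially by blast
  have grow: "?Y (Suc t) \<le> max (?Y t) Y0 + (eta t)\<^sup>2 * grad_sq (W t)" if t: "t0 \<le> t" for t
  proof -
    have p1: "K\<^sup>2 \<le> p1 t" using p1_lower[OF t0(1)[OF t]] by simp
    have step': "?Y (Suc t) \<le> ?Y t - 2 * eta t * vinner d (?\<xi> t) (wgrad (W t)) + (eta t)\<^sup>2 * grad_sq (W t)"
      by (rule off_axis_gd_step[OF step nsq_ub])
    have far: "0 \<le> vinner d (?\<xi> t) (wgrad (W t))" if "K \<le> vnorm d (?\<xi> t)"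
    proof -
      have "(\<Sum>i<n. sig (vinner d (pr t) (z i)) * vinner d (?\<xi> t) (z i)) \<le> 0"
      proof (rule gradient_points_to_ubar(2)[OF \<alpha>])
        show "2 * real n / \<alpha> \<le> vnorm d (?\<xi> t)" using that by (simp add: K_def)
        show "0 \<le> vinner d (pr t) (z i)" if "i < n" for i using t0(2)[OF t that] by (simp add: marg_pr)
      qed (simp_all add: perp_def)
      then show ?thesis unfolding vinner_wgrad by (simp add: marg_pr divide_nonpos_nonneg)
    qed
    show ?thesis
    proof (cases "K \<le> vnorm d (?\<xi> t)")
      case True
      then have "0 \<le> 2 * eta t * vinner d (?\<xi> t) (wgrad (W t))" using far eta_pos[of t] by simp
      with step' show ?thesis by linarith
    next
      case False
      have "?Y t < D + real L * C + 1"
      proof (rule ccontr)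
        assume "\<not> ?thesis"
        then have "1 \<le> ?Y t - (D + real L * C)" by simp
        then have "p1 t * 1 \<le> p1 t * (?Y t - (D + real L * C))" by (intro mult_left_mono) auto
        also have "\<dots> \<le> nsq d (?\<xi> t)"
          using nsq_perp_lower[where W = "W t" and u = ub, OF C_nonneg balanced] t0(1)[OF t] nsq_ub by (simp add: D_def)
        finally have "K\<^sup>2 \<le> (vnorm d (?\<xi> t))\<^sup>2" using p1 by (simp add: vnorm_sq)
        then show False using False K0 by (simp add: power2_le_iff_abs_le)
      qed
      moreover have "- (2 * eta t * vinner d (?\<xi> t) (wgrad (W t))) \<le> 2 * K"
      proof -
        have "\<bar>vinner d (?\<xi> t) (wgrad (W t))\<bar> \<le> K * 1"
          using False vnorm_wgrad_le[of "W t"] K0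
          by (intro order_trans[OF vinner_abs_le] mult_mono) auto
        then have "eta t * \<bar>vinner d (?\<xi> t) (wgrad (W t))\<bar> \<le> 1 * K"
          using eta_pos[of t] eta_le1[of t] K0 by (intro mult_mono) auto
        moreover have "- (eta t * vinner d (?\<xi> t) (wgrad (W t))) \<le> eta t * \<bar>vinner d (?\<xi> t) (wgrad (W t))\<bar>"
          using eta_pos[of t] by (metis abs_ge_minus_self abs_mult abs_of_pos)
        ultimately show ?thesis by simp
      qed
      ultimately show ?thesis using step' unfolding Y0_def by linarith
    qed
  qed
  have "?Y t \<le> max (?Y t0) Y0 + (\<Sum>s=t0..<t. (eta s)\<^sup>2 * grad_sq (W s))" if "t0 \<le> t" for t
    using that
  proof (induction t rule: dec_induct)
    case (step t)
    have "0 \<le> (\<Sum>s=t0..<t. (eta s)\<^sup>2 * grad_sq (W s))" by (intro sum_nonneg) auto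
    then show ?case using step grow[OF step(1)] by (simp add: max_def split: if_splits)
  qed simp
  then have "?Y t \<le> max (?Y t0) Y0 + energy" if "t0 \<le> t" for t
    using energy_sum_sq[where a = t0 and b = t] that by (meson add_left_mono order_trans)
  then show ?thesis unfolding eventually_sequentially by blast
qed

text \<open>The image of \<open>v\<close> is at least as long as that of \<open>ub\<close>, yet the
  part of \<open>v\<close> orthogonal to \<open>ub\<close> contributes at most \<open>sqrt Y\<close>
  to it. So the coefficient along \<open>ub\<close> must be close to 1 in absolute value.\<close>

lemma singular_vector_alignment:
  assumes v: "top_right_sing_vec (dk 1) d (V 1) v" and Y: "off_axis V ub \<le> Y"
    and pos: "0 < frob_sq (dk 1) d (V 1) - Y"
  shows "1 - sqrt Y / sqrt (frob_sq (dk 1) d (V 1) - Y) \<le> \<bar>vinner d v ub\<bar>"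
proof -
  let ?b = "vinner d v ub" and ?N = "sqrt (nsq (dk 1) (mat_vec d (V 1) ub))"
  have nv: "nsq d v = 1" using v by (simp add: top_right_sing_vec_def Let_def unit_vec_iff)
  let ?x = "\<lambda>j. v j - ?b * ub j"
  have x: "vinner d ub ?x = 0"
    using nsq_ub by (simp add: vinner_linear vinner_commute[of d ub v])
  have nx: "nsq d ?x \<le> 1"
    using nv nsq_ub by (simp add: nsq_diff_scale) (simp add: power2_eq_square)
  have off0: "0 \<le> off_axis V ub" by (rule off_axis_ge0[OF nsq_ub])
  have "nsq (dk 1) (mat_vec d (V 1) ?x) \<le> nsq d ?x * off_axis V ub"
    unfolding off_axis_def by (rule mat_vec_perp_bound[OF x nsq_ub])
  also have "\<dots> \<le> 1 * Y" using nx Y off0 by (intro mult_mono) auto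
  finally have vx: "vnorm (dk 1) (mat_vec d (V 1) ?x) \<le> sqrt Y" by (simp add: vnorm_def)
  have "mat_vec d (V 1) v = mat_vec d (V 1) (\<lambda>j. ?b * ub j + ?x j)" by simp
  also have "\<dots> = (\<lambda>i. ?b * mat_vec d (V 1) ub i + mat_vec d (V 1) ?x i)"
    by (simp only: mat_vec_add mat_vec_scale)
  finally have split: "mat_vec d (V 1) v = (\<lambda>i. ?b * mat_vec d (V 1) ub i + mat_vec d (V 1) ?x i)" .
  have "?N \<le> vnorm (dk 1) (mat_vec d (V 1) v)"
    unfolding vnorm_def by (intro real_sqrt_le_mono top_right_sing_vec_maximal[OF v nsq_ub])
  also have "\<dots> \<le> vnorm (dk 1) (\<lambda>i. ?b * mat_vec d (V 1) ub i) + vnorm (dk 1) (mat_vec d (V 1) ?x)"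
    unfolding split by (rule vnorm_triangle)
  also have "\<dots> \<le> \<bar>?b\<bar> * ?N + sqrt Y"
    unfolding vnorm_scale using vx by (simp add: vnorm_def)
  finally have "?N \<le> \<bar>?b\<bar> * ?N + sqrt Y" .
  have N: "sqrt (frob_sq (dk 1) d (V 1) - Y) \<le> ?N"
    using Y by (intro real_sqrt_le_mono) (simp add: off_axis_def)
  have r0: "0 < sqrt (frob_sq (dk 1) d (V 1) - Y)" using pos by simp
  have N0: "0 < ?N" using r0 N by linarith
  have "1 - \<bar>?b\<bar> \<le> sqrt Y / ?N" using \<open>?N \<le> \<bar>?b\<bar> * ?N + sqrt Y\<close> N0 by (simp add: field_simps)
  also have "\<dots> \<le> sqrt Y / sqrt (frob_sq (dk 1) d (V 1) - Y)"
    using N r0 N0 off0 Y by (intro divide_left_mono) auto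
  finally show ?thesis by simp
qed

lemma F0_at_top: "filterlim (\<lambda>t. F t 0 - Y) at_top sequentially"
proof (rule filterlim_at_top_mono)
  show "filterlim (\<lambda>t. - (D + Y) + ts t) at_top sequentially"
    by (intro filterlim_tendsto_add_at_top[OF tendsto_const] ts_at_top)
  have "- (D + Y) + ts t \<le> F t 0 - Y" for t
    using F_near_top[of 0 t] L_ge2 by (simp add: abs_le_iff)
  then show "\<forall>\<^sub>F t in sequentially. - (D + Y) + ts t \<le> F t 0 - Y" by (rule always_eventually[OF allI])
qed

lemma singular_vector_limit:
  assumes v: "\<And>t. top_right_sing_vec (dk 1) d (W t 1) (v1 t)"
  shows "(\<lambda>t. \<bar>vinner d (v1 t) ub\<bar>) \<longlonglongrightarrow> 1"
proof -
  obtain Y where Y: "\<forall>\<^sub>F t in sequentially. off_axis (W t) ub \<le> Y" using off_axis_bounded by blast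
  have top: "filterlim (\<lambda>t. F t 0 - Y) at_top sequentially" by (rule F0_at_top)
  then have pos: "\<forall>\<^sub>F t in sequentially. 0 < F t 0 - Y" unfolding filterlim_at_top_dense by blast
  show ?thesis
  proof (rule tendsto_sandwich)
    show "\<forall>\<^sub>F t in sequentially. 1 - sqrt Y / sqrt (F t 0 - Y) \<le> \<bar>vinner d (v1 t) ub\<bar>"
      using Y pos
    proof eventually_elim
      case (elim t)
      then show ?case using singular_vector_alignment[of "W t", OF v] by simp
    qed
    show "\<forall>\<^sub>F t in sequentially. \<bar>vinner d (v1 t) ub\<bar> \<le> 1"
    proof (rule always_eventually, rule allI)
      fix t
      have "vnorm d (v1 t) = 1" using v[of t] by (simp add: top_right_sing_vec_def Let_def unit_vec_def)
      then show "\<bar>vinner d (v1 t) ub\<bar> \<le> 1"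
        using vinner_abs_le[of d "v1 t" ub] nsq_ub by (simp add: vnorm_def)
    qed
    have "filterlim (\<lambda>t. sqrt (F t 0 - Y)) at_infinity sequentially"
      by (intro filterlim_at_top_imp_at_infinity filterlim_compose[OF sqrt_at_top top])
    then have "(\<lambda>t. 1 - sqrt Y / sqrt (F t 0 - Y)) \<longlonglongrightarrow> 1 - 0"
      by (intro tendsto_diff tendsto_const tendsto_divide_0[OF tendsto_const])
    then show "(\<lambda>t. 1 - sqrt Y / sqrt (F t 0 - Y)) \<longlonglongrightarrow> 1" by simp
  qed (rule tendsto_const)
qed

lemma prod_frob_sq: "(\<Prod>k=1..L. frob dk (W t) k)\<^sup>2 = (\<Prod>j<L. F t j)"
proof -
  have "(\<Prod>k=1..L. frob dk (W t) k) = (\<Prod>j<L. frob dk (W t) (Suc j))"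
    by (simp add: prod.atLeast1_atMost_eq)
  then show ?thesis by (simp add: prod_power_distrib frob_power2)
qed

text \<open>The power compares the balanced lower bound on the product with the upper bound on the
  product of layer norms. The term \<open>Y / (ts t - D)\<close> is the share of the orthogonal
  part, whose squared norm is at most \<open>p1 t * Y\<close> while the squared denominator is at
  least \<open>p1 t * F t 0\<close>.\<close>

lemma product_distance:
  assumes Y: "off_axis (W t) ub \<le> Y" and ts: "real L * C < ts t" "D < ts t" "0 \<le> vinner d (pr t) ub"
  shows "(vnorm d (\<lambda>j. wprod L dk (W t) j / (\<Prod>k=1..L. frob dk (W t) k) - ub j))\<^sup>2
    \<le> 2 - 2 * (((ts t - real L * C) / (ts t + D)) ^ L - Y / (ts t - D))"
proof -
  let ?N = "\<Prod>k=1..L. frob dk (W t) k" and ?a = "vinner d (pr t) ub"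
  have low: "(ts t - real L * C) ^ L \<le> nsq d (pr t)"
    using bwd_lower[where W = "W t" and k = 0, OF C_nonneg balanced] ts(1) by simp
  have "0 < (ts t - real L * C) ^ L" using ts(1) by simp
  then have "0 < ?N\<^sup>2" using low nsq_pr_le_prod[of t] unfolding prod_frob_sq by linarith
  moreover have "0 \<le> ?N" by (intro prod_nonneg) auto
  ultimately have N0: "0 < ?N" by (auto simp: less_le)
  have N_up: "?N\<^sup>2 \<le> (ts t + D) ^ L"
  proof -
    have "(\<Prod>j<L. F t j) \<le> (\<Prod>j<L. ts t + D)"
      using F_near_top[of _ t] by (intro prod_mono) (auto simp: abs_le_iff algebra_simps)
    then show ?thesis unfolding prod_frob_sq by simp
  qed
  have off0: "0 \<le> off_axis (W t) ub" by (rule off_axis_ge0[OF nsq_ub])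
  have F0: "ts t - D \<le> F t 0" using F_near_top[of 0 t] L_ge2 by (simp add: abs_le_iff)
  have part: "p1 t * F t 0 \<le> ?N\<^sup>2"
  proof -
    have "p1 t \<le> (\<Prod>j\<in>{1..<L}. F t j)" using bwd_upper[of 1 "W t"] L_ge2 by simp
    then have "p1 t * F t 0 \<le> (\<Prod>j\<in>{1..<L}. F t j) * F t 0" by (intro mult_right_mono) auto
    also have "\<dots> = (\<Prod>j<L. F t j)"
    proof -
      have "{..<L} = insert 0 {1..<L}" using L_ge2 by auto
      then show ?thesis by simp
    qed
    finally show ?thesis unfolding prod_frob_sq .
  qed
  have perp: "nsq d (perp (W t) ub) / ?N\<^sup>2 \<le> Y / (ts t - D)"
  proof -
    have "nsq d (perp (W t) ub) * (ts t - D) \<le> (p1 t * Y) * F t 0"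
      using nsq_perp_upper[OF nsq_ub, of "W t"] Y off0 F0 ts(2)
      by (intro mult_mono order_trans[OF nsq_perp_upper[OF nsq_ub]] mult_left_mono mult_nonneg_nonneg) auto
    also have "\<dots> = Y * (p1 t * F t 0)" by simp
    also have "\<dots> \<le> Y * ?N\<^sup>2" using Y off0 part by (intro mult_left_mono) auto
    finally have le: "nsq d (perp (W t) ub) * (ts t - D) \<le> Y * ?N\<^sup>2" .
    have "0 < ts t - D" using ts(2) by simp
    moreover have "0 < ?N\<^sup>2" using N0 by (rule zero_less_power)
    ultimately show ?thesis
      by (simp only: pos_le_divide_eq times_divide_eq_left pos_divide_le_eq le)
  qed
  have "((ts t - real L * C) / (ts t + D)) ^ L \<le> nsq d (pr t) / ?N\<^sup>2"
    unfolding power_divide by (rule frac_le[OF vinner_self_ge0 low zero_less_power[OF N0] N_up])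
  moreover have "(?a / ?N)\<^sup>2 = nsq d (pr t) / ?N\<^sup>2 - nsq d (perp (W t) ub) / ?N\<^sup>2"
    unfolding nsq_perp[OF nsq_ub] by (simp add: power_divide diff_divide_distrib)
  ultimately have sq: "((ts t - real L * C) / (ts t + D)) ^ L - Y / (ts t - D) \<le> (?a / ?N)\<^sup>2"
    using perp by linarith
  have le1: "nsq d (pr t) / ?N\<^sup>2 \<le> 1" unfolding divide_le_eq_1_pos[OF zero_less_power[OF N0]] unfolding prod_frob_sq by (rule nsq_pr_le_prod)
  have "(?a / ?N)\<^sup>2 \<le> nsq d (pr t) / ?N\<^sup>2"
    unfolding power_divide using vinner_Cauchy_Schwarz[of d "pr t" ub] nsq_ub by (intro divide_right_mono) auto
  then have "(?a / ?N)\<^sup>2 \<le> 1\<^sup>2" using le1 by simp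
  then have "?a / ?N \<le> 1" by (rule power2_le_imp_le) simp
  \<comment> \<open>A number between 0 and 1 dominates its square, so the bound on the squared
    component along \<open>ub\<close> passes to the component itself.\<close>
  then have "(?a / ?N)\<^sup>2 \<le> ?a / ?N"
    using ts(3) N0 mult_left_mono[of "?a / ?N" 1 "?a / ?N"] by (simp add: power2_eq_square)
  with sq have r: "((ts t - real L * C) / (ts t + D)) ^ L - Y / (ts t - D) \<le> ?a / ?N" by linarith
  have "(vnorm d (\<lambda>j. wprod L dk (W t) j / ?N - ub j))\<^sup>2 = nsq d (\<lambda>j. (1 / ?N) * pr t j - 1 * ub j)"
    unfolding vnorm_sq using L_ge2 dk_top by (intro vinner_cong) (auto simp: wprod_eq_bwd)
  also have "\<dots> = nsq d (pr t) / ?N\<^sup>2 - 2 * (?a / ?N) + 1"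
    unfolding nsq_diff_scale vinner_scale_left vinner_scale_right nsq_ub by (simp add: power2_eq_square)
  finally have eq: "(vnorm d (\<lambda>j. wprod L dk (W t) j / ?N - ub j))\<^sup>2
    = nsq d (pr t) / ?N\<^sup>2 - 2 * (?a / ?N) + 1" .
  have "x \<le> 2 - 2 * l" if "x = q - 2 * b + 1" "q \<le> 1" "l \<le> b" for x q b l :: real
    using that by linarith
  from this[OF eq le1 r] show ?thesis .
qed

lemma product_limit:
  "(\<lambda>t. vnorm d (\<lambda>j. wprod L dk (W t) j / (\<Prod>k=1..L. frob dk (W t) k) - ub j)) \<longlonglongrightarrow> 0"
proof -
  let ?e = "\<lambda>t. vnorm d (\<lambda>j. wprod L dk (W t) j / (\<Prod>k=1..L. frob dk (W t) k) - ub j)"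
  obtain Y where Y: "\<forall>\<^sub>F t in sequentially. off_axis (W t) ub \<le> Y" using off_axis_bounded by blast
  obtain \<alpha> where \<alpha>: "0 < \<alpha>" "\<And>\<xi>. vinner d ub \<xi> = 0 \<Longrightarrow> \<exists>i\<in>supp. vinner d \<xi> (z i) \<le> - \<alpha> * vnorm d \<xi>"
    using support_vector_uniform[OF a3 gp] by blast
  let ?u = "\<lambda>t. 2 - 2 * (((ts t - real L * C) / (ts t + D)) ^ L - Y / (ts t - D))"
  have "\<forall>\<^sub>F t in sequentially. max (real L * C) D < ts t"
    using ts_at_top unfolding filterlim_at_top_dense by blast
  then have ts: "\<forall>\<^sub>F t in sequentially. real L * C < ts t \<and> D < ts t" by simp
  have "\<forall>\<^sub>F t in sequentially. (?e t)\<^sup>2 \<le> ?u t"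
    using Y ts eventually_marg_ge[of 0]
  proof eventually_elim
    case (elim t)
    \<comment> \<open>The sign excludes the limit \<open>- ub\<close>, which the squared estimates
      cannot distinguish from \<open>ub\<close>.\<close>
    have "0 \<le> vinner d (pr t) ub"
      by (rule gradient_points_to_ubar(1)[OF \<alpha> _ refl]) (use elim in \<open>auto simp: marg_pr\<close>)
    then show ?case using elim by (intro product_distance) auto
  qed
  then have "\<forall>\<^sub>F t in sequentially. norm ((?e t)\<^sup>2) \<le> ?u t" by simp
  moreover have "?u \<longlonglongrightarrow> 0"
  proof -
    have inf: "filterlim (\<lambda>t. ts t + c) at_infinity sequentially" for c
      using filterlim_tendsto_add_at_top[OF tendsto_const ts_at_top, of c]
      by (intro filterlim_at_top_imp_at_infinity) (simp add: add.commute)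
    have lim0: "(\<lambda>t. b / (ts t + c)) \<longlonglongrightarrow> 0" for b c
      by (intro tendsto_divide_0[OF tendsto_const] inf)
    have "(\<lambda>t. 1 - (real L * C + D) / (ts t + D)) \<longlonglongrightarrow> 1 - 0"
      by (intro tendsto_diff tendsto_const lim0)
    moreover have "\<forall>\<^sub>F t in sequentially. 1 - (real L * C + D) / (ts t + D) = (ts t - real L * C) / (ts t + D)"
      using ts by eventually_elim (use D_nonneg in \<open>simp add: field_simps\<close>)
    ultimately have "(\<lambda>t. (ts t - real L * C) / (ts t + D)) \<longlonglongrightarrow> 1 - 0"
      by (rule Lim_transform_eventually)
    then have "?u \<longlonglongrightarrow> 2 - 2 * ((1 - 0) ^ L - 0)"
      using lim0[of Y "- D"] by (intro tendsto_diff tendsto_mult tendsto_power tendsto_const) auto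
    then show ?thesis by simp
  qed
  ultimately have "(\<lambda>t. (?e t)\<^sup>2) \<longlonglongrightarrow> 0"
    by (rule Lim_null_comparison)
  then have "(\<lambda>t. sqrt ((?e t)\<^sup>2)) \<longlonglongrightarrow> sqrt 0" by (rule tendsto_real_sqrt)
  then show ?thesis by simp
qed

end

theorem mainTheorem13:
  fixes n d L :: nat and dk :: "nat \<Rightarrow> nat" and y :: "nat \<Rightarrow> real"
  assumes "n \<ge> 1" and "L \<ge> 2"
    and "dk 0 = d" and "dk L = 1" and "\<forall>k\<le>L. dk k \<ge> 1"
    and "\<forall>i<n. y i \<in> {-1, 1}"
  shows "AE X in PiM ({..<n} \<times> {..<d}) (\<lambda>_. lborel).
    (let z = (\<lambda>i j. y i * X (i, j)) in
     (\<forall>i<n. vnorm d (\<lambda>j. X (i, j)) \<le> 1) \<longrightarrow>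
     lin_separable n d z \<longrightarrow>
     assumption3 n d z \<longrightarrow>
     (\<forall>(W :: nat \<Rightarrow> nat \<Rightarrow> nat \<Rightarrow> nat \<Rightarrow> real) (Rad :: nat \<Rightarrow> real) (eta :: nat \<Rightarrow> real)
        (v1 :: nat \<Rightarrow> nat \<Rightarrow> real).
        wf_net L dk (W 0) \<longrightarrow>
        (\<exists>k i j. grad L dk (risk logistic n d z L dk) (W 0) k i j \<noteq> 0) \<longrightarrow>
        risk logistic n d z L dk (W 0) \<le> logistic 0 \<longrightarrow>
        (\<forall>t. eta t = min (1 / betaR L (1/4) 1 (Rad t)) 1) \<longrightarrow>
        (\<forall>t. in_ball L dk (Rad t - 1) (W t)) \<longrightarrow>
        (\<forall>t. in_ball L dk (Rad t - 1) (W (Suc t)) \<longrightarrow> Rad (Suc t) = Rad t) \<longrightarrow>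
        (\<forall>t. W (Suc t) = (\<lambda>k i j. W t k i j - eta t * grad L dk (risk logistic n d z L dk) (W t) k i j)) \<longrightarrow>
        (\<forall>t. top_right_sing_vec (dk 1) d (W t 1) (v1 t)) \<longrightarrow>
        ((\<lambda>t. \<bar>vinner d (v1 t) (ubar n d z)\<bar>) \<longlonglongrightarrow> 1) \<and>
        ((\<lambda>t. vnorm d (\<lambda>j. wprod L dk (W t) j / (\<Prod>k=1..L. frob dk (W t) k) - ubar n d z j))
           \<longlonglongrightarrow> 0)))"
proof -
  have "AE X in PiM ({..<n} \<times> {..<d}) (\<lambda>_. lborel). \<not> degenerate n d (\<lambda>i j. y i * X (i, j))"
    using assms(6) by (intro AE_not_degenerate) force
  then show ?thesis
  proof (rule AE_mp, intro AE_I2 impI, unfold Let_def, intro impI allI)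
    fix X W Rad eta v1
    let ?z = "\<lambda>i (j :: nat). y i * X (i, j)"
    assume gp: "\<not> degenerate n d ?z" and bounded: "\<forall>i<n. vnorm d (\<lambda>j. X (i, j)) \<le> 1"
      and sep: "lin_separable n d ?z" and a3: "assumption3 n d ?z"
      and run: "\<exists>k i j. grad L dk (risk logistic n d ?z L dk) (W 0) k i j \<noteq> 0"
        "risk logistic n d ?z L dk (W 0) \<le> logistic 0"
        "\<forall>t. eta t = min (1 / betaR L (1/4) 1 (Rad t)) 1"
        "\<forall>t. in_ball L dk (Rad t - 1) (W t)"
        "\<forall>t. in_ball L dk (Rad t - 1) (W (Suc t)) \<longrightarrow> Rad (Suc t) = Rad t"
        "\<forall>t. W (Suc t) = (\<lambda>k i j. W t k i j - eta t * grad L dk (risk logistic n d ?z L dk) (W t) k i j)"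
      and v1: "\<forall>t. top_right_sing_vec (dk 1) d (W t 1) (v1 t)"
    have "nsq d (?z i) \<le> 1" if "i < n" for i
    proof -
      have "nsq d (?z i) = (y i)\<^sup>2 * (vnorm d (\<lambda>j. X (i, j)))\<^sup>2"
        unfolding vnorm_sq by (simp add: vinner_linear power2_eq_square)
      also have "(y i)\<^sup>2 = 1" using assms(6) that by force
      also have "(vnorm d (\<lambda>j. X (i, j)))\<^sup>2 \<le> 1"
        using bounded that by (simp add: power_le_one)
      finally show ?thesis by simp
    qed
    then interpret gd_run n L dk ?z W Rad eta
      using assms gp sep a3 run by unfold_locales auto
    show "((\<lambda>t. \<bar>vinner d (v1 t) (ubar n d ?z)\<bar>) \<longlonglongrightarrow> 1) \<and>
        ((\<lambda>t. vnorm d (\<lambda>j. wprod L dk (W t) j / (\<Prod>k=1..L. frob dk (W t) k) - ubar n d ?z j))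
           \<longlonglongrightarrow> 0)"
      using singular_vector_limit[of v1] product_limit v1 assms(3) by simp
  qed
qed

end
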